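(* Let $G$ be a totally disconnected, locally compact group, $\alpha$ an automorphism of $G$ of infinite order with $s(\alpha^{-1})>1$, and $V$ a compact open subgroup of $G$ tidy for $\alpha$. Let $\mu$ be a Borel probability measure on $V_{--}\rtimes\langle\alpha\rangle$ such that the closure of the semigroup generated by the support of $\mu$ is a closed, non-exceptional subgroup $\Gamma$ of $V_{--}\rtimes\langle\alpha\rangle$. Suppose that $\mu$ is aperiodic, spread-out and has finite first moment with respect to $|\cdot|_{V_{--}\rtimes\langle\alpha\rangle}$. Then $m_1(\eta_*\mu)\le0$ if and only if the Poisson boundary of $(V_{--}\rtimes\langle\alpha\rangle,\mu)$ is trivial.
   Context: Tidy subgroups. For a (bicontinuous) automorphism $\alpha$ of $G$ and a compact open subgroup $V$, put $V_+=\bigcap_{k\ge0}\alpha^k(V)$, $V_-=\bigcap_{k\ge0}\alpha^{-k}(V)$, $V_{++}=\bigcup_{k\ge0}\alpha^k(V_+)$, $V_{--}=\bigcup_{k\ge0}\alpha^{-k}(V_-)$. $V$ is tidy for $\alpha$ if $V=V_+V_-$ and $V_{++}$ is closed (equivalently $V_{--}$ is closed). The scale is $s(\alpha)=\min\{[\alpha(U):U\cap\alpha(U)] : U \text{ a compact open subgroup of } G\}$. Group and tree. $H:=V_{--}\rtimes\langle\alpha\rangle$ has elements $(v,n)$, $v\in V_{--}$, $n\in\mathbb{Z}$, product $(v,m)(w,n)=(v\alpha^m(w),m+n)$, and the product topology with $\mathbb{Z}$ discrete; it is assumed second countable. $V_-$ is identified with $V_-\times\{0\}$. The vertices of the graph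 $\mathcal{T}$ are the left cosets of $V_-$ in $H$; the coset of $(v,m)$ is also written $(v,m)$. There is an edge from $(v,m)$ to $(w,n)$ iff $n=m+1$ and $w\in v\alpha^m(V_-)$. Forgetting directions, $\mathcal{T}$ is a homogeneous tree of degree $s(\alpha^{-1})+1\ge3$, and $H$ acts on it by left multiplication. An end is an equivalence class of geodesic rays (equivalent when their intersection is infinite). $\omega$ is the end of the ray $\{(e,-n)\}_{n\in\mathbb{N}}$; it is fixed by $H$. The distinguished vertex is $V_-=(e,0)$. Let $\operatorname{Aff}\mathcal{T}$ be the group of automorphisms of $\mathcal{T}$ fixing $\omega$, $\pi:H\to\operatorname{Aff}\mathcal{T}$ the action homomorphism, and $\eta:H\to\mathbb{Z}$, $\eta(v,n)=n$. Then $\eta=\phi\circ\pi$, where $\phi(\gamma)=d(\gamma o,c)-d(o,c)$ with $o=V_-$ and $c$ the first common vertex of the rays from $\gamma o$ and $o$ to $\omega$. Put $\operatorname{Hor}\mathcal{T}=\ker\phi$. A subgroup of $\operatorname{Aff}\mathcal{T}$ is exceptional if it is contained in $\operatorname{Hor}\mathcal{T}$ or all of its elements fix a common end other than $\omega$. A closed subgroup $\Gamma\le H$ is non-exceptional if $\pi(\Gamma)$ is not exceptional. Measures. $|g|_H=d(V_-,gV_-)$ (graph distance in $\mathcal{T}$); finite first moment means $\int_H|g|_H\,d\mu(g)<\infty$. $\mu$ is spread-out if some convolution power $\mu^{*n}$ is not singular with respect to Haar measure on $H$. $\mu$ is aperiodic if, regarded as a measure on $\Gamma$, its support is not contained in a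 proper closed subgroup of $\Gamma$. $m_1(\eta_*\mu)=\int_{\mathbb{Z}}z\,d\eta_*\mu(z)$ is the mean. Poisson boundary. It is understood for the walk with $\mu$ regarded as a measure on $\Gamma$: for i.i.d. $\mu$-distributed $X_1,X_2,\dots$ let $R_n=X_1\cdots X_n$. A $\Gamma$-space $B$ with a $\mu$-stationary probability measure $\nu$ ($\mu*\nu=\nu$) is a $\mu$-boundary if for almost every path $R_n\cdot\nu$ converges weak* to a point mass. It is the Poisson boundary if moreover $P_\nu\varphi(g)=\int_B\varphi(gb)\,d\nu(b)$ is an isometric isomorphism from $L^\infty(B,\nu)$ onto the space of bounded $\mu$-harmonic functions $f$ on $\Gamma$ ($f(g)=\int f(gx)\,d\mu(x)$). It is trivial if $\nu$ is a point mass, equivalently if every bounded $\mu$-harmonic function on $\Gamma$ is constant. *)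

theory Defs
  imports
    "HOL-Algebra.Left_Coset"
    "HOL-Algebra.Group_Action"
    "HOL-Probability.Probability"
begin

definition topological_group :: "('a, 'm) monoid_scheme \<Rightarrow> 'a topology \<Rightarrow> bool" where
  "topological_group G T \<longleftrightarrow>
     group G \<and> topspace T = carrier G \<and>
     continuous_map (prod_topology T T) T (\<lambda>(x, y). x \<otimes>\<^bsub>G\<^esub> y) \<and>
     continuous_map T T (\<lambda>x. inv\<^bsub>G\<^esub> x)"

definition totally_disconnected_space :: "'a topology \<Rightarrow> bool" where
  "totally_disconnected_space T \<longleftrightarrow> (\<forall>C. connectedin T C \<longrightarrow> (\<exists>a. C \<subseteq> {a}))"

definition tdlc_group :: "('a, 'm) monoid_scheme \<Rightarrow> 'a topology \<Rightarrow> bool" where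
  "tdlc_group G T \<longleftrightarrow>
     topological_group G T \<and> Hausdorff_space T \<and>
     locally_compact_space T \<and> totally_disconnected_space T"

definition topological_auto :: "('a, 'm) monoid_scheme \<Rightarrow> 'a topology \<Rightarrow> ('a \<Rightarrow> 'a) set" where
  "topological_auto G T = {\<alpha> \<in> auto G. homeomorphic_map T T \<alpha>}"

definition compact_open_subgroup :: "('a, 'm) monoid_scheme \<Rightarrow> 'a topology \<Rightarrow> 'a set \<Rightarrow> bool" where
  "compact_open_subgroup G T U \<longleftrightarrow> subgroup U G \<and> openin T U \<and> compactin T U"

text \<open>Only used for open subgroups of compact groups, where the index is finite.\<close>

definition subgroup_index :: "('a, 'm) monoid_scheme \<Rightarrow> 'a set \<Rightarrow> 'a set \<Rightarrow> nat" where
  "subgroup_index G K L = card (rcosets\<^bsub>G\<lparr>carrier := K\<rparr>\<^esub> L)"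

definition aut_scale :: "('a, 'm) monoid_scheme \<Rightarrow> 'a topology \<Rightarrow> ('a \<Rightarrow> 'a) \<Rightarrow> nat" where
  "aut_scale G T \<alpha> =
     (LEAST n. \<exists>U. compact_open_subgroup G T U \<and> n = subgroup_index G (\<alpha> ` U) (U \<inter> \<alpha> ` U))"

abbreviation aut_pow :: "('a, 'm) monoid_scheme \<Rightarrow> ('a \<Rightarrow> 'a) \<Rightarrow> int \<Rightarrow> 'a \<Rightarrow> 'a" where
  "aut_pow G \<alpha> n \<equiv> \<alpha> [^]\<^bsub>AutoGroup G\<^esub> n"

definition V_plus :: "('a, 'm) monoid_scheme \<Rightarrow> ('a \<Rightarrow> 'a) \<Rightarrow> 'a set \<Rightarrow> 'a set" where
  "V_plus G \<alpha> V = (\<Inter>k::nat. aut_pow G \<alpha> (int k) ` V)"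

definition V_minus :: "('a, 'm) monoid_scheme \<Rightarrow> ('a \<Rightarrow> 'a) \<Rightarrow> 'a set \<Rightarrow> 'a set" where
  "V_minus G \<alpha> V = (\<Inter>k::nat. aut_pow G \<alpha> (- int k) ` V)"

definition V_plusplus :: "('a, 'm) monoid_scheme \<Rightarrow> ('a \<Rightarrow> 'a) \<Rightarrow> 'a set \<Rightarrow> 'a set" where
  "V_plusplus G \<alpha> V = (\<Union>k::nat. aut_pow G \<alpha> (int k) ` V_plus G \<alpha> V)"

definition V_minusminus :: "('a, 'm) monoid_scheme \<Rightarrow> ('a \<Rightarrow> 'a) \<Rightarrow> 'a set \<Rightarrow> 'a set" where
  "V_minusminus G \<alpha> V = (\<Union>k::nat. aut_pow G \<alpha> (- int k) ` V_minus G \<alpha> V)"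

definition tidy :: "('a, 'm) monoid_scheme \<Rightarrow> 'a topology \<Rightarrow> ('a \<Rightarrow> 'a) \<Rightarrow> 'a set \<Rightarrow> bool" where
  "tidy G T \<alpha> V \<longleftrightarrow>
     V = V_plus G \<alpha> V <#>\<^bsub>G\<^esub> V_minus G \<alpha> V \<and> closedin T (V_plusplus G \<alpha> V)"

definition semidirect :: "('a, 'm) monoid_scheme \<Rightarrow> ('a \<Rightarrow> 'a) \<Rightarrow> 'a set \<Rightarrow> ('a \<times> int) monoid" where
  "semidirect G \<alpha> V =
     \<lparr>carrier = V_minusminus G \<alpha> V \<times> UNIV,
      monoid.mult = (\<lambda>(v, m) (w, n). (v \<otimes>\<^bsub>G\<^esub> aut_pow G \<alpha> m w, m + n)),
      one = (\<one>\<^bsub>G\<^esub>, 0)\<rparr>"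

definition semidirect_top ::
  "('a, 'm) monoid_scheme \<Rightarrow> 'a topology \<Rightarrow> ('a \<Rightarrow> 'a) \<Rightarrow> 'a set \<Rightarrow> ('a \<times> int) topology" where
  "semidirect_top G T \<alpha> V =
     prod_topology (subtopology T (V_minusminus G \<alpha> V)) (discrete_topology UNIV)"

definition eta :: "'a \<times> int \<Rightarrow> int" where
  "eta = snd"

text \<open>A graph is given by a vertex set \<open>X\<close> and a symmetric relation \<open>E\<close> on it.\<close>

definition gdist :: "'v rel \<Rightarrow> 'v \<Rightarrow> 'v \<Rightarrow> nat" where
  "gdist E x y = (LEAST n. (x, y) \<in> E ^^ n)"

text \<open>The requirement of a path in \<open>geodesic_rays\<close> excludes the arbitrary value of \<open>gdist\<close> on
  vertices in different components.\<close>

definition geodesic_rays :: "'v set \<Rightarrow> 'v rel \<Rightarrow> (nat \<Rightarrow> 'v) set" where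
  "geodesic_rays X E =
     {r. range r \<subseteq> X \<and> (\<forall>i j. i \<le> j \<longrightarrow> (r i, r j) \<in> E\<^sup>* \<and> gdist E (r i) (r j) = j - i)}"

definition ray_equiv :: "'v set \<Rightarrow> 'v rel \<Rightarrow> (nat \<Rightarrow> 'v) rel" where
  "ray_equiv X E =
     {(r, s). r \<in> geodesic_rays X E \<and> s \<in> geodesic_rays X E \<and> infinite (range r \<inter> range s)}"

definition ends :: "'v set \<Rightarrow> 'v rel \<Rightarrow> (nat \<Rightarrow> 'v) set set" where
  "ends X E = geodesic_rays X E // ray_equiv X E"

definition end_act :: "('v \<Rightarrow> 'v) \<Rightarrow> (nat \<Rightarrow> 'v) set \<Rightarrow> (nat \<Rightarrow> 'v) set" where
  "end_act \<gamma> \<xi> = (\<lambda>r. \<gamma> \<circ> r) ` \<xi>"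

definition graph_aut :: "'v set \<Rightarrow> 'v rel \<Rightarrow> ('v \<Rightarrow> 'v) set" where
  "graph_aut X E = {\<gamma> \<in> Bij X. \<forall>x\<in>X. \<forall>y\<in>X. (\<gamma> x, \<gamma> y) \<in> E \<longleftrightarrow> (x, y) \<in> E}"

definition Aff :: "'v set \<Rightarrow> 'v rel \<Rightarrow> (nat \<Rightarrow> 'v) set \<Rightarrow> ('v \<Rightarrow> 'v) set" where
  "Aff X E \<omega> = {\<gamma> \<in> graph_aut X E. end_act \<gamma> \<omega> = \<omega>}"

text \<open>In a tree there is exactly one geodesic ray from a given vertex to a given end.\<close>

definition ray_to :: "(nat \<Rightarrow> 'v) set \<Rightarrow> 'v \<Rightarrow> nat \<Rightarrow> 'v" where
  "ray_to \<omega> x = (THE r. r \<in> \<omega> \<and> r 0 = x)"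

definition first_common :: "(nat \<Rightarrow> 'v) set \<Rightarrow> 'v \<Rightarrow> 'v \<Rightarrow> 'v" where
  "first_common \<omega> x y = ray_to \<omega> x (LEAST i. ray_to \<omega> x i \<in> range (ray_to \<omega> y))"

definition horo_shift :: "'v rel \<Rightarrow> (nat \<Rightarrow> 'v) set \<Rightarrow> 'v \<Rightarrow> ('v \<Rightarrow> 'v) \<Rightarrow> int" where
  "horo_shift E \<omega> o' \<gamma> =
     int (gdist E (\<gamma> o') (first_common \<omega> (\<gamma> o') o')) - int (gdist E o' (first_common \<omega> (\<gamma> o') o'))"

definition Hor :: "'v set \<Rightarrow> 'v rel \<Rightarrow> (nat \<Rightarrow> 'v) set \<Rightarrow> 'v \<Rightarrow> ('v \<Rightarrow> 'v) set" where
  "Hor X E \<omega> o' = {\<gamma> \<in> Aff X E \<omega>. horo_shift E \<omega> o' \<gamma> = 0}"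

text \<open>The last argument is a subgroup of \<open>Aff X E \<omega>\<close>.\<close>

definition exceptional :: "'v set \<Rightarrow> 'v rel \<Rightarrow> (nat \<Rightarrow> 'v) set \<Rightarrow> 'v \<Rightarrow> ('v \<Rightarrow> 'v) set \<Rightarrow> bool" where
  "exceptional X E \<omega> o' S \<longleftrightarrow>
     S \<subseteq> Hor X E \<omega> o' \<or> (\<exists>\<xi>\<in>ends X E. \<xi> \<noteq> \<omega> \<and> (\<forall>\<gamma>\<in>S. end_act \<gamma> \<xi> = \<xi>))"

definition base_vertex :: "('a, 'm) monoid_scheme \<Rightarrow> ('a \<Rightarrow> 'a) \<Rightarrow> 'a set \<Rightarrow> ('a \<times> int) set" where
  "base_vertex G \<alpha> V = V_minus G \<alpha> V \<times> {0}"

definition tree_verts :: "('a, 'm) monoid_scheme \<Rightarrow> ('a \<Rightarrow> 'a) \<Rightarrow> 'a set \<Rightarrow> ('a \<times> int) set set" where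
  "tree_verts G \<alpha> V = lcosets\<^bsub>semidirect G \<alpha> V\<^esub> (base_vertex G \<alpha> V)"

definition vert :: "('a, 'm) monoid_scheme \<Rightarrow> ('a \<Rightarrow> 'a) \<Rightarrow> 'a set \<Rightarrow> 'a \<times> int \<Rightarrow> ('a \<times> int) set" where
  "vert G \<alpha> V h = h <#\<^bsub>semidirect G \<alpha> V\<^esub> base_vertex G \<alpha> V"

definition tree_arcs :: "('a, 'm) monoid_scheme \<Rightarrow> ('a \<Rightarrow> 'a) \<Rightarrow> 'a set \<Rightarrow> ('a \<times> int) set rel" where
  "tree_arcs G \<alpha> V =
     {(vert G \<alpha> V (v, m), vert G \<alpha> V (w, n)) | v m w n.
        v \<in> V_minusminus G \<alpha> V \<and> w \<in> V_minusminus G \<alpha> V \<and>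
        n = m + 1 \<and> w \<in> v <#\<^bsub>G\<^esub> (aut_pow G \<alpha> m ` V_minus G \<alpha> V)}"

definition tree_edges :: "('a, 'm) monoid_scheme \<Rightarrow> ('a \<Rightarrow> 'a) \<Rightarrow> 'a set \<Rightarrow> ('a \<times> int) set rel" where
  "tree_edges G \<alpha> V = tree_arcs G \<alpha> V \<union> (tree_arcs G \<alpha> V)\<inverse>"

definition omega_end ::
  "('a, 'm) monoid_scheme \<Rightarrow> ('a \<Rightarrow> 'a) \<Rightarrow> 'a set \<Rightarrow> (nat \<Rightarrow> ('a \<times> int) set) set" where
  "omega_end G \<alpha> V =
     ray_equiv (tree_verts G \<alpha> V) (tree_edges G \<alpha> V) `` {\<lambda>n. vert G \<alpha> V (\<one>\<^bsub>G\<^esub>, - int n)}"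

definition tree_act ::
  "('a, 'm) monoid_scheme \<Rightarrow> ('a \<Rightarrow> 'a) \<Rightarrow> 'a set \<Rightarrow> 'a \<times> int \<Rightarrow> ('a \<times> int) set \<Rightarrow> ('a \<times> int) set" where
  "tree_act G \<alpha> V h = (\<lambda>x \<in> tree_verts G \<alpha> V. h <#\<^bsub>semidirect G \<alpha> V\<^esub> x)"

definition non_exceptional :: "('a, 'm) monoid_scheme \<Rightarrow> ('a \<Rightarrow> 'a) \<Rightarrow> 'a set \<Rightarrow> ('a \<times> int) set \<Rightarrow> bool" where
  "non_exceptional G \<alpha> V \<Gamma> \<longleftrightarrow>
     \<not> exceptional (tree_verts G \<alpha> V) (tree_edges G \<alpha> V) (omega_end G \<alpha> V) (base_vertex G \<alpha> V)
         (tree_act G \<alpha> V ` \<Gamma>)"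

definition tree_length :: "('a, 'm) monoid_scheme \<Rightarrow> ('a \<Rightarrow> 'a) \<Rightarrow> 'a set \<Rightarrow> 'a \<times> int \<Rightarrow> nat" where
  "tree_length G \<alpha> V g = gdist (tree_edges G \<alpha> V) (base_vertex G \<alpha> V) (tree_act G \<alpha> V g (base_vertex G \<alpha> V))"

definition finite_first_moment ::
  "('a, 'm) monoid_scheme \<Rightarrow> ('a \<Rightarrow> 'a) \<Rightarrow> 'a set \<Rightarrow> ('a \<times> int) measure \<Rightarrow> bool" where
  "finite_first_moment G \<alpha> V \<mu> \<longleftrightarrow>
     (\<integral>\<^sup>+ g. ennreal (real (tree_length G \<alpha> V g)) \<partial>\<mu>) < \<infinity>"

definition borel_of :: "'a topology \<Rightarrow> 'a measure" where
  "borel_of T = sigma (topspace T) {U. openin T U}"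

definition borel_prob :: "'a topology \<Rightarrow> 'a measure \<Rightarrow> bool" where
  "borel_prob T \<mu> \<longleftrightarrow> prob_space \<mu> \<and> sets \<mu> = sets (borel_of T)"

definition support_of :: "'a topology \<Rightarrow> 'a measure \<Rightarrow> 'a set" where
  "support_of T \<mu> = {x \<in> topspace T. \<forall>U. openin T U \<and> x \<in> U \<longrightarrow> emeasure \<mu> U > 0}"

inductive_set semigroup_generated :: "('a, 'm) monoid_scheme \<Rightarrow> 'a set \<Rightarrow> 'a set"
  for G (structure) and S where
    incl: "x \<in> S \<Longrightarrow> x \<in> semigroup_generated G S"
  | mult: "x \<in> semigroup_generated G S \<Longrightarrow> y \<in> semigroup_generated G S \<Longrightarrow>
             x \<otimes> y \<in> semigroup_generated G S"

text \<open>For second countable \<open>T\<close>, the product \<open>\<sigma>\<close>-algebra of two Borel \<open>\<sigma>\<close>-algebras is the Borel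
  \<open>\<sigma>\<close>-algebra of the product topology.\<close>

definition mconv ::
  "('a, 'm) monoid_scheme \<Rightarrow> 'a topology \<Rightarrow> 'a measure \<Rightarrow> 'a measure \<Rightarrow> 'a measure" where
  "mconv G T \<mu> \<nu> = distr (\<mu> \<Otimes>\<^sub>M \<nu>) (borel_of T) (\<lambda>(x, y). x \<otimes>\<^bsub>G\<^esub> y)"

primrec mconv_pow ::
  "('a, 'm) monoid_scheme \<Rightarrow> 'a topology \<Rightarrow> 'a measure \<Rightarrow> nat \<Rightarrow> 'a measure" where
  "mconv_pow G T \<mu> 0 = return (borel_of T) \<one>\<^bsub>G\<^esub>"
| "mconv_pow G T \<mu> (Suc n) = mconv G T \<mu> (mconv_pow G T \<mu> n)"

definition haar_measure :: "('a, 'm) monoid_scheme \<Rightarrow> 'a topology \<Rightarrow> 'a measure \<Rightarrow> bool" where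
  "haar_measure G T \<theta> \<longleftrightarrow>
     sets \<theta> = sets (borel_of T) \<and>
     (\<forall>g\<in>carrier G. \<forall>A\<in>sets \<theta>. emeasure \<theta> (g <#\<^bsub>G\<^esub> A) = emeasure \<theta> A) \<and>
     (\<forall>K. compactin T K \<longrightarrow> emeasure \<theta> K < \<infinity>) \<and>
     (\<forall>U. openin T U \<and> U \<noteq> {} \<longrightarrow> emeasure \<theta> U > 0) \<and>
     (\<forall>A\<in>sets \<theta>. emeasure \<theta> A = (INF U\<in>{U. openin T U \<and> A \<subseteq> U}. emeasure \<theta> U)) \<and>
     (\<forall>U. openin T U \<longrightarrow> emeasure \<theta> U = (SUP K\<in>{K. compactin T K \<and> K \<subseteq> U}. emeasure \<theta> K))"

definition mutually_singular :: "'a measure \<Rightarrow> 'a measure \<Rightarrow> bool" where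
  "mutually_singular \<mu> \<nu> \<longleftrightarrow>
     (\<exists>A. A \<in> sets \<mu> \<and> A \<in> sets \<nu> \<and> emeasure \<mu> A = 0 \<and> emeasure \<nu> (space \<nu> - A) = 0)"

definition spread_out :: "('a, 'm) monoid_scheme \<Rightarrow> 'a topology \<Rightarrow> 'a measure \<Rightarrow> bool" where
  "spread_out G T \<mu> \<longleftrightarrow>
     (\<exists>\<theta> n. haar_measure G T \<theta> \<and> n \<ge> 1 \<and> \<not> mutually_singular (mconv_pow G T \<mu> n) \<theta>)"

definition aperiodic :: "('a, 'm) monoid_scheme \<Rightarrow> 'a topology \<Rightarrow> 'a measure \<Rightarrow> bool" where
  "aperiodic G T \<mu> \<longleftrightarrow>
     (\<forall>K. subgroup K G \<and> closedin T K \<and> support_of T \<mu> \<subseteq> K \<longrightarrow> K = carrier G)"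

definition bounded_harmonic ::
  "('a, 'm) monoid_scheme \<Rightarrow> 'a topology \<Rightarrow> 'a measure \<Rightarrow> ('a \<Rightarrow> real) \<Rightarrow> bool" where
  "bounded_harmonic G T \<mu> f \<longleftrightarrow>
     f \<in> borel_measurable (borel_of T) \<and> bounded (f ` carrier G) \<and>
     (\<forall>g\<in>carrier G. f g = (\<integral>x. f (g \<otimes>\<^bsub>G\<^esub> x) \<partial>\<mu>))"

text \<open>A \<open>G\<close>-space is taken to be locally compact, Hausdorff and second countable, with a jointly
  continuous action.\<close>

definition G_space ::
  "('a, 'm) monoid_scheme \<Rightarrow> 'a topology \<Rightarrow> 'b topology \<Rightarrow> ('a \<Rightarrow> 'b \<Rightarrow> 'b) \<Rightarrow> bool" where
  "G_space G T B act \<longleftrightarrow>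
     locally_compact_space B \<and> Hausdorff_space B \<and> second_countable B \<and>
     group_action G (topspace B) act \<and>
     continuous_map (prod_topology T B) B (\<lambda>(g, b). act g b)"

definition stationary ::
  "'a measure \<Rightarrow> 'b topology \<Rightarrow> ('a \<Rightarrow> 'b \<Rightarrow> 'b) \<Rightarrow> 'b measure \<Rightarrow> bool" where
  "stationary \<mu> B act \<nu> \<longleftrightarrow> distr (\<mu> \<Otimes>\<^sub>M \<nu>) (borel_of B) (\<lambda>(g, b). act g b) = \<nu>"

primrec walk :: "('a, 'm) monoid_scheme \<Rightarrow> (nat \<Rightarrow> 'a) \<Rightarrow> nat \<Rightarrow> 'a" where
  "walk G x 0 = \<one>\<^bsub>G\<^esub>"
| "walk G x (Suc n) = walk G x n \<otimes>\<^bsub>G\<^esub> x n"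

text \<open>The paths are governed by the product measure, under which the coordinates are i.i.d.
  Since \<open>\<nu>\<close> and the limit are probability measures, weak* convergence may be
  tested against all bounded continuous functions.\<close>

definition mu_boundary ::
  "('a, 'm) monoid_scheme \<Rightarrow> 'a topology \<Rightarrow> 'a measure \<Rightarrow> 'b topology \<Rightarrow> ('a \<Rightarrow> 'b \<Rightarrow> 'b) \<Rightarrow> 'b measure \<Rightarrow> bool" where
  "mu_boundary G T \<mu> B act \<nu> \<longleftrightarrow>
     G_space G T B act \<and> borel_prob B \<nu> \<and> stationary \<mu> B act \<nu> \<and>
     (AE x in (\<Pi>\<^sub>M i\<in>(UNIV :: nat set). \<mu>). \<exists>c\<in>topspace B.
        \<forall>f. continuous_map B euclideanreal f \<and> bounded (f ` topspace B) \<longrightarrow>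
          (\<lambda>n. \<integral>b. f (act (walk G x n) b) \<partial>\<nu>) \<longlonglongrightarrow> f c)"

definition poisson_transform ::
  "('a \<Rightarrow> 'b \<Rightarrow> 'b) \<Rightarrow> 'b measure \<Rightarrow> ('b \<Rightarrow> real) \<Rightarrow> 'a \<Rightarrow> real" where
  "poisson_transform act \<nu> \<phi> g = (\<integral>b. \<phi> (act g b) \<partial>\<nu>)"

definition L_infinity :: "'b measure \<Rightarrow> ('b \<Rightarrow> real) set" where
  "L_infinity \<nu> = {\<phi> \<in> borel_measurable \<nu>. esssup \<nu> (\<lambda>b. ereal \<bar>\<phi> b\<bar>) < \<infinity>}"

text \<open>Equality in \<open>L\<^sup>\<infinity>\<close> is equality almost everywhere. Applied to differences,
  the isometry condition yields that the transform is well defined on classes and injective.\<close>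

definition poisson_boundary ::
  "('a, 'm) monoid_scheme \<Rightarrow> 'a topology \<Rightarrow> 'a measure \<Rightarrow> 'b topology \<Rightarrow> ('a \<Rightarrow> 'b \<Rightarrow> 'b) \<Rightarrow> 'b measure \<Rightarrow> bool" where
  "poisson_boundary G T \<mu> B act \<nu> \<longleftrightarrow>
     mu_boundary G T \<mu> B act \<nu> \<and>
     (\<forall>\<phi>\<in>L_infinity \<nu>.
        bounded_harmonic G T \<mu> (poisson_transform act \<nu> \<phi>) \<and>
        (SUP g\<in>carrier G. ereal \<bar>poisson_transform act \<nu> \<phi> g\<bar>) = esssup \<nu> (\<lambda>b. ereal \<bar>\<phi> b\<bar>)) \<and>
     (\<forall>f. bounded_harmonic G T \<mu> f \<longrightarrow>
        (\<exists>\<phi>\<in>L_infinity \<nu>. \<forall>g\<in>carrier G. poisson_transform act \<nu> \<phi> g = f g))"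

definition point_mass :: "'b topology \<Rightarrow> 'b measure \<Rightarrow> bool" where
  "point_mass B \<nu> \<longleftrightarrow> (\<exists>b\<in>topspace B. \<nu> = return (borel_of B) b)"

text \<open>Every locally compact, Hausdorff, second countable space is homeomorphic to a subspace of
  the space of real sequences, so models carried by that type represent all of them. The Poisson
  boundary is unique up to isomorphism; triviality of one model is triviality of every model,
  see \<open>poisson_boundary_trivial_all_models\<close> below.\<close>

definition poisson_boundary_trivial ::
  "('a, 'm) monoid_scheme \<Rightarrow> 'a topology \<Rightarrow> 'a measure \<Rightarrow> bool" where
  "poisson_boundary_trivial G T \<mu> \<longleftrightarrow>
     (\<exists>(B :: (nat \<Rightarrow> real) topology) act \<nu>. poisson_boundary G T \<mu> B act \<nu> \<and> point_mass B \<nu>)"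

lemma space_borel_of: "space (borel_of T) = topspace T"
  by (simp add: borel_of_def space_measure_of_conv)

lemma openin_borel_of: "openin T U \<Longrightarrow> U \<in> sets (borel_of T)"
  unfolding borel_of_def by (subst sets_measure_of) (auto dest: openin_subset)

lemma closedin_borel_of: "closedin T C \<Longrightarrow> C \<in> sets (borel_of T)"
  using sets.compl_sets[OF openin_borel_of[of T "topspace T - C"]] closedin_subset[of T C]
  by (simp add: space_borel_of openin_diff double_diff)

lemma continuous_map_measurable:
  assumes "continuous_map S T f"
  shows "f \<in> measurable (borel_of S) (borel_of T)"
  unfolding borel_of_def[of T]
proof (rule measurable_measure_of)
  show "{U. openin T U} \<subseteq> Pow (topspace T)" by (auto dest: openin_subset)
  show "f \<in> space (borel_of S) \<rightarrow> topspace T"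
    using assms by (auto simp: space_borel_of continuous_map_def)
next
  fix U assume "U \<in> {U. openin T U}"
  then show "f -` U \<inter> space (borel_of S) \<in> sets (borel_of S)"
    using openin_continuous_map_preimage[OF assms, of U]
    by (auto simp: space_borel_of vimage_def Int_def conj_commute intro: openin_borel_of)
qed

lemma G_space_act:
  assumes "G_space G T B act" "g \<in> carrier G" "topspace T = carrier G"
  shows "continuous_map B B (act g)"
proof -
  have c: "continuous_map (prod_topology T B) B (\<lambda>(g, b). act g b)"
    using assms(1) by (simp add: G_space_def)
  have "continuous_map B (prod_topology T B) (\<lambda>b. (g, b))"
    using assms by (intro continuous_map_pairedI) auto
  from continuous_map_compose[OF this c] show ?thesis by (simp add: o_def)
qed

lemma esssup_abs_eq_0:
  fixes \<phi> :: "'b \<Rightarrow> real"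
  assumes "esssup \<nu> (\<lambda>b. ereal \<bar>\<phi> b\<bar>) = 0" "\<phi> \<in> borel_measurable \<nu>"
  shows "AE b in \<nu>. \<phi> b = 0"
proof -
  have "AE b in \<nu>. ereal \<bar>\<phi> b\<bar> \<le> esssup \<nu> (\<lambda>b. ereal \<bar>\<phi> b\<bar>)"
    using assms(2) by (intro esssup_AE)
  then show ?thesis using assms(1) by (auto simp: zero_ereal_def)
qed

lemma L_infinity_bounded:
  assumes "\<phi> \<in> borel_measurable \<nu>" "\<And>b. \<bar>\<phi> b\<bar> \<le> C"
  shows "\<phi> \<in> L_infinity \<nu>"
proof -
  have "esssup \<nu> (\<lambda>b. ereal \<bar>\<phi> b\<bar>) \<le> ereal C"
    using assms by (intro esssup_I) auto
  also have "\<dots> < \<infinity>" by simp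
  finally show ?thesis using assms by (simp add: L_infinity_def)
qed


lemma poisson_boundary_isometry:
  assumes "poisson_boundary G T \<mu> B act \<nu>" "\<phi> \<in> L_infinity \<nu>"
  shows "(SUP g\<in>carrier G. ereal \<bar>poisson_transform act \<nu> \<phi> g\<bar>) = esssup \<nu> (\<lambda>b. ereal \<bar>\<phi> b\<bar>)"
  using assms by (simp add: poisson_boundary_def)

lemma poisson_transform_return:
  assumes "poisson_boundary G T \<mu> B act (return (borel_of B) b)" "topspace T = carrier G"
    "g \<in> carrier G" "b \<in> topspace B" "\<phi> \<in> borel_measurable (borel_of B)"
  shows "poisson_transform act (return (borel_of B) b) \<phi> g = \<phi> (act g b)"
proof -
  have "G_space G T B act" using assms(1) by (simp add: poisson_boundary_def mu_boundary_def)
  then have "act g \<in> measurable (borel_of B) (borel_of B)"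
    using assms(2,3) by (intro continuous_map_measurable G_space_act)
  then have "(\<lambda>b. \<phi> (act g b)) \<in> borel_measurable (borel_of B)"
    using assms(5) by (rule measurable_compose)
  then show ?thesis
    using assms(4) by (simp add: poisson_transform_def integral_return space_borel_of)
qed

lemma point_mass_imp_harmonic_constant:
  assumes pb: "poisson_boundary G T \<mu> B act \<nu>" and "point_mass B \<nu>"
    and T: "topspace T = carrier G" and f: "bounded_harmonic G T \<mu> f"
  shows "\<exists>c. \<forall>g\<in>carrier G. f g = c"
proof -
  obtain b where b: "b \<in> topspace B" and \<nu>: "\<nu> = return (borel_of B) b"
    using assms(2) by (auto simp: point_mass_def)
  note tr = poisson_transform_return[OF pb[unfolded \<nu>] T _ b]
  have G: "G_space G T B act" using pb by (simp add: poisson_boundary_def mu_boundary_def)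
  then have H: "Hausdorff_space B" by (simp add: G_space_def)
  have sing: "{b} \<in> sets (borel_of B)"
    using b H by (intro closedin_borel_of) (simp add: closedin_Hausdorff_sing_eq)
  have fixed: "act g b = b" if g: "g \<in> carrier G" for g
  proof -
    let ?\<psi> = "indicator (topspace B - {b}) :: _ \<Rightarrow> real"
    have m: "?\<psi> \<in> borel_measurable (borel_of B)"
      using sing by (intro borel_measurable_indicator) (metis sets.compl_sets space_borel_of)
    then have L: "?\<psi> \<in> L_infinity \<nu>"
      by (intro L_infinity_bounded[where C = 1]) (auto simp: \<nu> indicator_def)
    have "AE x in \<nu>. ereal \<bar>?\<psi> x\<bar> \<le> 0"
      unfolding \<nu> using m b by (subst AE_return) (auto simp: space_borel_of)
    then have "esssup \<nu> (\<lambda>x. ereal \<bar>?\<psi> x\<bar>) \<le> 0"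
      using m by (intro esssup_I) (auto simp: \<nu>)
    then have "(SUP g\<in>carrier G. ereal \<bar>poisson_transform act \<nu> ?\<psi> g\<bar>) \<le> 0"
      by (simp add: poisson_boundary_isometry[OF pb L])
    then have "poisson_transform act \<nu> ?\<psi> g = 0"
      using g by (auto simp: SUP_le_iff zero_ereal_def)
    then have "?\<psi> (act g b) = 0" using tr[OF g m] by (simp add: \<nu>)
    moreover have "act g b \<in> topspace B"
      using G_space_act[OF G g T] b by (auto simp: continuous_map_def)
    ultimately show ?thesis by (auto simp: indicator_def split: if_splits)
  qed
  obtain \<phi> where \<phi>: "\<phi> \<in> L_infinity \<nu>" "\<forall>g\<in>carrier G. poisson_transform act \<nu> \<phi> g = f g"
    using pb f unfolding poisson_boundary_def by blast
  then have "\<phi> \<in> borel_measurable (borel_of B)" by (simp add: L_infinity_def \<nu>)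
  from tr[OF _ this] have "f g = \<phi> b" if "g \<in> carrier G" for g
    using \<phi>(2) that fixed \<nu> by force
  then show ?thesis by blast
qed

lemma prob_0_1_imp_point_mass:
  assumes "Hausdorff_space B" "second_countable B" "borel_prob B \<nu>"
    and 01: "\<And>A. A \<in> sets \<nu> \<Longrightarrow> measure \<nu> A = 0 \<or> measure \<nu> A = 1"
  shows "point_mass B \<nu>"
proof -
  interpret prob_space \<nu> using assms(3) by (simp add: borel_prob_def)
  have s: "sets \<nu> = sets (borel_of B)" using assms(3) by (simp add: borel_prob_def)
  have sp: "space \<nu> = topspace B" using sets_eq_imp_space_eq[OF s] by (simp add: space_borel_of)
  obtain \<B> where \<B>: "countable \<B>" "\<forall>U\<in>\<B>. openin B U"
    "\<forall>U x. openin B U \<and> x \<in> U \<longrightarrow> (\<exists>W\<in>\<B>. x \<in> W \<and> W \<subseteq> U)"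
    using assms(2) unfolding second_countable_def by (elim exE conjE) (rule that)
  define N where "N = \<Union>{U\<in>\<B>. emeasure \<nu> U = 0}"
  have "N \<in> null_sets \<nu>"
  proof -
    have "countable {U\<in>\<B>. emeasure \<nu> U = 0}" using \<B>(1) by simp
    moreover have "U \<in> null_sets \<nu>" if "U \<in> {U\<in>\<B>. emeasure \<nu> U = 0}" for U
      using that \<B>(2) by (simp add: null_sets_def s openin_borel_of)
    ultimately have "(\<Union>U\<in>{U\<in>\<B>. emeasure \<nu> U = 0}. U) \<in> null_sets \<nu>"
      by (rule null_sets_UN')
    then show ?thesis by (simp add: N_def)
  qed
  then have cN: "space \<nu> - N \<in> sets \<nu>" "prob (space \<nu> - N) = 1"
    using prob_compl[of N] sets.compl_sets[of N \<nu>] by (simp_all add: null_sets_def measure_def)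
  have "space \<nu> - N \<noteq> {}"
  proof
    assume "space \<nu> - N = {}"
    then show False using cN(2) by (simp only: measure_empty)
  qed
  then obtain b where b: "b \<in> space \<nu> - N" by blast
  have "x = b" if x: "x \<in> space \<nu> - N" for x
  proof (rule ccontr)
    assume "x \<noteq> b"
    moreover have "x \<in> topspace B" "b \<in> topspace B" using x b sp by auto
    ultimately obtain U W where UW: "openin B U" "openin B W" "x \<in> U" "b \<in> W" "disjnt U W"
      using assms(1) unfolding Hausdorff_space_def by blast
    obtain U' where U': "U' \<in> \<B>" "x \<in> U'" "U' \<subseteq> U"
      using \<B>(3)[rule_format, of U x] UW by blast
    obtain W' where W': "W' \<in> \<B>" "b \<in> W'" "W' \<subseteq> W"
      using \<B>(3)[rule_format, of W b] UW by blast
    have st: "U' \<in> sets \<nu>" "W' \<in> sets \<nu>"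
      using U'(1) W'(1) \<B>(2) by (simp_all add: s openin_borel_of)
    have "emeasure \<nu> U' \<noteq> 0" "emeasure \<nu> W' \<noteq> 0" using U'(1,2) W'(1,2) x b unfolding N_def by blast+
    then have "prob U' = 1" "prob W' = 1"
      using 01[OF st(1)] 01[OF st(2)] by (simp_all add: emeasure_eq_measure)
    moreover have "prob (U' \<union> W') = prob U' + prob W'"
      using st U' W' UW(5) by (intro finite_measure_Union) (auto simp: disjnt_def)
    ultimately show False using prob_le_1[of "U' \<union> W'"] by linarith
  qed
  then have eq: "space \<nu> - N = {b}" using b by blast
  have bs: "b \<in> topspace B" using b sp by simp
  have bm: "{b} \<in> sets \<nu>" "prob {b} = 1" using cN unfolding eq by simp_all
  have "\<nu> = return (borel_of B) b"
  proof (rule measure_eqI)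
    show "sets \<nu> = sets (return (borel_of B) b)" by (simp add: s)
    fix A assume A: "A \<in> sets \<nu>"
    have "prob A = indicator A b"
    proof (cases "b \<in> A")
      case True
      then have "prob {b} \<le> prob A" using A by (intro finite_measure_mono) auto
      then have "prob A = 1" using bm(2) prob_le_1[of A] by linarith
      then show ?thesis using True by simp
    next
      case False
      then have "prob (A \<union> {b}) = prob A + prob {b}"
        using A bm(1) by (intro finite_measure_Union) auto
      then have "prob A = 0"
        using prob_le_1[of "A \<union> {b}"] bm(2) measure_nonneg[of \<nu> A] by linarith
      then show ?thesis using False by simp
    qed
    moreover have "emeasure (return (borel_of B) b) A = indicator A b"
      using A s by (intro emeasure_return) blast
    ultimately show "emeasure \<nu> A = emeasure (return (borel_of B) b) A"
      using emeasure_eq_measure[of A] by (simp only: ennreal_indicator)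
  qed
  then show ?thesis using bs unfolding point_mass_def by blast
qed

lemma harmonic_constant_imp_point_mass:
  assumes pb: "poisson_boundary G T \<mu> B act \<nu>" and T: "topspace T = carrier G"
    and const: "\<And>f. bounded_harmonic G T \<mu> f \<Longrightarrow> \<exists>c. \<forall>g\<in>carrier G. f g = c"
  shows "point_mass B \<nu>"
proof -
  have G: "G_space G T B act" and bp: "borel_prob B \<nu>"
    using pb by (simp_all add: poisson_boundary_def mu_boundary_def)
  interpret prob_space \<nu> using bp by (simp add: borel_prob_def)
  have s: "sets \<nu> = sets (borel_of B)" using bp by (simp add: borel_prob_def)
  have sp: "space \<nu> = topspace B" using sets_eq_imp_space_eq[OF s] by (simp add: space_borel_of)
  interpret group_action G "topspace B" act using G by (simp add: G_space_def)
  have one: "\<one>\<^bsub>G\<^esub> \<in> carrier G" using group_hom by (simp add: group_hom_def group.is_monoid monoid.one_closed)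
  show ?thesis
  proof (rule prob_0_1_imp_point_mass)
    fix A assume A: "A \<in> sets \<nu>"
    let ?\<phi> = "indicator A :: _ \<Rightarrow> real"
    have L: "?\<phi> \<in> L_infinity \<nu>"
      using A by (intro L_infinity_bounded[where C = 1]) (auto simp: indicator_def)
    then have "bounded_harmonic G T \<mu> (poisson_transform act \<nu> ?\<phi>)"
      using pb by (simp add: poisson_boundary_def)
    then obtain c where c: "\<And>g. g \<in> carrier G \<Longrightarrow> poisson_transform act \<nu> ?\<phi> g = c"
      using const by blast
    let ?\<psi> = "\<lambda>b. ?\<phi> b - c"
    have L\<psi>: "?\<psi> \<in> L_infinity \<nu>"
      using A by (intro L_infinity_bounded[where C = "1 + \<bar>c\<bar>"]) (auto simp: indicator_def)
    have "poisson_transform act \<nu> ?\<psi> g = 0" if g: "g \<in> carrier G" for g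
    proof -
      have "act g \<in> measurable \<nu> \<nu>"
        using continuous_map_measurable[OF G_space_act[OF G g T]] s
        by (simp cong: measurable_cong_sets)
      then have "(\<lambda>b. ?\<phi> (act g b)) \<in> borel_measurable \<nu>"
        using borel_measurable_indicator[OF A] by (rule measurable_compose)
      then have "integrable \<nu> (\<lambda>b. ?\<phi> (act g b))"
        by (intro integrable_const_bound[where B = 1]) (auto simp: indicator_def)
      then have "poisson_transform act \<nu> ?\<psi> g = poisson_transform act \<nu> ?\<phi> g - c"
        by (simp add: poisson_transform_def prob_space)
      then show ?thesis using c[OF g] by simp
    qed
    then have "(SUP g\<in>carrier G. ereal \<bar>poisson_transform act \<nu> ?\<psi> g\<bar>) = (SUP g\<in>carrier G. 0)"
      by (intro SUP_cong) (auto simp: zero_ereal_def)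
    also have "\<dots> = 0" using one by (intro SUP_const) auto
    finally have "esssup \<nu> (\<lambda>b. ereal \<bar>?\<psi> b\<bar>) = 0"
      by (simp add: poisson_boundary_isometry[OF pb L\<psi>])
    then have ae: "AE b in \<nu>. ?\<phi> b - c = 0"
      using L\<psi> by (intro esssup_abs_eq_0) (auto simp: L_infinity_def)
    then have "AE b in \<nu>. ?\<phi> b = c" by simp
    then have "(\<integral>b. ?\<phi> b \<partial>\<nu>) = (\<integral>b. c \<partial>\<nu>)"
      using A by (intro integral_cong_AE) auto
    then have pc: "prob A = c"
      using A sets.sets_into_space[OF A] by (simp add: prob_space Int_absorb2)
    have "\<exists>b. c = ?\<phi> b"
    proof (rule ccontr)
      assume "\<nexists>b. c = ?\<phi> b"
      then have "AE b in \<nu>. False" 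
        using eventually_mono[OF \<open>AE b in \<nu>. ?\<phi> b = c\<close>, of "\<lambda>_. False"] by blast
      then show False by simp
    qed
    then obtain b where "c = ?\<phi> b" by (elim exE)
    then show "prob A = 0 \<or> prob A = 1" unfolding pc by (cases "b \<in> A") simp_all
  qed (use G bp in \<open>auto simp: G_space_def\<close>)
qed

theorem poisson_boundary_trivial_all_models:
  assumes "topspace T = carrier G" "poisson_boundary_trivial G T \<mu>" "poisson_boundary G T \<mu> B act \<nu>"
  shows "point_mass B \<nu>"
proof (rule harmonic_constant_imp_point_mass[OF assms(3,1)])
  fix f assume f: "bounded_harmonic G T \<mu> f"
  from assms(2) show "\<exists>c. \<forall>g\<in>carrier G. f g = c"
    unfolding poisson_boundary_trivial_def using point_mass_imp_harmonic_constant[OF _ _ assms(1) f] by blast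
qed


theorem poisson_boundary_trivial_iff_harmonic_constant:
  assumes G: "group G" and T: "topspace T = carrier G" and \<mu>: "borel_prob T \<mu>"
  shows "poisson_boundary_trivial G T \<mu> \<longleftrightarrow>
    (\<forall>f. bounded_harmonic G T \<mu> f \<longrightarrow> (\<exists>c. \<forall>g\<in>carrier G. f g = c))"
proof
  assume "poisson_boundary_trivial G T \<mu>"
  then show "\<forall>f. bounded_harmonic G T \<mu> f \<longrightarrow> (\<exists>c. \<forall>g\<in>carrier G. f g = c)"
    unfolding poisson_boundary_trivial_def using point_mass_imp_harmonic_constant[OF _ _ T] by blast
next
  assume const: "\<forall>f. bounded_harmonic G T \<mu> f \<longrightarrow> (\<exists>c. \<forall>g\<in>carrier G. f g = c)"
  define z :: "nat \<Rightarrow> real" where "z = (\<lambda>_. 0)"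
  define B where "B = discrete_topology {z}"
  define act where "act = (\<lambda>g :: 'a. \<lambda>x\<in>{z}. x)"
  define \<nu> where "\<nu> = return (borel_of B) z"
  interpret G: group G by fact
  interpret \<mu>: prob_space \<mu> using \<mu> by (simp add: borel_prob_def)
  have sB: "space (borel_of B) = {z}" by (simp add: space_borel_of B_def)
  interpret \<nu>: prob_space \<nu> unfolding \<nu>_def by (rule prob_space_return) (simp add: sB)
  have s\<nu>: "space \<nu> = {z}" "sets \<nu> = sets (borel_of B)" by (simp_all add: \<nu>_def sB)
  have tB: "topspace B = {z}" by (simp add: B_def)
  have one: "\<one>\<^bsub>G\<^esub> \<in> carrier G" by simp
  have int: "(\<integral>b. \<phi> (act g b) \<partial>\<nu>) = \<phi> z" for \<phi> :: "(nat \<Rightarrow> real) \<Rightarrow> real" and g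
  proof -
    have "(\<integral>b. \<phi> (act g b) \<partial>\<nu>) = (\<integral>b. \<phi> z \<partial>\<nu>)"
      by (intro Bochner_Integration.integral_cong) (auto simp: s\<nu> act_def)
    then show ?thesis by (simp add: \<nu>.prob_space)
  qed
  have act1: "act g = \<one>\<^bsub>BijGroup {z}\<^esub>" for g
    by (simp add: act_def BijGroup_def)
  have "group_hom G (BijGroup {z}) act"
  proof (intro group_hom.intro group_hom_axioms.intro homI)
    show "act x \<in> carrier (BijGroup {z})" for x
      unfolding act1 by (intro monoid.one_closed group.is_monoid group_BijGroup)
    show "act (x \<otimes>\<^bsub>G\<^esub> y) = act x \<otimes>\<^bsub>BijGroup {z}\<^esub> act y" for x y
      unfolding act1
      by (intro monoid.l_one[symmetric] monoid.one_closed group.is_monoid group_BijGroup)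
  qed (use group_BijGroup G in blast)+
  then have ga: "group_action G (topspace B) act" by (simp add: group_action_def tB)
  have "continuous_map (prod_topology T B) B (\<lambda>(g, b). act g b)"
    by (rule continuous_map_eq[OF continuous_map_snd]) (auto simp: act_def tB)
  then have gs: "G_space G T B act"
    using ga by (simp add: G_space_def B_def second_countable_discrete_topology
        compact_imp_locally_compact_space compact_space_discrete_topology)
  have "stationary \<mu> B act \<nu>"
    unfolding stationary_def
  proof (rule measure_eqI)
    let ?D = "distr (\<mu> \<Otimes>\<^sub>M \<nu>) (borel_of B) (\<lambda>(g, b). act g b)"
    have m: "(\<lambda>(g, b). act g b) \<in> measurable (\<mu> \<Otimes>\<^sub>M \<nu>) (borel_of B)"
      by (subst measurable_cong[where g = "\<lambda>_. z"])
         (auto simp: space_pair_measure s\<nu> act_def sB)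
    interpret P: pair_prob_space \<mu> \<nu> ..
    interpret D: prob_space ?D by (rule P.prob_space_distr[OF m])
    show "sets ?D = sets \<nu>" by (simp add: s\<nu>)
    fix A assume "A \<in> sets ?D"
    then have "A \<subseteq> {z}" using sets.sets_into_space sB by fastforce
    then consider "A = {}" | "A = space ?D" by (force simp: sB)
    then show "emeasure ?D A = emeasure \<nu> A"
    proof cases
      case 2
      have "space ?D = space \<nu>" by (simp add: sB s\<nu>)
      then show ?thesis using D.emeasure_space_1 \<nu>.emeasure_space_1 2 by simp
    qed simp
  qed
  then have mb: "mu_boundary G T \<mu> B act \<nu>"
    using gs by (auto simp: mu_boundary_def borel_prob_def \<nu>.prob_space_axioms s\<nu> int tB)
  have pt: "poisson_transform act \<nu> \<phi> = (\<lambda>_. \<phi> z)" for \<phi>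
    by (rule ext) (simp add: poisson_transform_def int)
  have "bounded_harmonic G T \<mu> (\<lambda>_. c)" for c
    by (auto simp: bounded_harmonic_def \<mu>.prob_space image_constant_conv)
  moreover have "(SUP g\<in>carrier G. ereal \<bar>\<phi> z\<bar>) = esssup \<nu> (\<lambda>b. ereal \<bar>\<phi> b\<bar>)"
    if "\<phi> \<in> borel_measurable \<nu>" for \<phi>
  proof -
    have "esssup \<nu> (\<lambda>b. ereal \<bar>\<phi> b\<bar>) = esssup \<nu> (\<lambda>b. ereal \<bar>\<phi> z\<bar>)"
      using that by (intro esssup_AE_cong AE_I2) (auto simp: s\<nu>)
    also have "\<dots> = ereal \<bar>\<phi> z\<bar>"
      by (rule esssup_const) (simp add: \<nu>.emeasure_space_1)
    also have "\<dots> = (SUP g\<in>carrier G. ereal \<bar>\<phi> z\<bar>)"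
      using one by (intro SUP_const[symmetric]) auto
    finally show ?thesis by simp
  qed
  moreover have "\<exists>\<phi>\<in>L_infinity \<nu>. \<forall>g\<in>carrier G. poisson_transform act \<nu> \<phi> g = f g"
    if f: "bounded_harmonic G T \<mu> f" for f
  proof -
    obtain c where "\<forall>g\<in>carrier G. f g = c" using const f by blast
    then show ?thesis
      by (intro bexI[where x = "\<lambda>_. c"]) (auto simp: pt intro: L_infinity_bounded[where C = "\<bar>c\<bar>"])
  qed
  ultimately have "poisson_boundary G T \<mu> B act \<nu>"
    using mb by (simp add: poisson_boundary_def pt L_infinity_def)
  then show "poisson_boundary_trivial G T \<mu>"
    unfolding poisson_boundary_trivial_def point_mass_def \<nu>_def using tB by blast
qed

end

theory Submission
  imports Defs
begin

text \<open>The Poisson boundary is trivial exactly when all bounded harmonic functions on \<open>\<Gamma>\<close> are constant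
  (\<open>poisson_boundary_trivial_iff_harmonic_constant\<close>). Both directions are read off the tree. Its vertices at
  level \<open>m\<close> are represented by cosets of \<open>\<alpha>\<^sup>m V\<^sub>-\<close>, and the path from the base vertex to its image under \<open>g\<close>
  climbs towards the fixed end and then descends. The mean of \<open>\<eta>\<close> is the drift of the walk, counted positive
  away from the fixed end.

  If the mean is at most \<open>0\<close>, the descent of the walk is dominated by a reflected random walk without
  positive drift, so its expectation grows sublinearly (\<open>sublinear_height\<close>). The climb carries little
  information, because a vertex has only one ancestor at each level; the entropy of the walk on the cosets of a
  small open subgroup is therefore sublinear (\<open>entropy_gibbs\<close>). The increments of this entropy measure how
  well the walk remembers its first step, and hence the first step is forgotten (\<open>entropy_criterion\<close>). This
  applies to functions that are nearly constant on such cosets; a bounded harmonic function is of this kind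
  since \<open>\<mu>\<close> is spread-out (\<open>harmonic_right_uniformly_continuous\<close>). So it is constant along the increments,
  hence on the closed semigroup \<open>\<Gamma>\<close> (\<open>harmonic_constant_if_mean_nonpositive\<close>).

  If the mean is positive, the climbs stay bounded with positive probability
  (\<open>max_climb_bounded_with_positive_probability\<close>), and the walk then stays in a subtree. The probability of
  ending in a given subtree is a bounded harmonic function of the starting point. If all of these were constant,
  they would describe a nonzero \<open>\<Gamma>\<close>-invariant finite measure on the ends other than the fixed one. An element of
  \<open>\<Gamma>\<close> with positive translation concentrates this measure in a single end, which is then fixed by \<open>\<Gamma>\<close>; so
  \<open>\<Gamma>\<close> would be exceptional (\<open>constant_harmonic_imp_exceptional\<close>, \<open>fixed_point_imp_exceptional\<close>).\<close>

section \<open>Borel measures on second countable spaces\<close>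

text \<open>Second countability makes every open set of the product a countable union of open rectangles, so the
  Borel structure of the product is generated by the two Borel structures. This is what allows group
  multiplication to be used inside product measures.\<close>

lemma continuous_map_pair_measurable:
  assumes "second_countable S" "second_countable T" and f: "continuous_map (prod_topology S T) R f"
  shows "f \<in> measurable (borel_of S \<Otimes>\<^sub>M borel_of T) (borel_of R)"
proof -
  obtain BS where BS: "countable BS" "\<And>V. V \<in> BS \<Longrightarrow> openin S V"
    "\<And>U x. openin S U \<Longrightarrow> x \<in> U \<Longrightarrow> \<exists>V\<in>BS. x \<in> V \<and> V \<subseteq> U"
    using assms(1) unfolding second_countable_def by metis
  obtain BT where BT: "countable BT" "\<And>V. V \<in> BT \<Longrightarrow> openin T V"
    "\<And>U x. openin T U \<Longrightarrow> x \<in> U \<Longrightarrow> \<exists>V\<in>BT. x \<in> V \<and> V \<subseteq> U"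
    using assms(2) unfolding second_countable_def by metis
  have open_meas: "W \<in> sets (borel_of S \<Otimes>\<^sub>M borel_of T)" if W: "openin (prod_topology S T) W" for W
  proof -
    let ?I = "{(U, V). U \<in> BS \<and> V \<in> BT \<and> U \<times> V \<subseteq> W}"
    have eq: "W = (\<Union>(U, V)\<in>?I. U \<times> V)"
    proof
      show "W \<subseteq> (\<Union>(U, V)\<in>?I. U \<times> V)"
      proof
        fix z assume z: "z \<in> W"
        obtain x y where xy: "z = (x, y)" by (cases z)
        have "\<exists>U V. openin S U \<and> openin T V \<and> x \<in> U \<and> y \<in> V \<and> U \<times> V \<subseteq> W"
          using W[unfolded openin_prod_topology_alt, rule_format, of x y] z xy by simp
        then obtain U V where UV: "openin S U" "openin T V" "x \<in> U" "y \<in> V" "U \<times> V \<subseteq> W"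
          by (elim exE conjE)
        obtain U' where U': "U' \<in> BS" "x \<in> U'" "U' \<subseteq> U" using BS(3) UV by blast
        obtain V' where V': "V' \<in> BT" "y \<in> V'" "V' \<subseteq> V" using BT(3) UV by blast
        have "U' \<times> V' \<subseteq> W" using U'(3) V'(3) UV(5) by (meson Sigma_mono order_trans)
        then have "(U', V') \<in> ?I" using U'(1) V'(1) by simp
        moreover have "z \<in> (case (U', V') of (U, V) \<Rightarrow> U \<times> V)" using U'(2) V'(2) xy by simp
        ultimately show "z \<in> (\<Union>(U, V)\<in>?I. U \<times> V)" by (rule UN_I)
      qed
    qed auto
    have cnt: "countable ?I"
      by (rule countable_subset[OF _ countable_SIGMA[OF BS(1) BT(1)]]) auto
    have mem: "(case p of (U, V) \<Rightarrow> U \<times> V) \<in> sets (borel_of S \<Otimes>\<^sub>M borel_of T)" if "p \<in> ?I" for p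
      using that BS(2) BT(2) by (auto intro!: pair_measureI openin_borel_of)
    show ?thesis
      by (subst eq) (intro sets.countable_UN' cnt image_subsetI mem)
  qed
  show ?thesis
    unfolding borel_of_def[of R]
  proof (rule measurable_measure_of)
    show "{U. openin R U} \<subseteq> Pow (topspace R)" by (auto dest: openin_subset)
    show "f \<in> space (borel_of S \<Otimes>\<^sub>M borel_of T) \<rightarrow> topspace R"
      using f by (auto simp: space_pair_measure space_borel_of continuous_map_def)
  next
    fix U assume "U \<in> {U. openin R U}"
    then have "openin (prod_topology S T) {x \<in> topspace (prod_topology S T). f x \<in> U}"
      using openin_continuous_map_preimage[OF f] by blast
    from open_meas[OF this] show "f -` U \<inter> space (borel_of S \<Otimes>\<^sub>M borel_of T) \<in> sets (borel_of S \<Otimes>\<^sub>M borel_of T)"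
      by (simp add: space_pair_measure space_borel_of vimage_def Int_def conj_commute)
  qed
qed

lemma sets_borel_of_subtopology:
  assumes S: "S \<in> sets (borel_of T)"
  shows "sets (borel_of (subtopology T S)) = sets (restrict_space (borel_of T) S)"
proof -
  have sub: "S \<subseteq> topspace T" using sets.sets_into_space[OF S] by (simp add: space_borel_of)
  have "sets (borel_of (subtopology T S)) = sigma_sets S {U. openin (subtopology T S) U}"
    unfolding borel_of_def using sub openin_subset[of "subtopology T S"]
    by (subst sets_measure_of) (auto simp: inf.absorb2)
  also have "{U. openin (subtopology T S) U} = (\<lambda>U. S \<inter> U) ` {U. openin T U}"
    by (auto simp: openin_subtopology Int_commute)
  also have "sigma_sets S \<dots> = (\<lambda>U. S \<inter> U) ` sigma_sets (topspace T) {U. openin T U}"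
    using S by (intro restricted_sigma[symmetric]) (auto simp: borel_of_def sets_measure_of_conv split: if_splits dest: openin_subset)
  also have "\<dots> = sets (restrict_space (borel_of T) S)"
    unfolding sets_restrict_space borel_of_def
    by (subst sets_measure_of) (auto dest: openin_subset)
  finally show ?thesis .
qed

text \<open>A countable base makes the complement of the support a countable union of null open sets.\<close>

lemma AE_support_of:
  assumes "second_countable T" and bp: "borel_prob T \<mu>"
  shows "AE x in \<mu>. x \<in> support_of T \<mu>"
proof -
  have s: "sets \<mu> = sets (borel_of T)" using bp by (simp add: borel_prob_def)
  have sp: "space \<mu> = topspace T" using sets_eq_imp_space_eq[OF s] by (simp add: space_borel_of)
  obtain B where B: "countable B" "\<And>V. V \<in> B \<Longrightarrow> openin T V"
    "\<And>U x. openin T U \<Longrightarrow> x \<in> U \<Longrightarrow> \<exists>V\<in>B. x \<in> V \<and> V \<subseteq> U"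
    using assms(1) unfolding second_countable_def by metis
  have "AE x in \<mu>. x \<notin> U" if "U \<in> {U\<in>B. emeasure \<mu> U = 0}" for U
    using that B(2) by (intro AE_not_in) (auto simp: null_sets_def s openin_borel_of)
  then have "AE x in \<mu>. \<forall>U\<in>{U\<in>B. emeasure \<mu> U = 0}. x \<notin> U"
    using B(1) by (subst AE_ball_countable) auto
  moreover have "AE x in \<mu>. x \<in> space \<mu>" by simp
  ultimately show ?thesis
  proof eventually_elim
    case (elim x)
    have "emeasure \<mu> U > 0" if U: "openin T U" "x \<in> U" for U
    proof -
      obtain W where W: "W \<in> B" "x \<in> W" "W \<subseteq> U" using B(3) U by blast
      then have "emeasure \<mu> W \<noteq> 0" using elim by blast
      moreover have "emeasure \<mu> W \<le> emeasure \<mu> U"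
        using W(3) U by (intro emeasure_mono) (auto simp: s openin_borel_of)
      ultimately show ?thesis by (metis le_zero_eq not_gr_zero)
    qed
    then show ?case using elim(2) by (simp add: support_of_def sp)
  qed
qed

section \<open>Random walks on second countable groups\<close>

locale random_walk =
  fixes G :: "('a, 'm) monoid_scheme" (structure) and T :: "'a topology" and \<mu> :: "'a measure"
  assumes topological_group: "topological_group G T"
    and second_countable: "second_countable T"
    and borel_prob: "borel_prob T \<mu>"
begin

sublocale group G
  using topological_group by (simp add: topological_group_def)

sublocale mu: prob_space \<mu>
  using borel_prob by (simp add: borel_prob_def)

abbreviation "BT \<equiv> borel_of T"

lemma topspace_eq: "topspace T = carrier G"
  using topological_group by (simp add: topological_group_def)

lemma space_BT [simp]: "space BT = carrier G"
  by (simp add: space_borel_of topspace_eq)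

lemma sets_mu [simp, measurable_cong]: "sets \<mu> = sets BT"
  using borel_prob by (simp add: borel_prob_def)

lemma space_mu [simp]: "space \<mu> = carrier G"
  using sets_eq_imp_space_eq[OF sets_mu] by simp

lemma mult_measurable: "(\<lambda>(x, y). x \<otimes> y) \<in> measurable (BT \<Otimes>\<^sub>M BT) BT"
  using topological_group second_countable
  by (intro continuous_map_pair_measurable) (auto simp: topological_group_def)

lemma mult_measurable' [measurable (raw)]:
  assumes "f \<in> measurable M BT" "g \<in> measurable M BT"
  shows "(\<lambda>x. f x \<otimes> g x) \<in> measurable M BT"
  using measurable_compose[OF measurable_Pair[OF assms] mult_measurable] by simp

lemma continuous_lmult: "g \<in> carrier G \<Longrightarrow> continuous_map T T (\<lambda>x. g \<otimes> x)"
proof -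
  assume g: "g \<in> carrier G"
  have "continuous_map T (prod_topology T T) (\<lambda>x. (g, x))"
    using g by (intro continuous_map_pairedI) (auto simp: topspace_eq)
  from continuous_map_compose[OF this, of T "\<lambda>(x, y). x \<otimes> y"] show ?thesis
    using topological_group by (simp add: topological_group_def o_def)
qed

lemma continuous_rmult: "g \<in> carrier G \<Longrightarrow> continuous_map T T (\<lambda>x. x \<otimes> g)"
proof -
  assume g: "g \<in> carrier G"
  have "continuous_map T (prod_topology T T) (\<lambda>x. (x, g))"
    using g by (intro continuous_map_pairedI) (auto simp: topspace_eq)
  from continuous_map_compose[OF this, of T "\<lambda>(x, y). x \<otimes> y"] show ?thesis
    using topological_group by (simp add: topological_group_def o_def)
qed

lemmas measurable_lmult = continuous_map_measurable[OF continuous_lmult]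

lemma lmult_cancel_inv: "g \<in> carrier G \<Longrightarrow> x \<in> carrier G \<Longrightarrow> g \<otimes> (inv g \<otimes> x) = x"
  "g \<in> carrier G \<Longrightarrow> x \<in> carrier G \<Longrightarrow> inv g \<otimes> (g \<otimes> x) = x"
  by (simp_all add: m_assoc[symmetric])

abbreviation law :: "nat \<Rightarrow> 'a measure" where
  "law n \<equiv> mconv_pow G T \<mu> n"

lemma law_space_sets: "prob_space (law n) \<and> sets (law n) = sets BT"
proof (induction n)
  case 0
  show ?case by (auto intro!: prob_space_return)
next
  case (Suc n)
  interpret L: prob_space "law n" using Suc by simp
  interpret P: pair_prob_space \<mu> "law n" ..
  have [measurable_cong]: "sets (law n) = sets BT" using Suc by simp
  have "(\<lambda>(x, y). x \<otimes> y) \<in> measurable (\<mu> \<Otimes>\<^sub>M law n) BT" by measurable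
  then show ?case by (auto simp: mconv_def intro: P.prob_space_distr)
qed

lemma prob_space_law: "prob_space (law n)"
  and sets_law [simp, measurable_cong]: "sets (law n) = sets BT"
  using law_space_sets by auto

lemma space_law [simp]: "space (law n) = carrier G"
  using sets_eq_imp_space_eq[OF sets_law] by simp

lemma emeasure_law_space [simp]: "emeasure (law n) (carrier G) = 1"
  using prob_space.emeasure_space_1[OF prob_space_law, of n] by simp

lemma emeasure_mu_carrier [simp]: "emeasure \<mu> (carrier G) = 1" "measure \<mu> (carrier G) = 1"
  using mu.emeasure_space_1 mu.prob_space by simp_all

lemma measure_law_carrier [simp]: "measure (law n) (carrier G) = 1"
  by (simp add: measure_def)

text \<open>The first increment is split off, not the last one: the rest of the walk is then translated from the
  left, which is the action on left cosets.\<close>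

lemma nn_integral_law_Suc:
  assumes F[measurable]: "F \<in> borel_measurable BT"
  shows "(\<integral>\<^sup>+ g. F g \<partial>law (Suc n)) = (\<integral>\<^sup>+ x. (\<integral>\<^sup>+ g. F (x \<otimes> g) \<partial>law n) \<partial>\<mu>)"
proof -
  interpret L: prob_space "law n" by (rule prob_space_law)
  interpret P: pair_prob_space \<mu> "law n" ..
  have "(\<integral>\<^sup>+ g. F g \<partial>law (Suc n)) = (\<integral>\<^sup>+ p. F (case p of (x, y) \<Rightarrow> x \<otimes> y) \<partial>(\<mu> \<Otimes>\<^sub>M law n))"
    unfolding mconv_pow.simps mconv_def by (subst nn_integral_distr) auto
  also have "\<dots> = (\<integral>\<^sup>+ x. (\<integral>\<^sup>+ g. F (x \<otimes> g) \<partial>law n) \<partial>\<mu>)"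
    by (subst L.nn_integral_fst[symmetric]) auto
  finally show ?thesis .
qed

lemma integral_law_Suc:
  assumes F[measurable]: "F \<in> borel_measurable BT" and B: "\<And>g. \<bar>F g\<bar> \<le> (B::real)"
  shows "(\<integral>g. F g \<partial>law (Suc n)) = (\<integral>x. (\<integral>g. F (x \<otimes> g) \<partial>law n) \<partial>\<mu>)"
proof -
  interpret L: prob_space "law n" by (rule prob_space_law)
  interpret P: pair_prob_space \<mu> "law n" ..
  have "(\<integral>g. F g \<partial>law (Suc n)) = (\<integral>p. F (case p of (x, y) \<Rightarrow> x \<otimes> y) \<partial>(\<mu> \<Otimes>\<^sub>M law n))"
    unfolding mconv_pow.simps mconv_def by (subst integral_distr) auto
  also have "\<dots> = (\<integral>x. (\<integral>g. F (x \<otimes> g) \<partial>law n) \<partial>\<mu>)"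
    by (subst P.integral_fst'[symmetric]) (auto intro!: P.P.integrable_const_bound[where B = B] B)
  finally show ?thesis .
qed

end

section \<open>Entropy of a random walk on a coset space\<close>

definition xlogx_neg :: "real \<Rightarrow> real" where
  "xlogx_neg t = - (t * ln t)"

text \<open>A quantitative form of concavity: the graph of \<open>- t ln t\<close> lies below its tangent at \<open>b\<close> by at least a
  squared Hellinger distance. The inequality is \<open>ln u \<le> u - 1\<close> at \<open>u = sqrt (b / a)\<close>.\<close>

lemma xlogx_neg_tangent:
  assumes "0 \<le> a" "0 < b"
  shows "xlogx_neg a + (sqrt a - sqrt b)\<^sup>2 \<le> xlogx_neg b - (ln b + 1) * (a - b)"
proof (cases "a = 0")
  case True
  then show ?thesis using assms by (simp add: xlogx_neg_def algebra_simps)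
next
  case False
  then have a: "0 < a" using assms by simp
  have "ln (sqrt (b / a)) \<le> sqrt (b / a) - 1"
    using a assms by (intro ln_le_minus_one) simp
  then have "a * (ln b - ln a) \<le> a * (2 * (sqrt (b / a) - 1))"
    using a assms by (intro mult_left_mono) (auto simp: ln_sqrt ln_div)
  also have "\<dots> = 2 * (sqrt a * sqrt b) - 2 * a"
    using a assms by (simp add: algebra_simps real_sqrt_divide) (simp add: field_simps flip: power2_eq_square)
  finally show ?thesis
    using a assms by (simp add: xlogx_neg_def power2_diff algebra_simps)
qed

lemma xlogx_neg_bounds:
  assumes "0 \<le> t" "t \<le> 1"
  shows "0 \<le> xlogx_neg t" "xlogx_neg t \<le> 1"
proof -
  show "0 \<le> xlogx_neg t"
    using assms by (cases "t = 0") (auto simp: xlogx_neg_def mult_nonneg_nonpos)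
  have "xlogx_neg t + (sqrt t - sqrt 1)\<^sup>2 \<le> 1 - t"
    using xlogx_neg_tangent[of t 1] assms by (simp add: xlogx_neg_def)
  moreover have "0 \<le> (sqrt t - sqrt 1)\<^sup>2" by (rule zero_le_power2)
  ultimately have "xlogx_neg t \<le> 1 - t" by linarith
  then show "xlogx_neg t \<le> 1" using assms by simp
qed

text \<open>The tangent at \<open>exp (- L)\<close>. Summed over the atoms of a distribution it is Gibbs' inequality, which
  bounds an entropy by a mean code length.\<close>

lemma xlogx_neg_gibbs:
  assumes "0 \<le> t"
  shows "xlogx_neg t \<le> t * L + exp (- L)"
proof -
  have "xlogx_neg t \<le> xlogx_neg (exp (- L)) - (ln (exp (- L)) + 1) * (t - exp (- L))"
    using xlogx_neg_tangent[OF assms exp_gt_zero, of "- L"]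
      zero_le_power2[of "sqrt t - sqrt (exp (- L))"] by linarith
  then show ?thesis using assms by (simp add: xlogx_neg_def algebra_simps)
qed

lemma measurable_xlogx_neg [measurable]: "xlogx_neg \<in> borel_measurable borel"
  unfolding xlogx_neg_def[abs_def] by measurable

text \<open>The Cauchy-Schwarz bound of a total variation distance by a Hellinger distance, linearized by the
  parameter \<open>lam\<close> so that it can be summed and integrated without square roots of integrals.\<close>

lemma abs_diff_le_hellinger:
  fixes a b lam :: real
  assumes "0 \<le> a" "0 \<le> b" "0 < lam"
  shows "\<bar>a - b\<bar> \<le> lam / 2 * (sqrt a - sqrt b)\<^sup>2 + 1 / lam * a + 1 / lam * b"
proof -
  define s t where "s = sqrt a" and "t = sqrt b"
  have st: "0 \<le> s" "0 \<le> t" "a = s\<^sup>2" "b = t\<^sup>2" using assms by (simp_all add: s_def t_def)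
  have "\<bar>a - b\<bar> = \<bar>s - t\<bar> * (s + t)"
    using st by (simp add: power2_eq_square square_diff_square_factored abs_mult)
  also have "\<dots> \<le> lam / 2 * (s - t)\<^sup>2 + 1 / (2 * lam) * (s + t)\<^sup>2"
  proof -
    have "0 \<le> (lam * \<bar>s - t\<bar> - (s + t))\<^sup>2 / (2 * lam)" using assms by simp
    also have "\<dots> = lam / 2 * \<bar>s - t\<bar>\<^sup>2 + 1 / (2 * lam) * (s + t)\<^sup>2 - \<bar>s - t\<bar> * (s + t)"
      unfolding power2_diff power_mult_distrib using assms(3) by (simp add: power2_eq_square add_divide_distrib diff_divide_distrib)
    finally show ?thesis by simp
  qed
  also have "1 / (2 * lam) * (s + t)\<^sup>2 \<le> 1 / (2 * lam) * (2 * (s\<^sup>2 + t\<^sup>2))"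
    using zero_le_power2[of "s - t"] assms(3) by (intro mult_left_mono) (simp_all add: power2_sum power2_diff)
  also have "\<dots> = 1 / lam * a + 1 / lam * b" using assms(3) st by (simp add: field_simps)
  finally show ?thesis by (simp add: s_def t_def)
qed

locale random_walk_in_subgroup = random_walk +
  fixes \<Gamma> :: "'a set"
  assumes subgroup_\<Gamma>: "subgroup \<Gamma> G" and closed_\<Gamma>: "closedin T \<Gamma>" and AE_\<Gamma>: "AE x in \<mu>. x \<in> \<Gamma>"
begin

lemma \<Gamma>_sets [measurable]: "\<Gamma> \<in> sets BT"
  using closed_\<Gamma> by (rule closedin_borel_of)

lemma \<Gamma>_carrier: "g \<in> \<Gamma> \<Longrightarrow> g \<in> carrier G"
  using subgroup.subset[OF subgroup_\<Gamma>] by blast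

lemma AE_law_\<Gamma>: "AE g in law n. g \<in> \<Gamma>"
proof (induction n)
  case 0
  have "Measurable.pred BT (\<lambda>x. x \<in> \<Gamma>)" using \<Gamma>_sets sets.sets_into_space[OF \<Gamma>_sets]
    by (simp add: pred_def Int_absorb1 Int_def[symmetric] Collect_conj_eq)
  then show ?case using subgroup.one_closed[OF subgroup_\<Gamma>] unfolding mconv_pow.simps
    by (subst AE_return) simp_all
next
  case (Suc n)
  have "(\<integral>\<^sup>+ g. indicator (carrier G - \<Gamma>) g \<partial>law (Suc n))
    = (\<integral>\<^sup>+ x. (\<integral>\<^sup>+ g. indicator (carrier G - \<Gamma>) (x \<otimes> g) \<partial>law n) \<partial>\<mu>)"
    by (rule nn_integral_law_Suc) (use \<Gamma>_sets sets.compl_sets[OF \<Gamma>_sets] in simp)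
  also have "\<dots> = (\<integral>\<^sup>+ x. 0 \<partial>\<mu>)"
  proof (rule nn_integral_cong_AE, use AE_\<Gamma> in eventually_elim)
    fix x assume x: "x \<in> \<Gamma>"
    have "(\<integral>\<^sup>+ g. indicator (carrier G - \<Gamma>) (x \<otimes> g) \<partial>law n) = (\<integral>\<^sup>+ g. 0 \<partial>law n)"
      by (rule nn_integral_cong_AE, use Suc in eventually_elim)
         (auto simp: indicator_def x subgroup.m_closed[OF subgroup_\<Gamma>])
    then show "(\<integral>\<^sup>+ g. indicator (carrier G - \<Gamma>) (x \<otimes> g) \<partial>law n) = 0" by simp
  qed
  finally have 0: "(\<integral>\<^sup>+ g. indicator (carrier G - \<Gamma>) g \<partial>law (Suc n)) = 0" by simp
  have cm: "carrier G - \<Gamma> \<in> sets (law (Suc n))"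
    using sets.compl_sets[OF \<Gamma>_sets] by (simp only: sets_law space_BT)
  have "AE g in law (Suc n). g \<notin> carrier G - \<Gamma>"
    using 0 cm by (intro AE_not_in null_setsI) (simp_all only: nn_integral_indicator)
  then show ?case
    by (rule AE_mp) (rule AE_I2, use space_law[of "Suc n"] in auto)
qed

text \<open>The function lives on the whole group, so that it can be integrated against measures on the group,
  but only its values on \<open>\<Gamma>\<close> obey the mean value property. The bound \<open>B\<close> is explicit because it enters the estimates.\<close>

definition harmonic_on_\<Gamma> :: "real \<Rightarrow> ('a \<Rightarrow> real) \<Rightarrow> bool" where
  "harmonic_on_\<Gamma> B f \<longleftrightarrow> f \<in> borel_measurable BT \<and> (\<forall>g. \<bar>f g\<bar> \<le> B) \<and>
     (\<forall>g\<in>\<Gamma>. f g = (\<integral>x. f (g \<otimes> x) \<partial>\<mu>))"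

lemma harmonic_law:
  assumes f: "harmonic_on_\<Gamma> B f" and g: "g \<in> \<Gamma>"
  shows "f g = (\<integral>x. f (g \<otimes> x) \<partial>law n)"
  using g
proof (induction n arbitrary: g)
  case 0
  have [measurable]: "f \<in> borel_measurable BT" using f by (simp add: harmonic_on_\<Gamma>_def)
  have [measurable]: "g \<in> carrier G" using 0 by (rule \<Gamma>_carrier)
  have "(\<lambda>x. f (g \<otimes> x)) \<in> borel_measurable BT"
    using measurable_compose[OF measurable_lmult] 0 \<Gamma>_carrier by simp
  then show ?case using 0 by (simp add: integral_return \<Gamma>_carrier)
next
  case (Suc n)
  have fm [measurable]: "f \<in> borel_measurable BT" and B: "\<And>g. \<bar>f g\<bar> \<le> B"
    using f by (simp_all add: harmonic_on_\<Gamma>_def)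
  have gc: "g \<in> carrier G" using Suc.prems by (rule \<Gamma>_carrier)
  have gm: "(\<lambda>x. f (g \<otimes> x)) \<in> borel_measurable BT" using measurable_compose[OF measurable_lmult[OF gc] fm] .
  have "(\<integral>x. f (g \<otimes> x) \<partial>law (Suc n)) = (\<integral>x. (\<integral>h. f (g \<otimes> (x \<otimes> h)) \<partial>law n) \<partial>\<mu>)"
    by (rule integral_law_Suc[OF gm B])
  also have "\<dots> = (\<integral>x. f (g \<otimes> x) \<partial>\<mu>)"
  proof (rule integral_cong_AE)
    show "AE x in \<mu>. (\<integral>h. f (g \<otimes> (x \<otimes> h)) \<partial>law n) = f (g \<otimes> x)"
      using AE_\<Gamma>
    proof eventually_elim
      fix x assume x: "x \<in> \<Gamma>"
      have "(\<integral>h. f (g \<otimes> (x \<otimes> h)) \<partial>law n) = (\<integral>h. f (g \<otimes> x \<otimes> h) \<partial>law n)"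
        by (intro Bochner_Integration.integral_cong) (auto simp: m_assoc gc x \<Gamma>_carrier)
      also have "\<dots> = f (g \<otimes> x)"
        by (rule Suc.IH[symmetric]) (simp add: x Suc.prems subgroup.m_closed[OF subgroup_\<Gamma>])
      finally show "(\<integral>h. f (g \<otimes> (x \<otimes> h)) \<partial>law n) = f (g \<otimes> x)" .
    qed
    interpret L: prob_space "law n" by (rule prob_space_law)
    note [measurable] = gm
    show "(\<lambda>x. \<integral>h. f (g \<otimes> (x \<otimes> h)) \<partial>law n) \<in> borel_measurable \<mu>"
      using measurable_compose[OF mult_measurable gm] by (simp add: case_prod_unfold)
  qed (use gm in simp)
  also have "\<dots> = f g" using f Suc.prems by (simp add: harmonic_on_\<Gamma>_def)
  finally show ?case by simp
qed

end

locale random_walk_cosets = random_walk +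
  fixes K :: "'a set"
  assumes subgroup_K: "subgroup K G" and K_sets [measurable]: "K \<in> sets BT"
    and countable_cosets: "countable (lcosets K)"
begin

abbreviation "Y \<equiv> lcosets K"

definition prob_coset :: "nat \<Rightarrow> 'a set \<Rightarrow> real" where
  "prob_coset n y = measure (law n) y"

text \<open>The law on cosets of the walk after \<open>n + 1\<close> steps, given that its first increment is \<open>x\<close>. Its average
  over \<open>x\<close> is \<open>prob_coset (Suc n)\<close>.\<close>

definition prob_shifted :: "nat \<Rightarrow> 'a \<Rightarrow> 'a set \<Rightarrow> real" where
  "prob_shifted n x y = (\<integral>g. indicator y (x \<otimes> g) \<partial>law n)"

definition entropy :: "nat \<Rightarrow> ennreal" where
  "entropy n = (\<integral>\<^sup>+ y. ennreal (xlogx_neg (prob_coset n y)) \<partial>count_space Y)"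

text \<open>How much knowing the first increment \<open>x\<close> changes the law of the position after \<open>n + 1\<close> steps.\<close>

definition hellinger :: "nat \<Rightarrow> 'a \<Rightarrow> ennreal" where
  "hellinger n x = (\<integral>\<^sup>+ y. ennreal ((sqrt (prob_shifted n x y) - sqrt (prob_coset (Suc n) y))\<^sup>2) \<partial>count_space Y)"

lemma K_carrier: "k \<in> K \<Longrightarrow> k \<in> carrier G"
  using subgroup.subset[OF subgroup_K] by blast

lemma coset_eq: "g \<in> carrier G \<Longrightarrow> g <# K = {x \<in> carrier G. inv g \<otimes> x \<in> K}"
proof -
  assume g: "g \<in> carrier G"
  have "x \<in> g <# K" if "x \<in> carrier G" "inv g \<otimes> x \<in> K" for x
  proof -
    have "x = g \<otimes> (inv g \<otimes> x)" using g that by (simp add: lmult_cancel_inv)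
    then show ?thesis using that unfolding l_coset_def by blast
  qed
  moreover have "x \<in> carrier G \<and> inv g \<otimes> x \<in> K" if x: "x \<in> g <# K" for x
  proof -
    obtain k where k: "k \<in> K" "x = g \<otimes> k" using x unfolding l_coset_def by blast
    then show ?thesis using g K_carrier by (simp add: m_assoc[symmetric])
  qed
  ultimately show ?thesis by blast
qed

lemma coset_in_Y: "g \<in> carrier G \<Longrightarrow> g <# K \<in> Y"
  unfolding LCOSETS_def by blast

lemma Y_E: assumes "y \<in> Y" obtains g where "g \<in> carrier G" "y = g <# K"
  using assms unfolding LCOSETS_def by blast

lemma coset_sets [measurable]: "y \<in> Y \<Longrightarrow> y \<in> sets BT"
proof (erule Y_E)
  fix g assume g: "g \<in> carrier G" "y = g <# K"
  have "{x \<in> space BT. inv g \<otimes> x \<in> K} \<in> sets BT"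
    using measurable_sets[OF measurable_lmult K_sets, of "inv g"] g by (simp add: vimage_def Int_def conj_commute)
  then show "y \<in> sets BT" using g by (simp add: coset_eq)
qed

lemma Y_carrier: "y \<in> Y \<Longrightarrow> y \<subseteq> carrier G"
  using sets.sets_into_space[OF coset_sets] by simp

lemma in_coset_iff:
  assumes y: "y \<in> Y" and x: "x \<in> carrier G"
  shows "x \<in> y \<longleftrightarrow> x <# K = y"
proof
  assume "x <# K = y"
  then show "x \<in> y" using x subgroup.one_closed[OF subgroup_K] by (auto simp: coset_eq)
next
  assume xy: "x \<in> y"
  from y obtain g where g: "g \<in> carrier G" "y = g <# K" by (rule Y_E)
  have k: "inv g \<otimes> x \<in> K" using xy g by (simp add: coset_eq)
  show "x <# K = y"
    unfolding g(2) coset_eq[OF x] coset_eq[OF g(1)]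
  proof (intro Collect_cong conj_cong refl)
    fix z assume z: "z \<in> carrier G"
    have 1: "inv g \<otimes> z = (inv g \<otimes> x) \<otimes> (inv x \<otimes> z)"
      using x z g(1) by (simp add: m_assoc lmult_cancel_inv)
    have 2: "inv x \<otimes> z = inv (inv g \<otimes> x) \<otimes> (inv g \<otimes> z)"
      using x z g(1) by (simp add: m_assoc inv_mult_group lmult_cancel_inv)
    show "inv x \<otimes> z \<in> K \<longleftrightarrow> inv g \<otimes> z \<in> K"
      using 1 2 k subgroup.m_closed[OF subgroup_K] subgroup.m_inv_closed[OF subgroup_K] by metis
  qed
qed

lemma coset_measurable: "(\<lambda>g. g <# K) \<in> measurable BT (count_space Y)"
proof (rule measurable_count_space_eq_countable[THEN iffD2, OF countable_cosets], safe)
  fix g assume "g \<in> space BT" then show "g <# K \<in> Y" by (simp add: coset_in_Y)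
next
  fix y assume y: "y \<in> Y"
  have "(\<lambda>g. g <# K) -` {y} \<inter> space BT = y"
    using Y_carrier[OF y] in_coset_iff[OF y] by auto
  then show "(\<lambda>g. g <# K) -` {y} \<inter> space BT \<in> sets BT" using y by simp
qed

lemma prob_coset_bounds: "0 \<le> prob_coset n y" "prob_coset n y \<le> 1"
  using prob_space.prob_le_1[OF prob_space_law] by (simp_all add: prob_coset_def)

lemma prob_shifted_eq:
  assumes "x \<in> carrier G" "y \<in> Y"
  shows "prob_shifted n x y = prob_coset n (inv x <# y)" and "inv x <# y \<in> Y"
proof -
  obtain g where g: "g \<in> carrier G" "y = g <# K" using assms(2) by (rule Y_E)
  have e: "inv x <# y = (inv x \<otimes> g) <# K"
    using assms g K_carrier by (simp add: lcos_m_assoc subset_eq)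
  then show Y: "inv x <# y \<in> Y" using assms g by (simp add: coset_in_Y)
  have "x \<otimes> h \<in> y \<longleftrightarrow> h \<in> inv x <# y" if h: "h \<in> carrier G" for h
    using assms g h unfolding e by (simp add: coset_eq g inv_mult_group m_assoc)
  then have "prob_shifted n x y = (\<integral>g. indicator (inv x <# y) g \<partial>law n)"
    unfolding prob_shifted_def by (intro Bochner_Integration.integral_cong) (auto simp: indicator_def)
  then show "prob_shifted n x y = prob_coset n (inv x <# y)"
    using Y_carrier[OF Y] by (simp add: prob_coset_def Int_absorb2)
qed

lemma prob_shifted_bounds:
  "x \<in> carrier G \<Longrightarrow> y \<in> Y \<Longrightarrow> 0 \<le> prob_shifted n x y"
  "x \<in> carrier G \<Longrightarrow> y \<in> Y \<Longrightarrow> prob_shifted n x y \<le> 1"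
  using prob_coset_bounds by (simp_all add: prob_shifted_eq)

lemma prob_shifted_measurable [measurable]: "y \<in> Y \<Longrightarrow> (\<lambda>x. prob_shifted n x y) \<in> borel_measurable \<mu>"
proof -
  assume y: "y \<in> Y"
  interpret L: prob_space "law n" by (rule prob_space_law)
  have "(\<lambda>p. indicator y (case p of (x, g) \<Rightarrow> x \<otimes> g) :: real) \<in> borel_measurable (BT \<Otimes>\<^sub>M BT)"
    using measurable_compose[OF mult_measurable borel_measurable_indicator[OF coset_sets[OF y]]] .
  then have "(\<lambda>(x, g). indicator y (x \<otimes> g) :: real) \<in> borel_measurable (\<mu> \<Otimes>\<^sub>M law n)"
    by (simp add: case_prod_unfold cong: measurable_cong_sets)
  then show ?thesis unfolding prob_shifted_def by (rule L.borel_measurable_lebesgue_integral)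
qed

lemma prob_coset_Suc: "y \<in> Y \<Longrightarrow> prob_coset (Suc n) y = (\<integral>x. prob_shifted n x y \<partial>\<mu>)"
proof -
  assume y: "y \<in> Y"
  have "prob_coset (Suc n) y = (\<integral>g. indicator y g \<partial>law (Suc n))"
    using Y_carrier[OF y] by (simp add: prob_coset_def Int_absorb2 del: mconv_pow.simps)
  also have "\<dots> = (\<integral>x. prob_shifted n x y \<partial>\<mu>)"
    unfolding prob_shifted_def by (rule integral_law_Suc[where B = 1]) (use y in \<open>auto simp: indicator_def\<close>)
  finally show ?thesis .
qed

lemma entropy_step_pointwise:
  assumes y: "y \<in> Y"
  shows "(\<integral>x. xlogx_neg (prob_shifted n x y) \<partial>\<mu>)
    + (\<integral>x. (sqrt (prob_shifted n x y) - sqrt (prob_coset (Suc n) y))\<^sup>2 \<partial>\<mu>)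
    \<le> xlogx_neg (prob_coset (Suc n) y)"
proof -
  let ?b = "prob_coset (Suc n) y" and ?q = "\<lambda>x. prob_shifted n x y"
  have [measurable]: "?q \<in> borel_measurable \<mu>" using y by (rule prob_shifted_measurable)
  have iq: "integrable \<mu> ?q"
    using prob_shifted_bounds y by (intro mu.integrable_const_bound[where B = 1]) auto
  have i1: "integrable \<mu> (\<lambda>x. xlogx_neg (?q x))"
    using xlogx_neg_bounds prob_shifted_bounds y by (intro mu.integrable_const_bound[where B = 1]) auto
  have le1: "\<bar>sqrt (?q x) - sqrt ?b\<bar> \<le> 1" if "x \<in> carrier G" for x
    using prob_shifted_bounds[OF that y, of n] prob_coset_bounds[of "Suc n" y]
      real_sqrt_le_1_iff[of "?q x"] real_sqrt_le_1_iff[of ?b] real_sqrt_ge_0_iff[of "?q x"] real_sqrt_ge_0_iff[of ?b]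
    by linarith
  have i2: "integrable \<mu> (\<lambda>x. (sqrt (?q x) - sqrt ?b)\<^sup>2)"
    using le1 by (intro mu.integrable_const_bound[where B = 1]) (auto simp: abs_square_le_1)
  show ?thesis
  proof (cases "?b = 0")
    case True
    then have "AE x in \<mu>. ?q x = 0"
      using integral_nonneg_eq_0_iff_AE[OF iq] prob_shifted_bounds(1)[OF _ y] prob_coset_Suc[OF y, of n] AE_I2[of \<mu>]
      by (metis (no_types, lifting) space_mu)
    then have "AE x in \<mu>. xlogx_neg (?q x) = 0" "AE x in \<mu>. (sqrt (?q x) - sqrt ?b)\<^sup>2 = 0"
      using True by (auto elim!: eventually_mono simp: xlogx_neg_def)
    then have "(\<integral>x. xlogx_neg (?q x) \<partial>\<mu>) = 0" "(\<integral>x. (sqrt (?q x) - sqrt ?b)\<^sup>2 \<partial>\<mu>) = 0"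
      by (intro integral_eq_zero_AE; simp)+
    then show ?thesis using True by (simp add: xlogx_neg_def)
  next
    case False
    then have b: "0 < ?b" using prob_coset_bounds[of "Suc n" y] by linarith
    have "(\<integral>x. xlogx_neg (?q x) \<partial>\<mu>) + (\<integral>x. (sqrt (?q x) - sqrt ?b)\<^sup>2 \<partial>\<mu>)
      = (\<integral>x. xlogx_neg (?q x) + (sqrt (?q x) - sqrt ?b)\<^sup>2 \<partial>\<mu>)"
      using i1 i2 by simp
    also have "\<dots> \<le> (\<integral>x. xlogx_neg ?b - (ln ?b + 1) * (?q x - ?b) \<partial>\<mu>)"
    proof (rule integral_mono)
      fix x assume "x \<in> space \<mu>"
      then show "xlogx_neg (?q x) + (sqrt (?q x) - sqrt ?b)\<^sup>2 \<le> xlogx_neg ?b - (ln ?b + 1) * (?q x - ?b)"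
        using xlogx_neg_tangent[OF prob_shifted_bounds(1) b] y by simp
    qed (use i1 i2 iq in auto)
    also have "\<dots> = xlogx_neg ?b - (ln ?b + 1) * ((\<integral>x. ?q x \<partial>\<mu>) - ?b)"
      using iq by (simp add: mu.prob_space)
    also have "\<dots> = xlogx_neg ?b" using prob_coset_Suc[OF y, of n] by simp
    finally show ?thesis .
  qed
qed

text \<open>Left translation permutes the left cosets, so it does not change entropy.\<close>

lemma entropy_shifted:
  assumes x: "x \<in> carrier G"
  shows "(\<integral>\<^sup>+ y. ennreal (xlogx_neg (prob_shifted n x y)) \<partial>count_space Y) = entropy n"
proof -
  have bij: "bij_betw (\<lambda>y. inv x <# y) Y Y"
  proof (rule bij_betwI[where g = "\<lambda>y. x <# y"])
    show "(\<lambda>y. inv x <# y) \<in> Y \<rightarrow> Y" using prob_shifted_eq(2)[OF x] by blast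
    show "(\<lambda>y. x <# y) \<in> Y \<rightarrow> Y" using prob_shifted_eq(2)[of "inv x"] x by auto
    show "x <# (inv x <# y) = y" if "y \<in> Y" for y
      using that x Y_carrier[of y] by (simp add: lcos_m_assoc lcos_mult_one)
    show "inv x <# (x <# y) = y" if "y \<in> Y" for y
      using that x Y_carrier[of y] by (simp add: lcos_m_assoc lcos_mult_one)
  qed
  have "(\<integral>\<^sup>+ y. ennreal (xlogx_neg (prob_shifted n x y)) \<partial>count_space Y)
    = (\<integral>\<^sup>+ y. ennreal (xlogx_neg (prob_coset n (inv x <# y))) \<partial>count_space Y)"
    by (intro nn_integral_cong) (simp add: prob_shifted_eq x)
  also have "\<dots> = entropy n"
    unfolding entropy_def by (rule nn_integral_bij_count_space[OF bij])
  finally show ?thesis .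
qed

lemma hellinger_measurable [measurable]: "hellinger n \<in> borel_measurable \<mu>"
proof -
  interpret sigma_finite_measure "count_space Y"
    using countable_cosets by (rule sigma_finite_measure_count_space_countable)
  have "(\<lambda>(x, y). ennreal ((sqrt (prob_shifted n x y) - sqrt (prob_coset (Suc n) y))\<^sup>2))
    \<in> borel_measurable (\<mu> \<Otimes>\<^sub>M count_space Y)"
    using countable_cosets
    by (subst measurable_pair_swap_iff, intro measurable_pair_measure_countable1) (auto simp: case_prod_unfold)
  then show ?thesis unfolding hellinger_def[abs_def] by (rule borel_measurable_nn_integral)
qed

text \<open>The conditional laws all have the entropy of \<open>n\<close> steps, and the law of \<open>n + 1\<close> steps is their average.
  The gain in entropy is therefore the mutual information between the first increment and the position,
  and this dominates the mean squared Hellinger distance.\<close>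

lemma entropy_step: "entropy n + (\<integral>\<^sup>+ x. hellinger n x \<partial>\<mu>) \<le> entropy (Suc n)"
proof -
  let ?h = "\<lambda>x y. (sqrt (prob_shifted n x y) - sqrt (prob_coset (Suc n) y))\<^sup>2"
  have "entropy n = (\<integral>\<^sup>+ x. entropy n \<partial>\<mu>)" by (simp add: mu.emeasure_space_1)
  also have "\<dots> = (\<integral>\<^sup>+ x. (\<integral>\<^sup>+ y. ennreal (xlogx_neg (prob_shifted n x y)) \<partial>count_space Y) \<partial>\<mu>)"
    by (intro nn_integral_cong) (simp add: entropy_shifted)
  also have "\<dots> = (\<integral>\<^sup>+ y. (\<integral>\<^sup>+ x. ennreal (xlogx_neg (prob_shifted n x y)) \<partial>\<mu>) \<partial>count_space Y)"
    by (rule nn_integral_count_space_nn_integral[OF countable_cosets]) measurable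
  finally have 1: "entropy n = \<dots>" .
  have 2: "(\<integral>\<^sup>+ x. hellinger n x \<partial>\<mu>) = (\<integral>\<^sup>+ y. (\<integral>\<^sup>+ x. ennreal (?h x y) \<partial>\<mu>) \<partial>count_space Y)"
    unfolding hellinger_def
    by (rule nn_integral_count_space_nn_integral[OF countable_cosets]) measurable
  have "entropy n + (\<integral>\<^sup>+ x. hellinger n x \<partial>\<mu>) = 
    (\<integral>\<^sup>+ y. (\<integral>\<^sup>+ x. ennreal (xlogx_neg (prob_shifted n x y)) \<partial>\<mu>) + (\<integral>\<^sup>+ x. ennreal (?h x y) \<partial>\<mu>) \<partial>count_space Y)"
    unfolding 1 2 by (subst nn_integral_add) auto
  also have "\<dots> \<le> entropy (Suc n)"
    unfolding entropy_def
  proof (rule nn_integral_mono)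
    fix y assume "y \<in> space (count_space Y)"
    then have y: "y \<in> Y" by simp
    let ?q = "\<lambda>x. prob_shifted n x y"
    have [measurable]: "?q \<in> borel_measurable \<mu>" using y by (rule prob_shifted_measurable)
    have i1: "integrable \<mu> (\<lambda>x. xlogx_neg (?q x))"
      using xlogx_neg_bounds prob_shifted_bounds y by (intro mu.integrable_const_bound[where B = 1]) auto
    have le1: "\<bar>sqrt (?q x) - sqrt (prob_coset (Suc n) y)\<bar> \<le> 1" if "x \<in> carrier G" for x
      using prob_shifted_bounds[OF that y, of n] prob_coset_bounds[of "Suc n" y]
        real_sqrt_le_1_iff[of "?q x"] real_sqrt_le_1_iff[of "prob_coset (Suc n) y"]
        real_sqrt_ge_0_iff[of "?q x"] real_sqrt_ge_0_iff[of "prob_coset (Suc n) y"]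
      by linarith
    have i2: "integrable \<mu> (\<lambda>x. ?h x y)"
      using le1 by (intro mu.integrable_const_bound[where B = 1]) (auto simp: abs_square_le_1)
    have "(\<integral>\<^sup>+ x. ennreal (xlogx_neg (?q x)) \<partial>\<mu>) = ennreal (\<integral>x. xlogx_neg (?q x) \<partial>\<mu>)"
      using xlogx_neg_bounds prob_shifted_bounds y by (intro nn_integral_eq_integral i1) auto
    moreover have "(\<integral>\<^sup>+ x. ennreal (?h x y) \<partial>\<mu>) = ennreal (\<integral>x. ?h x y \<partial>\<mu>)"
      by (intro nn_integral_eq_integral i2) auto
    moreover have "0 \<le> (\<integral>x. xlogx_neg (?q x) \<partial>\<mu>)" "0 \<le> (\<integral>x. ?h x y \<partial>\<mu>)"
      using xlogx_neg_bounds prob_shifted_bounds y by (auto intro!: integral_nonneg_AE)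
    ultimately show "(\<integral>\<^sup>+ x. ennreal (xlogx_neg (?q x)) \<partial>\<mu>) + (\<integral>\<^sup>+ x. ennreal (?h x y) \<partial>\<mu>)
       \<le> ennreal (xlogx_neg (prob_coset (Suc n) y))"
      using entropy_step_pointwise[OF y, of n] by (simp add: ennreal_leI flip: ennreal_plus)
  qed
  finally show ?thesis .
qed

lemma sum_hellinger_le_entropy: "(\<Sum>k<n. \<integral>\<^sup>+ x. hellinger k x \<partial>\<mu>) \<le> entropy n"
proof (induction n)
  case (Suc n)
  have "(\<Sum>k<Suc n. \<integral>\<^sup>+ x. hellinger k x \<partial>\<mu>) \<le> entropy n + (\<integral>\<^sup>+ x. hellinger n x \<partial>\<mu>)"
    using Suc by (simp add: add_right_mono)
  also have "\<dots> \<le> entropy (Suc n)" by (rule entropy_step)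
  finally show ?case .
qed simp

lemma distr_coset:
  assumes x: "x \<in> carrier G"
  shows "distr (law n) (count_space Y) (\<lambda>g. (x \<otimes> g) <# K) = density (count_space Y) (\<lambda>y. ennreal (prob_shifted n x y))"
    and "(\<lambda>g. (x \<otimes> g) <# K) \<in> measurable (law n) (count_space Y)"
proof -
  have m: "(\<lambda>g. (x \<otimes> g) <# K) \<in> measurable BT (count_space Y)"
    using measurable_compose[OF measurable_lmult[OF x] coset_measurable] .
  then show m': "(\<lambda>g. (x \<otimes> g) <# K) \<in> measurable (law n) (count_space Y)" by simp
  interpret L: prob_space "law n" by (rule prob_space_law)
  show "distr (law n) (count_space Y) (\<lambda>g. (x \<otimes> g) <# K) = density (count_space Y) (\<lambda>y. ennreal (prob_shifted n x y))"
  proof (rule measure_eqI_countable[of _ Y])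
    fix y assume y: "y \<in> Y"
    let ?S = "{g \<in> carrier G. x \<otimes> g \<in> y}"
    have S: "(\<lambda>g. (x \<otimes> g) <# K) -` {y} \<inter> space (law n) = ?S"
      using in_coset_iff[OF y] x by auto
    have Sm: "?S \<in> sets (law n)"
      using measurable_sets[OF m', of "{y}"] y unfolding S by simp
    have "prob_shifted n x y = (\<integral>g. indicator ?S g \<partial>law n)"
      unfolding prob_shifted_def by (intro Bochner_Integration.integral_cong) (auto simp: indicator_def)
    also have "\<dots> = L.prob ?S" using Sm by (simp add: Int_absorb2)
    finally have q: "prob_shifted n x y = L.prob ?S" .
    have "emeasure (distr (law n) (count_space Y) (\<lambda>g. (x \<otimes> g) <# K)) {y} = emeasure (law n) ?S"
      using y m' S by (subst emeasure_distr) auto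
    also have "\<dots> = ennreal (prob_shifted n x y)" unfolding q by (rule L.emeasure_eq_measure)
    also have "\<dots> = emeasure (density (count_space Y) (\<lambda>y. ennreal (prob_shifted n x y))) {y}"
      using y by (subst emeasure_density) (auto simp: nn_integral_indicator_singleton)
    finally show "emeasure (distr (law n) (count_space Y) (\<lambda>g. (x \<otimes> g) <# K)) {y}
      = emeasure (density (count_space Y) (\<lambda>y. ennreal (prob_shifted n x y))) {y}" .
  qed (use countable_cosets in auto)
qed

lemma prob_shifted_one: "y \<in> Y \<Longrightarrow> prob_shifted n \<one> y = prob_coset n y"
  using Y_carrier[of y] by (simp add: prob_shifted_eq lcos_mult_one)

lemma nn_integral_prob_shifted:
  assumes x: "x \<in> carrier G"
  shows "(\<integral>\<^sup>+ y. ennreal (prob_shifted n x y) \<partial>count_space Y) = 1"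
proof -
  interpret L: prob_space "law n" by (rule prob_space_law)
  interpret D: prob_space "distr (law n) (count_space Y) (\<lambda>g. (x \<otimes> g) <# K)"
    by (rule L.prob_space_distr[OF distr_coset(2)[OF x]])
  have "emeasure (density (count_space Y) (\<lambda>y. ennreal (prob_shifted n x y))) Y = 1"
    using D.emeasure_space_1 unfolding distr_coset(1)[OF x] by simp
  moreover have "emeasure (density (count_space Y) (\<lambda>y. ennreal (prob_shifted n x y))) Y
    = (\<integral>\<^sup>+ y. ennreal (prob_shifted n x y) * indicator Y y \<partial>count_space Y)"
    by (rule emeasure_density) auto
  moreover have "\<dots> = (\<integral>\<^sup>+ y. ennreal (prob_shifted n x y) \<partial>count_space Y)"
    by (intro nn_integral_cong) auto
  ultimately show ?thesis by simp
qed

lemma nn_integral_prob_coset: "(\<integral>\<^sup>+ y. ennreal (prob_coset n y) \<partial>count_space Y) = 1"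
  using nn_integral_prob_shifted[of \<one> n] by (simp add: prob_shifted_one cong: nn_integral_cong_simp)

text \<open>An entropy bound needs only a function \<open>L\<close> on the cosets with summable \<open>exp (- L)\<close> and small mean
  along the walk.\<close>

lemma entropy_gibbs:
  assumes L: "\<And>y. 0 \<le> L y"
  shows "entropy n \<le> (\<integral>\<^sup>+ g. ennreal (L (g <# K)) \<partial>law n) + (\<integral>\<^sup>+ y. ennreal (exp (- L y)) \<partial>count_space Y)"
proof -
  have "entropy n \<le> (\<integral>\<^sup>+ y. ennreal (prob_coset n y) * ennreal (L y) + ennreal (exp (- L y)) \<partial>count_space Y)"
    unfolding entropy_def using L prob_coset_bounds xlogx_neg_gibbs
    by (intro nn_integral_mono) (simp flip: ennreal_plus ennreal_mult add: ennreal_leI)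
  also have "\<dots> = (\<integral>\<^sup>+ y. ennreal (prob_coset n y) * ennreal (L y) \<partial>count_space Y) + (\<integral>\<^sup>+ y. ennreal (exp (- L y)) \<partial>count_space Y)"
    by (rule nn_integral_add) auto
  also have "(\<integral>\<^sup>+ y. ennreal (prob_coset n y) * ennreal (L y) \<partial>count_space Y)
    = (\<integral>\<^sup>+ y. ennreal (prob_shifted n \<one> y) * ennreal (L y) \<partial>count_space Y)"
    by (intro nn_integral_cong) (simp add: prob_shifted_one)
  also have "\<dots> = (\<integral>\<^sup>+ y. ennreal (L y) \<partial>density (count_space Y) (\<lambda>y. ennreal (prob_shifted n \<one> y)))"
    by (subst nn_integral_density) auto
  also have "\<dots> = (\<integral>\<^sup>+ g. ennreal (L ((\<one> \<otimes> g) <# K)) \<partial>law n)"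
    by (subst distr_coset(1)[OF one_closed, symmetric], subst nn_integral_distr[OF distr_coset(2)[OF one_closed]]) auto
  also have "\<dots> = (\<integral>\<^sup>+ g. ennreal (L (g <# K)) \<partial>law n)"
    by (intro nn_integral_cong) simp
  finally show ?thesis .
qed

lemma total_variation_le_hellinger:
  assumes x: "x \<in> carrier G" and lam: "0 < lam"
  shows "(\<integral>\<^sup>+ y. ennreal \<bar>prob_shifted n x y - prob_coset (Suc n) y\<bar> \<partial>count_space Y)
    \<le> ennreal (lam / 2) * hellinger n x + ennreal (2 / lam)"
proof -
  let ?q = "prob_shifted n x" and ?P = "prob_coset (Suc n)"
  have pt: "\<bar>?q y - ?P y\<bar> \<le> lam / 2 * (sqrt (?q y) - sqrt (?P y))\<^sup>2 + 1 / lam * ?q y + 1 / lam * ?P y"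
    if y: "y \<in> Y" for y
    using prob_shifted_bounds(1)[OF x y] prob_coset_bounds(1) lam by (rule abs_diff_le_hellinger)
  have "(\<integral>\<^sup>+ y. ennreal \<bar>?q y - ?P y\<bar> \<partial>count_space Y)
    \<le> (\<integral>\<^sup>+ y. (ennreal (lam / 2) * ennreal ((sqrt (?q y) - sqrt (?P y))\<^sup>2) + ennreal (1 / lam) * ennreal (?q y))
        + ennreal (1 / lam) * ennreal (?P y) \<partial>count_space Y)"
    using pt lam prob_shifted_bounds[OF x] prob_coset_bounds
    by (intro nn_integral_mono) (simp flip: ennreal_plus ennreal_mult add: ennreal_leI)
  also have "\<dots> = ennreal (lam / 2) * hellinger n x + ennreal (1 / lam) + ennreal (1 / lam)"
    by (simp add: nn_integral_add nn_integral_cmult nn_integral_prob_shifted[OF x] nn_integral_prob_coset hellinger_def)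
  also have "\<dots> = ennreal (lam / 2) * hellinger n x + ennreal (2 / lam)"
    using lam by (simp add: add.assoc flip: ennreal_plus)
  finally show ?thesis .
qed

lemma integral_coset_function_diff:
  assumes x: "x \<in> carrier G" and \<phi>: "\<And>y. \<bar>\<phi> y\<bar> \<le> (B::real)"
  shows "ennreal \<bar>(\<integral>g. \<phi> ((x \<otimes> g) <# K) \<partial>law n) - (\<integral>g. \<phi> (g <# K) \<partial>law (Suc n))\<bar>
    \<le> ennreal B * (\<integral>\<^sup>+ y. ennreal \<bar>prob_shifted n x y - prob_coset (Suc n) y\<bar> \<partial>count_space Y)"
proof -
  have B: "0 \<le> B" using \<phi>[of undefined] by linarith
  have eq: "(\<integral>g. \<phi> ((z \<otimes> g) <# K) \<partial>law m) = (\<integral>y. prob_shifted m z y * \<phi> y \<partial>count_space Y)"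
    "integrable (count_space Y) (prob_shifted m z)" "integrable (count_space Y) (\<lambda>y. prob_shifted m z y * \<phi> y)"
    if z: "z \<in> carrier G" for z m
  proof -
    have "(\<integral>g. \<phi> ((z \<otimes> g) <# K) \<partial>law m) = (\<integral>y. \<phi> y \<partial>density (count_space Y) (\<lambda>y. ennreal (prob_shifted m z y)))"
      by (subst distr_coset(1)[OF z, symmetric], subst integral_distr[OF distr_coset(2)[OF z]]) auto
    also have "\<dots> = (\<integral>y. prob_shifted m z y * \<phi> y \<partial>count_space Y)"
      using prob_shifted_bounds[OF z] by (subst integral_density) (auto simp: AE_count_space)
    finally show "(\<integral>g. \<phi> ((z \<otimes> g) <# K) \<partial>law m) = \<dots>" .
    show i: "integrable (count_space Y) (prob_shifted m z)"
      using nn_integral_prob_shifted[OF z] prob_shifted_bounds[OF z]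
      by (intro integrableI_nonneg) (auto simp: AE_count_space)
    show "integrable (count_space Y) (\<lambda>y. prob_shifted m z y * \<phi> y)"
    proof (rule Bochner_Integration.integrable_bound[OF integrable_mult_right[OF i, of B]])
      show "AE y in count_space Y. norm (prob_shifted m z y * \<phi> y) \<le> norm (B * prob_shifted m z y)"
        using \<phi> B prob_shifted_bounds[OF z] by (auto simp: AE_count_space abs_mult mult.commute intro!: mult_right_mono)
    qed simp
  qed
  have P: "(\<integral>g. \<phi> (g <# K) \<partial>law (Suc n)) = (\<integral>y. prob_shifted (Suc n) \<one> y * \<phi> y \<partial>count_space Y)"
  proof -
    have "(\<integral>g. \<phi> (g <# K) \<partial>law (Suc n)) = (\<integral>g. \<phi> ((\<one> \<otimes> g) <# K) \<partial>law (Suc n))"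
      by (rule Bochner_Integration.integral_cong[OF refl]) (simp del: mconv_pow.simps)
    also have "\<dots> = (\<integral>y. prob_shifted (Suc n) \<one> y * \<phi> y \<partial>count_space Y)" by (rule eq(1)[OF one_closed])
    finally show ?thesis .
  qed
  let ?d = "\<lambda>y. prob_shifted n x y - prob_shifted (Suc n) \<one> y"
  have "(\<integral>g. \<phi> ((x \<otimes> g) <# K) \<partial>law n) - (\<integral>g. \<phi> (g <# K) \<partial>law (Suc n)) = (\<integral>y. ?d y * \<phi> y \<partial>count_space Y)"
    unfolding P eq(1)[OF x] using eq(3)[OF x] eq(3)[OF one_closed] by (simp add: left_diff_distrib)
  then have "ennreal \<bar>(\<integral>g. \<phi> ((x \<otimes> g) <# K) \<partial>law n) - (\<integral>g. \<phi> (g <# K) \<partial>law (Suc n))\<bar>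
    \<le> (\<integral>\<^sup>+ y. ennreal (norm (?d y * \<phi> y)) \<partial>count_space Y)"
    using integral_norm_bound_ennreal[of "count_space Y" "\<lambda>y. ?d y * \<phi> y"] eq(3)[OF x] eq(3)[OF one_closed]
    by (simp add: left_diff_distrib)
  also have "\<dots> \<le> (\<integral>\<^sup>+ y. ennreal B * ennreal \<bar>prob_shifted n x y - prob_coset (Suc n) y\<bar> \<partial>count_space Y)"
    using \<phi> B by (intro nn_integral_mono)
      (auto simp: prob_shifted_one abs_mult mult.commute simp flip: ennreal_mult intro!: ennreal_leI mult_right_mono)
  also have "\<dots> = ennreal B * (\<integral>\<^sup>+ y. ennreal \<bar>prob_shifted n x y - prob_coset (Suc n) y\<bar> \<partial>count_space Y)"
    by (rule nn_integral_cmult) simp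
  finally show ?thesis .
qed

end

locale random_walk_entropy = random_walk_in_subgroup + random_walk_cosets
begin

text \<open>The values \<open>f x\<close> and \<open>f \<one>\<close> are integrals of \<open>f\<close> against the law of the position with and without the
  knowledge that the first increment is \<open>x\<close>. Since \<open>f\<close> is constant on cosets up to \<open>\<epsilon>\<close>, only the laws on
  cosets matter.\<close>

lemma harmonic_diff_le:
  assumes f: "harmonic_on_\<Gamma> B f" and x: "x \<in> \<Gamma>" and lam: "0 < lam" and eps: "0 \<le> \<epsilon>"
    and inv: "\<And>g k. g \<in> \<Gamma> \<Longrightarrow> k \<in> K \<Longrightarrow> g \<otimes> k \<in> \<Gamma> \<Longrightarrow> \<bar>f (g \<otimes> k) - f g\<bar> \<le> \<epsilon>"
  shows "ennreal \<bar>f x - f \<one>\<bar> \<le> ennreal (2 * \<epsilon> + 2 * B / lam) + ennreal (B * lam / 2) * hellinger n x"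
proof -
  \<comment> \<open>representatives are taken in \<open>\<Gamma>\<close>, where alone \<open>f\<close> is controlled\<close>
  define \<phi> where "\<phi> y = (if y \<inter> \<Gamma> \<noteq> {} then f (SOME h. h \<in> y \<inter> \<Gamma>) else 0)" for y
  have fm [measurable]: "f \<in> borel_measurable BT" and fB: "\<And>g. \<bar>f g\<bar> \<le> B"
    using f by (simp_all add: harmonic_on_\<Gamma>_def)
  have B: "0 \<le> B" using fB[of \<one>] by linarith
  have \<phi>B: "\<bar>\<phi> y\<bar> \<le> B" for y using fB B by (simp add: \<phi>_def)
  have \<phi>f: "\<bar>f h - \<phi> (h <# K)\<bar> \<le> \<epsilon>" if h: "h \<in> \<Gamma>" for h
  proof -
    have hc: "h \<in> carrier G" using h by (rule \<Gamma>_carrier)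
    have "h \<in> (h <# K) \<inter> \<Gamma>" using h in_coset_iff[OF coset_in_Y[OF hc] hc] by simp
    then have ne: "(h <# K) \<inter> \<Gamma> \<noteq> {}" by blast
    define r where "r = (SOME r. r \<in> (h <# K) \<inter> \<Gamma>)"
    have r: "r \<in> h <# K" "r \<in> \<Gamma>" using someI_ex[of "\<lambda>r. r \<in> (h <# K) \<inter> \<Gamma>"] ne unfolding r_def by blast+
    from r(1) obtain k where k: "k \<in> K" "r = h \<otimes> k" unfolding l_coset_def by blast
    have "\<phi> (h <# K) = f r" using ne by (simp add: \<phi>_def r_def)
    then show ?thesis using inv[OF h k(1)] k(2) r(2) by (simp add: abs_minus_commute)
  qed
  have approx: "\<bar>f z - (\<integral>g. \<phi> ((z \<otimes> g) <# K) \<partial>law m)\<bar> \<le> \<epsilon>" if z: "z \<in> \<Gamma>" for z m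
  proof -
    interpret L: prob_space "law m" by (rule prob_space_law)
    have zc: "z \<in> carrier G" using z by (rule \<Gamma>_carrier)
    have i1: "integrable (law m) (\<lambda>g. f (z \<otimes> g))"
      using fB measurable_compose[OF measurable_lmult[OF zc] fm] by (intro L.integrable_const_bound[where B = B]) auto
    have m2: "(\<lambda>g. \<phi> ((z \<otimes> g) <# K)) \<in> borel_measurable (law m)"
      by (rule measurable_compose[OF distr_coset(2)[OF zc]]) simp
    have i2: "integrable (law m) (\<lambda>g. \<phi> ((z \<otimes> g) <# K))"
      using \<phi>B m2 by (intro L.integrable_const_bound[where B = B]) auto
    have "f z - (\<integral>g. \<phi> ((z \<otimes> g) <# K) \<partial>law m) = (\<integral>g. f (z \<otimes> g) - \<phi> ((z \<otimes> g) <# K) \<partial>law m)"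
      using harmonic_law[OF f z, of m] i1 i2 by simp
    also have "\<bar>\<dots>\<bar> \<le> (\<integral>g. \<bar>f (z \<otimes> g) - \<phi> ((z \<otimes> g) <# K)\<bar> \<partial>law m)" by (rule integral_abs_bound)
    also have "\<dots> \<le> (\<integral>g. \<epsilon> \<partial>law m)"
    proof (rule integral_mono_AE)
      show "AE g in law m. \<bar>f (z \<otimes> g) - \<phi> ((z \<otimes> g) <# K)\<bar> \<le> \<epsilon>"
        using AE_law_\<Gamma>[of m] by eventually_elim (intro \<phi>f subgroup.m_closed[OF subgroup_\<Gamma> z])
    qed (use i1 i2 in auto)
    finally show ?thesis by (simp add: L.prob_space)
  qed
  have xc: "x \<in> carrier G" using x by (rule \<Gamma>_carrier)
  let ?D = "\<bar>(\<integral>g. \<phi> ((x \<otimes> g) <# K) \<partial>law n) - (\<integral>g. \<phi> (g <# K) \<partial>law (Suc n))\<bar>"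
  have "(\<integral>g. \<phi> ((\<one> \<otimes> g) <# K) \<partial>law (Suc n)) = (\<integral>g. \<phi> (g <# K) \<partial>law (Suc n))"
    by (rule Bochner_Integration.integral_cong[OF refl]) (simp del: mconv_pow.simps)
  then have "\<bar>f x - f \<one>\<bar> \<le> 2 * \<epsilon> + ?D"
    using approx[OF x, of n] approx[OF subgroup.one_closed[OF subgroup_\<Gamma>], of "Suc n"] by linarith
  then have "ennreal \<bar>f x - f \<one>\<bar> \<le> ennreal (2 * \<epsilon>) + ennreal ?D"
    using eps by (simp flip: ennreal_plus add: ennreal_leI)
  also have "ennreal ?D \<le> ennreal B * (ennreal (lam / 2) * hellinger n x + ennreal (2 / lam))"
    by (rule order_trans[OF integral_coset_function_diff[OF xc \<phi>B]])
       (rule mult_left_mono[OF total_variation_le_hellinger[OF xc lam] zero_le])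
  also have "\<dots> = ennreal (B * lam / 2) * hellinger n x + ennreal (2 * B / lam)"
    using B lam by (simp add: distrib_left mult.assoc[symmetric] flip: ennreal_mult)
  finally show ?thesis
    using B lam eps by (simp add: ac_simps add_left_mono ennreal_plus)
qed

text \<open>The Hellinger distances of the first \<open>n\<close> steps add up to at most the entropy. If the entropy is
  sublinear, some of them is small: the walk forgets its first increment, and \<open>f\<close> does not see it.\<close>

theorem entropy_criterion:
  assumes f: "harmonic_on_\<Gamma> B f" and eps: "0 \<le> \<epsilon>"
    and inv: "\<And>g k. g \<in> \<Gamma> \<Longrightarrow> k \<in> K \<Longrightarrow> g \<otimes> k \<in> \<Gamma> \<Longrightarrow> \<bar>f (g \<otimes> k) - f g\<bar> \<le> \<epsilon>"
    and growth: "\<And>\<delta>. 0 < \<delta> \<Longrightarrow> \<exists>n\<ge>1. entropy n \<le> ennreal (\<delta> * real n)"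
  shows "(\<integral>x. \<bar>f x - f \<one>\<bar> \<partial>\<mu>) \<le> 2 * \<epsilon>"
proof (rule field_le_epsilon)
  fix d :: real assume d: "0 < d"
  have fm [measurable]: "f \<in> borel_measurable BT" and fB: "\<And>g. \<bar>f g\<bar> \<le> B"
    using f by (simp_all add: harmonic_on_\<Gamma>_def)
  have B: "0 \<le> B" using fB[of \<one>] by linarith
  \<comment> \<open>the two error terms of \<open>harmonic_diff_le\<close> are \<open>2 * B / lam\<close> and \<open>B * lam / 2\<close> times the mean distance;
    \<open>lam\<close> and then the threshold \<open>dd\<close> make each at most \<open>d / 2\<close>\<close>
  define lam where "lam = 4 * (B + 1) / d"
  have lam: "0 < lam" using B d by (simp add: lam_def)
  define dd where "dd = d / (B * lam + 1)"
  have dd: "0 < dd" using B d lam by (simp add: dd_def add_nonneg_pos)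
  obtain n where n: "n \<ge> 1" "entropy n \<le> ennreal (dd / 2 * real n)" using growth[of "dd / 2"] dd by auto
  have "\<exists>k<n. (\<integral>\<^sup>+ x. hellinger k x \<partial>\<mu>) \<le> ennreal dd"
  proof (rule ccontr)
    assume "\<not> ?thesis"
    then have "(\<Sum>k<n. ennreal dd) \<le> (\<Sum>k<n. \<integral>\<^sup>+ x. hellinger k x \<partial>\<mu>)"
      by (intro sum_mono) (auto simp: not_le less_imp_le)
    also have "\<dots> \<le> ennreal (dd / 2 * real n)" using sum_hellinger_le_entropy n(2) by (rule order_trans)
    finally have "ennreal (real n * dd) \<le> ennreal (dd / 2 * real n)"
      using dd by (simp add: ennreal_mult ennreal_of_nat_eq_real_of_nat)
    then show False using dd n(1) by (simp add: ennreal_le_iff)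
  qed
  then obtain k where k: "(\<integral>\<^sup>+ x. hellinger k x \<partial>\<mu>) \<le> ennreal dd" by (elim exE conjE)
  have "\<bar>f x - f \<one>\<bar> \<le> 2 * B" for x using fB[of x] fB[of \<one>] by linarith
  then have i: "integrable \<mu> (\<lambda>x. \<bar>f x - f \<one>\<bar>)"
    by (intro mu.integrable_const_bound[where B = "2 * B"]) simp_all
  have "ennreal (\<integral>x. \<bar>f x - f \<one>\<bar> \<partial>\<mu>) = (\<integral>\<^sup>+ x. ennreal \<bar>f x - f \<one>\<bar> \<partial>\<mu>)"
    by (rule nn_integral_eq_integral[OF i, symmetric]) simp
  also have "\<dots> \<le> (\<integral>\<^sup>+ x. ennreal (2 * \<epsilon> + 2 * B / lam) + ennreal (B * lam / 2) * hellinger k x \<partial>\<mu>)"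
    by (rule nn_integral_mono_AE, use AE_\<Gamma> in eventually_elim) (rule harmonic_diff_le[OF f _ lam eps inv])
  also have "\<dots> = ennreal (2 * \<epsilon> + 2 * B / lam) + ennreal (B * lam / 2) * (\<integral>\<^sup>+ x. hellinger k x \<partial>\<mu>)"
    by (simp add: nn_integral_add nn_integral_cmult mu.emeasure_space_1)
  also have "\<dots> \<le> ennreal (2 * \<epsilon> + 2 * B / lam) + ennreal (B * lam / 2) * ennreal dd"
    by (intro add_left_mono mult_left_mono k) simp
  also have "\<dots> = ennreal (2 * \<epsilon> + 2 * B / lam + B * lam / 2 * dd)"
    using B lam dd eps by (simp flip: ennreal_mult ennreal_plus)
  finally have "(\<integral>x. \<bar>f x - f \<one>\<bar> \<partial>\<mu>) \<le> 2 * \<epsilon> + 2 * B / lam + B * lam / 2 * dd"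
    using B lam dd eps by (subst (asm) ennreal_le_iff) simp_all
  moreover have "2 * B / lam \<le> d / 2"
  proof -
    have "2 * B / lam = d / 2 * (B / (B + 1))" using B d by (simp add: lam_def field_simps)
    also have "\<dots> \<le> d / 2 * 1" using B d by (intro mult_left_mono) simp_all
    finally show ?thesis by simp
  qed
  moreover have "B * lam / 2 * dd \<le> d / 2"
  proof -
    have "B * lam / 2 * dd = d / 2 * (B * lam / (B * lam + 1))" by (simp add: dd_def)
    also have "\<dots> \<le> d / 2 * 1" using B d lam by (intro mult_left_mono) (simp_all add: divide_le_eq_1 add_nonneg_pos)
    finally show ?thesis by simp
  qed
  ultimately show "(\<integral>x. \<bar>f x - f \<one>\<bar> \<partial>\<mu>) \<le> 2 * \<epsilon> + d" by linarith
qed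

end

section \<open>Right uniform continuity of bounded harmonic functions\<close>

lemma translates_of_compact_in_open:
  assumes tg: "topological_group G T" and A: "compactin T A" and U: "openin T U" "A \<subseteq> U"
  obtains W where "openin T W" "\<one>\<^bsub>G\<^esub> \<in> W" "\<And>k x. k \<in> W \<Longrightarrow> x \<in> A \<Longrightarrow> k \<otimes>\<^bsub>G\<^esub> x \<in> U"
proof -
  interpret group G using tg by (simp add: topological_group_def)
  have ts: "topspace T = carrier G" using tg by (simp add: topological_group_def)
  let ?P = "{p \<in> topspace (prod_topology T T). (case p of (x, y) \<Rightarrow> x \<otimes>\<^bsub>G\<^esub> y) \<in> U}"
  have P: "openin (prod_topology T T) ?P"
    using tg U(1) by (intro openin_continuous_map_preimage[where Y = T]) (simp_all add: topological_group_def)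
  have "{\<one>\<^bsub>G\<^esub>} \<times> A \<subseteq> ?P"
  proof
    fix p assume "p \<in> {\<one>\<^bsub>G\<^esub>} \<times> A"
    then obtain x where x: "x \<in> A" "p = (\<one>\<^bsub>G\<^esub>, x)" by blast
    then have xc: "x \<in> carrier G" using compactin_subset_topspace[OF A] ts by blast
    have "\<one>\<^bsub>G\<^esub> \<otimes>\<^bsub>G\<^esub> x \<in> U" using x xc U(2) by (simp add: subset_eq)
    then show "p \<in> ?P" using xc ts x(2) by simp
  qed
  from tube_lemma_right[OF P A _ this] ts obtain W W' where
    W: "openin T W" "\<one>\<^bsub>G\<^esub> \<in> W" "A \<subseteq> W'" "W \<times> W' \<subseteq> ?P" by auto
  show ?thesis
  proof (rule that[OF W(1,2)])
    fix k x assume "k \<in> W" "x \<in> A"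
    then have "(k, x) \<in> ?P" using W by blast
    then show "k \<otimes>\<^bsub>G\<^esub> x \<in> U" by simp
  qed
qed

context random_walk
begin

lemma sets_lcoset: "k \<in> carrier G \<Longrightarrow> E \<in> sets BT \<Longrightarrow> k <# E \<in> sets BT"
  and lcoset_preimage: "k \<in> carrier G \<Longrightarrow> E \<in> sets BT \<Longrightarrow> {x \<in> carrier G. k \<otimes> x \<in> E} = inv k <# E"
proof -
  assume k: "k \<in> carrier G" and E: "E \<in> sets BT"
  have Ec: "E \<subseteq> carrier G" using sets.sets_into_space[OF E] by simp
  have e: "{x \<in> carrier G. k \<otimes> x \<in> E} = inv k <# E" if k: "k \<in> carrier G" for k
  proof (intro equalityI subsetI)
    fix x assume x: "x \<in> {x \<in> carrier G. k \<otimes> x \<in> E}"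
    then have "x = inv k \<otimes> (k \<otimes> x)" using k by (simp add: lmult_cancel_inv)
    then show "x \<in> inv k <# E" using x unfolding l_coset_def by blast
  next
    fix x assume "x \<in> inv k <# E"
    then obtain y where y: "y \<in> E" "x = inv k \<otimes> y" unfolding l_coset_def by blast
    then show "x \<in> {x \<in> carrier G. k \<otimes> x \<in> E}" using k Ec by (auto simp: lmult_cancel_inv)
  qed
  show "{x \<in> carrier G. k \<otimes> x \<in> E} = inv k <# E" by (rule e[OF k])
  have "k <# E = {x \<in> carrier G. inv k \<otimes> x \<in> E}" using e[of "inv k"] k by simp
  then show "k <# E \<in> sets BT"
    using measurable_sets[OF measurable_lmult[of "inv k"] E] k by (simp add: vimage_def Int_def conj_commute)
qed

lemma haar_sets: "haar_measure G T \<theta> \<Longrightarrow> sets \<theta> = sets BT"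
  and haar_lcoset: "haar_measure G T \<theta> \<Longrightarrow> g \<in> carrier G \<Longrightarrow> A \<in> sets BT \<Longrightarrow> emeasure \<theta> (g <# A) = emeasure \<theta> A"
  and haar_compact: "haar_measure G T \<theta> \<Longrightarrow> compactin T K \<Longrightarrow> emeasure \<theta> K < \<infinity>"
  and haar_outer: "haar_measure G T \<theta> \<Longrightarrow> A \<in> sets BT \<Longrightarrow>
    emeasure \<theta> A = (INF U\<in>{U. openin T U \<and> A \<subseteq> U}. emeasure \<theta> U)"
  unfolding haar_measure_def by blast+

lemma haar_measure_distr:
  assumes \<theta>: "haar_measure G T \<theta>" and k: "k \<in> carrier G"
  shows "distr \<theta> \<theta> (\<lambda>x. k \<otimes> x) = \<theta>"
proof (rule measure_eqI)
  have s: "sets \<theta> = sets BT" by (rule haar_sets[OF \<theta>])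
  fix E assume "E \<in> sets (distr \<theta> \<theta> (\<lambda>x. k \<otimes> x))"
  then have E: "E \<in> sets \<theta>" by simp
  have m: "(\<lambda>x. k \<otimes> x) \<in> measurable \<theta> \<theta>"
    using measurable_lmult[OF k] s by (simp cong: measurable_cong_sets)
  have sp: "space \<theta> = carrier G" using sets_eq_imp_space_eq[OF s] by simp
  have "emeasure (distr \<theta> \<theta> (\<lambda>x. k \<otimes> x)) E = emeasure \<theta> {x \<in> carrier G. k \<otimes> x \<in> E}"
    using E m by (simp add: emeasure_distr sp vimage_def Int_def conj_commute)
  also have "\<dots> = emeasure \<theta> E"
    using \<theta> E s k by (simp add: lcoset_preimage haar_lcoset)
  finally show "emeasure (distr \<theta> \<theta> (\<lambda>x. k \<otimes> x)) E = emeasure \<theta> E" .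
qed simp

text \<open>Continuity of translation in measure. Outer regularity gives an open set only slightly larger than
  \<open>A\<close>, and it still contains \<open>k A\<close> for \<open>k\<close> near the identity. By invariance the two differences have equal measure.\<close>

lemma haar_translate_diff:
  assumes \<theta>: "haar_measure G T \<theta>" and A: "compactin T A" "A \<in> sets BT" and d: "0 < (d::real)"
  obtains W where "openin T W" "\<one> \<in> W" "\<And>k. k \<in> W \<Longrightarrow> measure \<theta> ((k <# A) - A) \<le> d \<and> measure \<theta> (A - (k <# A)) \<le> d"
proof -
  have s: "sets \<theta> = sets BT" by (rule haar_sets[OF \<theta>])
  have fA: "emeasure \<theta> A < \<infinity>" by (rule haar_compact[OF \<theta> A(1)])
  have "emeasure \<theta> A = (INF U\<in>{U. openin T U \<and> A \<subseteq> U}. emeasure \<theta> U)"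
    by (rule haar_outer[OF \<theta> A(2)])
  moreover have "emeasure \<theta> A < emeasure \<theta> A + ennreal d"
    using fA d by (simp add: ennreal_add_left_cancel_less[of _ 0, simplified] top.not_eq_extremum)
  ultimately obtain U where U: "openin T U" "A \<subseteq> U" "emeasure \<theta> U < emeasure \<theta> A + ennreal d"
    by (metis (mono_tags, lifting) INF_less_iff mem_Collect_eq)
  have Us: "U \<in> sets \<theta>" "A \<in> sets \<theta>" using U A s by (simp_all add: openin_borel_of)
  have UA: "emeasure \<theta> (U - A) \<le> ennreal d"
    using U(3) fA Us U(2) by (subst emeasure_Diff) (auto simp: ennreal_minus_le_iff less_imp_le)
  obtain W where W: "openin T W" "\<one> \<in> W" "\<And>k x. k \<in> W \<Longrightarrow> x \<in> A \<Longrightarrow> k \<otimes> x \<in> U"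
    using translates_of_compact_in_open[OF topological_group A(1) U(1,2)] by metis
  show ?thesis
  proof (rule that[OF W(1,2)])
    fix k assume k: "k \<in> W"
    have kc: "k \<in> carrier G" using k openin_subset[OF W(1)] topspace_eq by auto
    have kA: "k <# A \<in> sets \<theta>" using sets_lcoset[OF kc A(2)] s by simp
    have "k <# A \<subseteq> U" using W(3)[OF k] unfolding l_coset_def by blast
    then have 1: "emeasure \<theta> ((k <# A) - A) \<le> ennreal d"
      using Us kA by (intro order_trans[OF emeasure_mono UA]) auto
    have eqm: "emeasure \<theta> (k <# A) = emeasure \<theta> A" by (rule haar_lcoset[OF \<theta> kc A(2)])
    have "emeasure \<theta> (A - (k <# A)) + emeasure \<theta> (A \<inter> (k <# A)) = emeasure \<theta> ((k <# A) - A) + emeasure \<theta> (A \<inter> (k <# A))"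
    proof -
      have "emeasure \<theta> (A - (k <# A)) + emeasure \<theta> (A \<inter> (k <# A)) = emeasure \<theta> A"
        using Us kA by (subst plus_emeasure) (auto intro: arg_cong[where f = "emeasure \<theta>"])
      moreover have "emeasure \<theta> ((k <# A) - A) + emeasure \<theta> (A \<inter> (k <# A)) = emeasure \<theta> (k <# A)"
        using Us kA by (subst plus_emeasure) (auto intro: arg_cong[where f = "emeasure \<theta>"])
      ultimately show ?thesis using eqm by simp
    qed
    moreover have "emeasure \<theta> (A \<inter> (k <# A)) \<noteq> \<infinity>"
      using fA emeasure_mono[of "A \<inter> (k <# A)" A \<theta>] Us by (auto simp: top_unique)
    ultimately have 2: "emeasure \<theta> (A - (k <# A)) = emeasure \<theta> ((k <# A) - A)"
      by (metis add.commute ennreal_add_left_cancel infinity_ennreal_def)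
    show "measure \<theta> ((k <# A) - A) \<le> d \<and> measure \<theta> (A - (k <# A)) \<le> d"
      using 1 d unfolding measure_def 2 by (simp add: enn2real_leI)
  qed
qed

text \<open>A Hahn decomposition on each compact piece separates the part on which the law dominates
  \<open>1 / (m + 1)\<close> times Haar measure. If all these parts were Haar null, the law would live on a Haar null
  set. Outer regularity then shrinks a part of positive measure to a compact set.\<close>

lemma nonsingular_minorization:
  assumes \<theta>: "haar_measure G T \<theta>" and ns: "\<not> mutually_singular (law N) \<theta>" and H: "Hausdorff_space T"
    and \<C>: "countable \<C>" "\<And>C. C \<in> \<C> \<Longrightarrow> compactin T C" "carrier G \<subseteq> \<Union>\<C>"
  obtains A c where "compactin T A" "0 < c" "0 < emeasure \<theta> A"
    "\<And>E. E \<in> sets BT \<Longrightarrow> ennreal c * emeasure \<theta> (A \<inter> E) \<le> emeasure (law N) E"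
proof -
  have s: "sets \<theta> = sets BT" by (rule haar_sets[OF \<theta>])
  have sp: "space \<theta> = carrier G" using sets_eq_imp_space_eq[OF s] by simp
  interpret L: prob_space "law N" by (rule prob_space_law)
  have Cs: "C \<in> sets \<theta>" "emeasure \<theta> C < \<infinity>" if "C \<in> \<C>" for C
    using closedin_borel_of[OF compactin_imp_closedin[OF H]] \<C>(2)[OF that] haar_compact[OF \<theta>] s by auto
  \<comment> \<open>\<open>R C m Y\<close> says that \<open>Y\<close> is the part of \<open>C\<close> on which the law dominates the scaled Haar measure \<open>sc m\<close>\<close>
  define sc where "sc m = scale_measure (ennreal (1 / real (Suc m))) \<theta>" for m
  define R where "R C m Y \<longleftrightarrow> Y \<in> sets \<theta> \<and> Y \<subseteq> C \<and> (\<forall>X\<in>sets \<theta>. X \<subseteq> Y \<longrightarrow> emeasure (sc m) X \<le> emeasure (law N) X) \<and>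
      (\<forall>X\<in>sets \<theta>. X \<subseteq> C \<longrightarrow> X \<inter> Y = {} \<longrightarrow> emeasure (law N) X \<le> emeasure (sc m) X)" for C m Y
  have "\<exists>Y. R C m Y" if C: "C \<in> \<C>" for C m
  proof -
    have "emeasure (sc m) C \<noteq> \<infinity>"
      using Cs[OF C] by (auto simp: sc_def ennreal_mult_eq_top_iff)
    moreover have "sets (sc m) = sets \<theta>" by (simp add: sc_def)
    ultimately show ?thesis
      using unsigned_Hahn_decomposition[of "sc m" "law N" C] Cs[OF C] s unfolding R_def
      by (simp add: Bex_def)
  qed
  then obtain Y where "\<And>C m. C \<in> \<C> \<Longrightarrow> R C m (Y C m)" by metis
  then have Y: "\<And>C m. C \<in> \<C> \<Longrightarrow> Y C m \<in> sets \<theta>" "\<And>C m. C \<in> \<C> \<Longrightarrow> Y C m \<subseteq> C"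
    "\<And>C m X. C \<in> \<C> \<Longrightarrow> X \<in> sets \<theta> \<Longrightarrow> X \<subseteq> Y C m \<Longrightarrow> emeasure (sc m) X \<le> emeasure (law N) X"
    "\<And>C m X. C \<in> \<C> \<Longrightarrow> X \<in> sets \<theta> \<Longrightarrow> X \<subseteq> C \<Longrightarrow> X \<inter> Y C m = {} \<Longrightarrow> emeasure (law N) X \<le> emeasure (sc m) X"
    unfolding R_def by blast+
  have "\<exists>C\<in>\<C>. \<exists>m. emeasure \<theta> (Y C m) \<noteq> 0"
  proof (rule ccontr)
    assume "\<not> ?thesis"
    then have nul: "Y C m \<in> null_sets \<theta>" if "C \<in> \<C>" for C m using that Y(1) by auto
    define Z where "Z = (\<Union>C\<in>\<C>. \<Union>m. Y C m)"
    have Z: "Z \<in> null_sets \<theta>"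
      unfolding Z_def using \<C>(1) nul by (intro null_sets_UN' null_sets_UN) auto
    have nulC: "C - Z \<in> null_sets (law N)" if C: "C \<in> \<C>" for C
    proof -
      have CZ: "C - Z \<in> sets \<theta>" using Cs[OF C] Z by auto
      have "emeasure (law N) (C - Z) \<le> ennreal e" if e: "0 < e" for e
      proof -
        define r where "r = enn2real (emeasure \<theta> C)"
        have r: "emeasure \<theta> C = ennreal r" "0 \<le> r" using Cs(2)[OF C] by (simp_all add: r_def less_top)
        obtain m where m: "r / e < real m" using reals_Archimedean2 by blast
        have "(C - Z) \<inter> Y C m = {}" using C unfolding Z_def by blast
        then have "emeasure (law N) (C - Z) \<le> emeasure (sc m) (C - Z)"
          using Y(4)[OF C CZ] by blast
        also have "\<dots> \<le> emeasure (sc m) C"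
          using Cs[OF C] by (intro emeasure_mono) (auto simp: sc_def)
        also have "\<dots> = ennreal (1 / real (Suc m) * r)" using r by (simp add: sc_def flip: ennreal_mult)
        also have "\<dots> \<le> ennreal e"
        proof (rule ennreal_leI)
          have "r < real m * e" using m e by (simp add: divide_less_eq)
          then have "r \<le> e * real (Suc m)" using e by (simp add: algebra_simps)
          then show "1 / real (Suc m) * r \<le> e" by (simp add: divide_le_eq)
        qed
        finally show ?thesis .
      qed
      then have "emeasure (law N) (C - Z) \<le> 0"
        by - (rule ennreal_le_epsilon, simp)
      then show ?thesis using CZ s by auto
    qed
    have "(\<Union>C\<in>\<C>. C - Z) \<in> null_sets (law N)"
      using \<C>(1) nulC by (intro null_sets_UN') auto
    moreover have cz: "carrier G - Z \<subseteq> (\<Union>C\<in>\<C>. C - Z)" using \<C>(3) by blast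
    moreover have czs: "carrier G - Z \<in> sets BT" using Z s sets.compl_sets[of Z \<theta>] sp by (auto simp: null_sets_def)
    ultimately have "emeasure (law N) (carrier G - Z) = 0"
      by (metis null_setsD1 null_sets_subset sets_law)
    moreover have "space \<theta> - (carrier G - Z) = Z"
      using sets.sets_into_space[of Z \<theta>] Z sp by (auto simp: null_sets_def)
    ultimately have "mutually_singular (law N) \<theta>"
      unfolding mutually_singular_def using czs Z s by (intro exI[of _ "carrier G - Z"]) (auto simp: null_sets_def)
    then show False using ns by simp
  qed
  then obtain C m where C: "C \<in> \<C>" and Ym: "emeasure \<theta> (Y C m) \<noteq> 0" by blast
  let ?Y = "Y C m"
  have Ys: "?Y \<in> sets \<theta>" "?Y \<subseteq> C" using Y(1,2)[OF C] by auto
  have sum: "emeasure \<theta> C = emeasure \<theta> ?Y + emeasure \<theta> (C - ?Y)"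
    using Ys Cs(1)[OF C] by (subst plus_emeasure) (auto intro: arg_cong[where f = "emeasure \<theta>"])
  have fin: "emeasure \<theta> (C - ?Y) < \<infinity>"
    using Cs[OF C] emeasure_mono[of "C - ?Y" C \<theta>] by (auto simp: less_top top_unique)
  have "emeasure \<theta> (C - ?Y) < emeasure \<theta> C"
    unfolding sum using Ym fin
    by (metis add.commute add.right_neutral ennreal_add_left_cancel_less infinity_ennreal_def less_top not_gr_zero order_less_irrefl)
  moreover have "emeasure \<theta> (C - ?Y) = (INF U\<in>{U. openin T U \<and> C - ?Y \<subseteq> U}. emeasure \<theta> U)"
    using Ys Cs(1)[OF C] s by (intro haar_outer[OF \<theta>]) auto
  ultimately obtain U where U: "openin T U" "C - ?Y \<subseteq> U" "emeasure \<theta> U < emeasure \<theta> C"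
    by (metis (mono_tags, lifting) INF_less_iff mem_Collect_eq)
  have Us: "U \<in> sets \<theta>" using U(1) s by (simp add: openin_borel_of)
  define A where "A = C - U"
  have As: "A \<in> sets \<theta>" "A \<subseteq> ?Y" using Us Cs(1)[OF C] U(2) by (auto simp: A_def)
  have A: "compactin T A"
    unfolding A_def
  proof (rule closed_compactin)
    show "closedin T (C - U)"
      using U(1) compactin_imp_closedin[OF H \<C>(2)[OF C]] by (rule closedin_diff[rotated])
  qed (use \<C>(2)[OF C] in auto)
  have "emeasure \<theta> A \<noteq> 0"
  proof
    assume 0: "emeasure \<theta> A = 0"
    have "emeasure \<theta> C \<le> emeasure \<theta> (A \<union> U)"
      using As Us Cs(1)[OF C] by (intro emeasure_mono) (auto simp: A_def)
    also have "\<dots> \<le> emeasure \<theta> A + emeasure \<theta> U" using As Us by (intro emeasure_subadditive) auto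
    finally show False using U(3) 0 by simp
  qed
  then have "0 < emeasure \<theta> A" by (simp add: zero_less_iff_neq_zero)
  then show ?thesis
  proof (rule that[OF A, of "1 / real (Suc m)", rotated])
    fix E assume E: "E \<in> sets BT"
    have "emeasure (sc m) (A \<inter> E) \<le> emeasure (law N) (A \<inter> E)"
      using As E s by (intro Y(3)[OF C]) auto
    also have "\<dots> \<le> emeasure (law N) E" using E by (intro emeasure_mono) auto
    finally show "ennreal (1 / real (Suc m)) * emeasure \<theta> (A \<inter> E) \<le> emeasure (law N) E"
      by (simp add: sc_def)
  qed simp
qed

lemma haar_translate_integral:
  assumes \<theta>: "haar_measure G T \<theta>" and A: "compactin T A" "A \<in> sets BT"
    and k: "k \<in> carrier G" and fm: "f \<in> borel_measurable BT" and fB: "\<And>x. \<bar>f x\<bar> \<le> (B::real)"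
  shows "\<bar>\<integral>x. indicator A x * (f (k \<otimes> x) - f x) \<partial>\<theta>\<bar>
    \<le> B * (measure \<theta> ((k <# A) - A) + measure \<theta> (A - (k <# A)))"
proof -
  have s [measurable_cong]: "sets \<theta> = sets BT" by (rule haar_sets[OF \<theta>])
  have sp: "space \<theta> = carrier G" using sets_eq_imp_space_eq[OF s] by simp
  note [measurable] = fm A(2) sets_lcoset[OF k A(2)]
  have Ac: "A \<subseteq> carrier G" using sets.sets_into_space[OF A(2)] by simp
  have fin: "emeasure \<theta> A < \<infinity>" "emeasure \<theta> (k <# A) < \<infinity>"
    using haar_compact[OF \<theta> A(1)] haar_lcoset[OF \<theta> k A(2)] by simp_all
  have int: "integrable \<theta> (\<lambda>x. indicator E x * h x)"
    if "E \<in> sets BT" "emeasure \<theta> E < \<infinity>" "h \<in> borel_measurable BT" "\<And>x. \<bar>h x\<bar> \<le> B" for E and h :: "'a \<Rightarrow> real"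
  proof (rule Bochner_Integration.integrable_bound[of \<theta> "\<lambda>x. B * indicator E x"])
    show "integrable \<theta> (\<lambda>x. B * indicator E x :: real)"
      using that s by (intro integrable_mult_right integrable_real_indicator) auto
    show "AE x in \<theta>. norm (indicator E x * h x) \<le> norm (B * indicator E x)"
      using that(4) by (auto simp: indicator_def intro: order_trans[OF _ abs_ge_self])
    show "(\<lambda>x. indicator E x * h x) \<in> borel_measurable \<theta>"
      using that s by (simp cong: measurable_cong_sets)
  qed
  have kc: "inv k \<otimes> (k \<otimes> x) = x" if "x \<in> carrier G" for x using that k by (simp add: lmult_cancel_inv)
  have mem: "k \<otimes> x \<in> k <# A \<longleftrightarrow> x \<in> A" if x: "x \<in> carrier G" for x
  proof -
    have "k \<otimes> x \<in> k <# A \<longleftrightarrow> (\<exists>y\<in>A. k \<otimes> x = k \<otimes> y)" unfolding l_coset_def by blast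
    also have "\<dots> \<longleftrightarrow> x \<in> A" using x k Ac by (metis kc subsetD)
    finally show ?thesis .
  qed
  have lm: "(\<lambda>x. k \<otimes> x) \<in> measurable \<theta> \<theta>"
    using measurable_lmult[OF k] s by (simp cong: measurable_cong_sets)
  have "(\<integral>x. indicator A x * f (k \<otimes> x) \<partial>\<theta>) = (\<integral>x. indicator (k <# A) (k \<otimes> x) * f (k \<otimes> x) \<partial>\<theta>)"
    by (rule Bochner_Integration.integral_cong) (auto simp: sp mem indicator_def)
  also have "\<dots> = (\<integral>x. indicator (k <# A) x * f x \<partial>distr \<theta> \<theta> (\<lambda>x. k \<otimes> x))"
    by (rule integral_distr[symmetric, OF lm]) (measurable)
  also have "\<dots> = (\<integral>x. indicator (k <# A) x * f x \<partial>\<theta>)"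
    unfolding haar_measure_distr[OF \<theta> k] ..
  finally have tr: "(\<integral>x. indicator A x * f (k \<otimes> x) \<partial>\<theta>) = (\<integral>x. indicator (k <# A) x * f x \<partial>\<theta>)" .
  have fk: "(\<lambda>x. f (k \<otimes> x)) \<in> borel_measurable BT"
    using measurable_compose[OF measurable_lmult[OF k] fm] .
  have "(\<integral>x. indicator A x * (f (k \<otimes> x) - f x) \<partial>\<theta>)
    = (\<integral>x. indicator (k <# A) x * f x \<partial>\<theta>) - (\<integral>x. indicator A x * f x \<partial>\<theta>)"
    using int[OF A(2) fin(1) fk fB] int[OF A(2) fin(1) fm fB] by (simp add: right_diff_distrib tr)
  also have "\<dots> = (\<integral>x. indicator (k <# A) x * f x - indicator A x * f x \<partial>\<theta>)"
    using int[OF A(2) fin(1) fm fB] int[OF sets_lcoset[OF k A(2)] fin(2) fm fB] by simp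
  finally have "\<bar>\<integral>x. indicator A x * (f (k \<otimes> x) - f x) \<partial>\<theta>\<bar>
    \<le> (\<integral>x. \<bar>indicator (k <# A) x * f x - indicator A x * f x\<bar> \<partial>\<theta>)"
    using integral_abs_bound by simp
  also have "\<dots> \<le> (\<integral>x. B * indicator ((k <# A) - A) x + B * indicator (A - (k <# A)) x \<partial>\<theta>)"
  proof (rule integral_mono)
    have f1: "emeasure \<theta> ((k <# A) - A) < \<infinity>" "emeasure \<theta> (A - (k <# A)) < \<infinity>"
      using fin emeasure_mono[of "(k <# A) - A" "k <# A" \<theta>] emeasure_mono[of "A - (k <# A)" A \<theta>]
      by (auto simp: less_top top_unique)
    show "integrable \<theta> (\<lambda>x. B * indicator ((k <# A) - A) x + B * indicator (A - (k <# A)) x)"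
      using f1 by (intro Bochner_Integration.integrable_add integrable_mult_right integrable_real_indicator) auto
    show "integrable \<theta> (\<lambda>x. \<bar>indicator (k <# A) x * f x - indicator A x * f x\<bar>)"
      using int[OF A(2) fin(1) fm fB] int[OF sets_lcoset[OF k A(2)] fin(2) fm fB] by simp
    show "\<bar>indicator (k <# A) x * f x - indicator A x * f x\<bar>
      \<le> B * indicator ((k <# A) - A) x + B * indicator (A - (k <# A)) x" for x
      using fB[of x] by (auto simp: indicator_def)
  qed
  also have "\<dots> = B * (measure \<theta> ((k <# A) - A) + measure \<theta> (A - (k <# A)))"
  proof -
    have f1: "emeasure \<theta> ((k <# A) - A) < \<infinity>" "emeasure \<theta> (A - (k <# A)) < \<infinity>"
      using fin emeasure_mono[of "(k <# A) - A" "k <# A" \<theta>] emeasure_mono[of "A - (k <# A)" A \<theta>]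
      by (auto simp: less_top top_unique)
    have "E \<inter> space \<theta> = E" if "E \<in> sets \<theta>" for E using sets.sets_into_space[OF that] by blast
    then show ?thesis using f1 by (subst Bochner_Integration.integral_add) (auto simp: distrib_left)
  qed
  finally show ?thesis .
qed

lemma decreasing_nbhds:
  obtains Ob :: "nat \<Rightarrow> 'a set" where "\<And>n. openin T (Ob n)" "\<And>n. \<one> \<in> Ob n"
    "\<And>U. openin T U \<Longrightarrow> \<one> \<in> U \<Longrightarrow> \<exists>n. \<forall>m\<ge>n. Ob m \<subseteq> U"
proof -
  obtain \<B> where \<B>: "countable \<B>" "\<And>V. V \<in> \<B> \<Longrightarrow> openin T V"
    "\<And>U x. openin T U \<Longrightarrow> x \<in> U \<Longrightarrow> \<exists>V\<in>\<B>. x \<in> V \<and> V \<subseteq> U"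
    using second_countable unfolding second_countable_def by metis
  define \<B>1 where "\<B>1 = {V\<in>\<B>. \<one> \<in> V}"
  have c1: "countable \<B>1" using \<B>(1) by (simp add: \<B>1_def)
  have "\<one> \<in> topspace T" by (simp add: topspace_eq)
  then have ne: "\<B>1 \<noteq> {}" using \<B>(3)[OF openin_topspace] unfolding \<B>1_def by blast
  define e where "e = from_nat_into \<B>1"
  have e: "e n \<in> \<B>1" for n unfolding e_def by (rule from_nat_into[OF ne])
  define Ob where "Ob n = (\<Inter>i\<le>n. e i)" for n :: nat
  show ?thesis
  proof (rule that)
    show "openin T (Ob n)" for n
      unfolding Ob_def using e \<B>(2) by (intro openin_INT2) (auto simp: \<B>1_def)
    show "\<one> \<in> Ob n" for n using e by (auto simp: Ob_def \<B>1_def)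
    fix U assume U: "openin T U" "\<one> \<in> U"
    then obtain V where V: "V \<in> \<B>1" "V \<subseteq> U" using \<B>(3)[OF U] by (auto simp: \<B>1_def)
    then obtain n where n: "e n = V" unfolding e_def using from_nat_into_surj[OF c1] by blast
    have "Ob m \<subseteq> U" if "n \<le> m" for m using that n V by (auto simp: Ob_def)
    then show "\<exists>n. \<forall>m\<ge>n. Ob m \<subseteq> U" by blast
  qed
qed

lemma conjugates_tend_to_one:
  assumes x: "x \<in> carrier G" and U: "openin T U" "\<one> \<in> U"
  obtains W where "openin T W" "\<one> \<in> W" "\<And>k. k \<in> W \<Longrightarrow> inv x \<otimes> (k \<otimes> x) \<in> U"
proof -
  have c: "continuous_map T T (\<lambda>k. inv x \<otimes> (k \<otimes> x))"
    using continuous_map_compose[OF continuous_rmult[OF x] continuous_lmult[of "inv x"]] x by (simp add: o_def)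
  let ?W = "{k \<in> topspace T. inv x \<otimes> (k \<otimes> x) \<in> U}"
  have "openin T ?W" by (rule openin_continuous_map_preimage[OF c U(1)])
  moreover have "\<one> \<in> ?W" using x U by (simp add: topspace_eq)
  ultimately show ?thesis using that by blast
qed

end

context random_walk_in_subgroup
begin

lemma minorization_integral_le:
  assumes \<theta>: "haar_measure G T \<theta>" and A: "A \<in> sets BT" "emeasure \<theta> A < \<infinity>" and c: "0 < c"
    and dom: "\<And>E. E \<in> sets BT \<Longrightarrow> ennreal c * emeasure \<theta> (A \<inter> E) \<le> emeasure (law N) E"
    and h: "h \<in> borel_measurable BT" "\<And>x. 0 \<le> h x" "\<And>x. h x \<le> (b::real)"
  shows "c * (\<integral>x. indicator A x * h x \<partial>\<theta>) \<le> (\<integral>x. h x \<partial>law N)"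
proof -
  have s [measurable_cong]: "sets \<theta> = sets BT" by (rule haar_sets[OF \<theta>])
  interpret L: prob_space "law N" by (rule prob_space_law)
  note [measurable] = h(1) A(1)
  let ?D = "density \<theta> (\<lambda>x. ennreal c * indicator A x)"
  have D: "emeasure ?D E = ennreal c * emeasure \<theta> (A \<inter> E)" if E: "E \<in> sets BT" for E
  proof -
    have "emeasure ?D E = (\<integral>\<^sup>+x. ennreal c * indicator A x * indicator E x \<partial>\<theta>)"
      using E s by (subst emeasure_density) auto
    also have "\<dots> = (\<integral>\<^sup>+x. ennreal c * indicator (A \<inter> E) x \<partial>\<theta>)"
      by (intro nn_integral_cong) (auto simp: indicator_def)
    also have "\<dots> = ennreal c * emeasure \<theta> (A \<inter> E)"
      using E s by (subst nn_integral_cmult_indicator) auto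
    finally show ?thesis .
  qed
  have le: "?D \<le> law N"
    using dom D s by (subst le_measure) (auto simp del: mconv_pow.simps)
  have il: "integrable (law N) h"
    using h by (intro L.integrable_const_bound[where B = b]) (auto simp: abs_of_nonneg)
  have ia: "integrable \<theta> (\<lambda>x. indicator A x * h x)"
  proof (rule Bochner_Integration.integrable_bound[of \<theta> "\<lambda>x. b * indicator A x"])
    show "integrable \<theta> (\<lambda>x. b * indicator A x :: real)"
      using A s by (intro integrable_mult_right integrable_real_indicator) auto
    show "AE x in \<theta>. norm (indicator A x * h x) \<le> norm (b * indicator A x)"
      using h(2,3) by (auto simp: indicator_def abs_of_nonneg intro: order_trans[OF _ abs_ge_self])
  qed measurable
  have "ennreal (c * (\<integral>x. indicator A x * h x \<partial>\<theta>)) = ennreal c * (\<integral>\<^sup>+x. ennreal (indicator A x * h x) \<partial>\<theta>)"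
    using ia h(2) c by (subst nn_integral_eq_integral) (auto simp: ennreal_mult' indicator_def)
  also have "\<dots> = (\<integral>\<^sup>+x. ennreal c * indicator A x * ennreal (h x) \<partial>\<theta>)"
    by (subst nn_integral_cmult[symmetric]) (auto intro!: nn_integral_cong simp: indicator_def)
  also have "\<dots> = (\<integral>\<^sup>+x. ennreal (h x) \<partial>?D)"
    by (subst nn_integral_density) auto
  also have "\<dots> \<le> (\<integral>\<^sup>+x. ennreal (h x) \<partial>law N)"
    by (rule nn_integral_mono_measure[OF _ le]) (simp add: s)
  also have "\<dots> = ennreal (\<integral>x. h x \<partial>law N)"
    using il h(2) by (intro nn_integral_eq_integral) auto
  finally show ?thesis
    using h(2) by (subst (asm) ennreal_le_iff) (auto intro!: integral_nonneg_AE)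
qed

text \<open>Let \<open>a\<close> be an asymptotic bound, for \<open>k\<close> tending to the identity, of the oscillations \<open>f (g k) - f g\<close>.
  By harmonicity such an oscillation is the average over \<open>x\<close>, with respect to a law of the walk, of
  \<open>\<psi> x = f (g k x) - f (g x)\<close>. Since \<open>g k x = (g x) (inv x k x)\<close> and \<open>inv x k x\<close> also tends to the identity, \<open>\<psi>\<close> is
  asymptotically bounded by \<open>a\<close> as well. Some law of the walk dominates a multiple of Haar measure on a
  compact set \<open>A\<close>, and there the average of \<open>\<psi>\<close> nearly cancels, because \<open>k A\<close> nearly equals \<open>A\<close>. So a
  fixed fraction \<open>\<kappa>\<close> of the mass contributes nothing, and \<open>(1 - \<kappa>) a\<close> is an asymptotic bound too. Hence the
  infimum of such bounds is \<open>0\<close>.\<close>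

theorem harmonic_right_uniformly_continuous:
  assumes spread: "spread_out G T \<mu>" and H: "Hausdorff_space T"
    and \<C>: "countable \<C>" "\<And>C. C \<in> \<C> \<Longrightarrow> compactin T C" "carrier G \<subseteq> \<Union>\<C>"
    and f: "harmonic_on_\<Gamma> B f" and eps: "0 < \<epsilon>"
  shows "\<exists>U. openin T U \<and> \<one> \<in> U \<and> (\<forall>g\<in>\<Gamma>. \<forall>k\<in>U \<inter> \<Gamma>. \<bar>f (g \<otimes> k) - f g\<bar> \<le> \<epsilon>)"
proof (rule ccontr)
  assume neg: "\<not> ?thesis"
  have fm [measurable]: "f \<in> borel_measurable BT" and fB: "\<And>g. \<bar>f g\<bar> \<le> B"
    using f by (simp_all add: harmonic_on_\<Gamma>_def)
  have B: "0 \<le> B" using fB[of \<one>] by linarith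
  define P where "P a \<longleftrightarrow> (\<exists>U. openin T U \<and> \<one> \<in> U \<and> (\<forall>g\<in>\<Gamma>. \<forall>k\<in>U \<inter> \<Gamma>. \<bar>f (g \<otimes> k) - f g\<bar> \<le> a))" for a
  have P_mono: "P a'" if "P a" "a \<le> a'" for a a'
    using that unfolding P_def by (meson order_trans)
  have P2B: "P (2 * B)"
    unfolding P_def
  proof (intro exI[of _ "topspace T"] conjI ballI)
    fix g k show "\<bar>f (g \<otimes> k) - f g\<bar> \<le> 2 * B" using fB[of "g \<otimes> k"] fB[of g] by linarith
    show "openin T (topspace T)" by (rule openin_topspace)
    show "\<one> \<in> topspace T" by (simp add: topspace_eq)
  qed
  have nP: "\<not> P \<epsilon>" using neg by (simp add: P_def)
  obtain \<theta> N where \<theta>: "haar_measure G T \<theta>" and ns: "\<not> mutually_singular (law N) \<theta>"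
    using spread unfolding spread_out_def by blast
  obtain A c where A: "compactin T A" and c: "0 < c" and A0: "0 < emeasure \<theta> A"
    and dom: "\<And>E. E \<in> sets BT \<Longrightarrow> ennreal c * emeasure \<theta> (A \<inter> E) \<le> emeasure (law N) E"
    using nonsingular_minorization[OF \<theta> ns H \<C>] by metis
  have s [measurable_cong]: "sets \<theta> = sets BT" by (rule haar_sets[OF \<theta>])
  have As [measurable]: "A \<in> sets BT" using closedin_borel_of[OF compactin_imp_closedin[OF H A]] .
  have Ac: "A \<subseteq> carrier G" using sets.sets_into_space[OF As] by simp
  have Af: "emeasure \<theta> A < \<infinity>" by (rule haar_compact[OF \<theta> A])
  interpret L: prob_space "law N" by (rule prob_space_law)
  define \<kappa> where "\<kappa> = c * measure \<theta> A"
  have tA: "emeasure \<theta> A = ennreal (measure \<theta> A)" using Af by (intro emeasure_eq_ennreal_measure) auto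
  have \<kappa>0: "0 < \<kappa>" using A0 c unfolding \<kappa>_def tA by simp
  have \<kappa>1: "\<kappa> \<le> 1"
  proof -
    have "ennreal \<kappa> = ennreal c * emeasure \<theta> (A \<inter> carrier G)"
      using c Ac by (simp add: \<kappa>_def tA Int_absorb2 ennreal_mult)
    also have "\<dots> \<le> 1" using dom[of "carrier G"] sets.top[of BT] by simp
    finally show ?thesis by (simp add: ennreal_le_1)
  qed
  \<comment> \<open>with \<open>a0\<close> the infimum of the admissible oscillations, \<open>a\<close> lies slightly above and \<open>b\<close> slightly below
    \<open>a0\<close>, so close that contraction by \<open>1 - \<kappa>\<close> takes \<open>a\<close> below \<open>b\<close>\<close>
  obtain a b where ab: "P a" "\<not> P b" "a * (1 - \<kappa>) < b" "0 \<le> a"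
  proof -
    define a0 where "a0 = Inf {a. P a}"
    have low: "\<epsilon> \<le> a" if "P a" for a using P_mono[OF that, of \<epsilon>] nP by linarith
    have bdd: "bdd_below {a. P a}" using low by (intro bdd_belowI[of _ \<epsilon>]) auto
    have a0: "\<epsilon> \<le> a0" unfolding a0_def using P2B low by (intro cInf_greatest) auto
    have "a0 < a0 * (1 + \<kappa> / 2)" using a0 eps \<kappa>0 by (simp add: algebra_simps)
    then obtain a where a: "P a" "a < a0 * (1 + \<kappa> / 2)"
      unfolding a0_def using cInf_lessD[of "{a. P a}"] P2B by blast
    have nb: "\<not> P (a0 * (1 - \<kappa> / 2))"
    proof
      assume "P (a0 * (1 - \<kappa> / 2))"
      then have "a0 \<le> a0 * (1 - \<kappa> / 2)" unfolding a0_def using bdd by (intro cInf_lower) auto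
      then have "a0 * \<kappa> \<le> 0" by (simp add: algebra_simps)
      then show False using mult_pos_pos[of a0 \<kappa>] a0 eps \<kappa>0 by linarith
    qed
    have "a * (1 - \<kappa>) \<le> a0 * (1 + \<kappa> / 2) * (1 - \<kappa>)" using a(2) \<kappa>1 by (intro mult_right_mono) auto
    also have "\<dots> = a0 * ((1 + \<kappa> / 2) * (1 - \<kappa>))" by simp
    also have "\<dots> < a0 * (1 - \<kappa> / 2)"
      using a0 eps \<kappa>0 by (intro mult_strict_left_mono) (simp_all add: algebra_simps)
    finally show ?thesis using that[OF a(1) nb] low[OF a(1)] eps by simp
  qed
  obtain Ua where Ua: "openin T Ua" "\<one> \<in> Ua" "\<And>g k. g \<in> \<Gamma> \<Longrightarrow> k \<in> Ua \<Longrightarrow> k \<in> \<Gamma> \<Longrightarrow> \<bar>f (g \<otimes> k) - f g\<bar> \<le> a"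
    using ab(1) unfolding P_def by blast
  obtain Ob :: "nat \<Rightarrow> 'a set" where Ob: "\<And>n. openin T (Ob n)" "\<And>n. \<one> \<in> Ob n"
    "\<And>U. openin T U \<Longrightarrow> \<one> \<in> U \<Longrightarrow> \<exists>n. \<forall>m\<ge>n. Ob m \<subseteq> U"
    using decreasing_nbhds by metis
  have "\<exists>g k. g \<in> \<Gamma> \<and> k \<in> \<Gamma> \<and> k \<in> Ob n \<and> b < \<bar>f (g \<otimes> k) - f g\<bar> \<and>
      measure \<theta> ((k <# A) - A) \<le> 1 / real (Suc n) \<and> measure \<theta> (A - (k <# A)) \<le> 1 / real (Suc n)" for n
  proof -
    obtain W where W: "openin T W" "\<one> \<in> W"
      "\<And>k. k \<in> W \<Longrightarrow> measure \<theta> ((k <# A) - A) \<le> 1 / real (Suc n) \<and> measure \<theta> (A - (k <# A)) \<le> 1 / real (Suc n)"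
      by (rule haar_translate_diff[OF \<theta> A As, of "1 / real (Suc n)"]) auto
    have "openin T (Ob n \<inter> W)" "\<one> \<in> Ob n \<inter> W" using W Ob by auto
    then have "\<exists>g\<in>\<Gamma>. \<exists>k\<in>(Ob n \<inter> W) \<inter> \<Gamma>. \<not> \<bar>f (g \<otimes> k) - f g\<bar> \<le> b"
      using ab(2) unfolding P_def by blast
    then show ?thesis using W(3) by (force simp: not_le)
  qed
  then obtain g k where gk: "\<And>n. g n \<in> \<Gamma>" "\<And>n. k n \<in> \<Gamma>" "\<And>n. k n \<in> Ob n" "\<And>n. b < \<bar>f (g n \<otimes> k n) - f (g n)\<bar>"
      "\<And>n. measure \<theta> ((k n <# A) - A) \<le> 1 / real (Suc n)" "\<And>n. measure \<theta> (A - (k n <# A)) \<le> 1 / real (Suc n)"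
    by metis
  have gc: "g n \<in> carrier G" "k n \<in> carrier G" for n using gk \<Gamma>_carrier by auto
  define \<psi> where "\<psi> n x = f (g n \<otimes> (k n \<otimes> x)) - f (g n \<otimes> x)" for n x
  \<comment> \<open>\<open>\<psi>'\<close> truncates \<open>\<psi>\<close> at the asymptotic bound \<open>a\<close>; the truncation error \<open>e\<close> vanishes in the limit\<close>
  define \<psi>' where "\<psi>' n x = max (- a) (min a (\<psi> n x))" for n x
  have mg: "(\<lambda>x. f (g n \<otimes> x)) \<in> borel_measurable BT" for n
    using measurable_compose[OF measurable_lmult[OF gc(1)] fm] .
  have m\<psi> [measurable]: "\<psi> n \<in> borel_measurable BT" for n
    unfolding \<psi>_def[abs_def] using mg measurable_compose[OF measurable_lmult[OF gc(2)] mg]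
    by (intro borel_measurable_diff) auto
  have m\<psi>' [measurable]: "\<psi>' n \<in> borel_measurable BT" for n
    unfolding \<psi>'_def[abs_def] by (intro borel_measurable_max borel_measurable_min borel_measurable_const m\<psi>)
  have b\<psi>: "\<bar>\<psi> n x\<bar> \<le> 2 * B" for n x
    unfolding \<psi>_def using fB[of "g n \<otimes> (k n \<otimes> x)"] fB[of "g n \<otimes> x"] by linarith
  have b\<psi>': "\<bar>\<psi>' n x\<bar> \<le> a" for n x unfolding \<psi>'_def using ab(4) by auto
  have bd: "\<bar>\<psi> n x - \<psi>' n x\<bar> \<le> 2 * B + a" for n x using b\<psi>[of n x] b\<psi>'[of n x] by linarith
  define e where "e n = (\<integral>x. \<bar>\<psi> n x - \<psi>' n x\<bar> \<partial>law N)" for n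
  have "(\<lambda>n. e n) \<longlonglongrightarrow> (\<integral>x. 0 \<partial>law N)"
    unfolding e_def
  proof (rule integral_dominated_convergence[where w = "\<lambda>_. 2 * B + a"])
    show "AE x in law N. (\<lambda>n. \<bar>\<psi> n x - \<psi>' n x\<bar>) \<longlonglongrightarrow> 0"
      using AE_law_\<Gamma>[of N]
    proof eventually_elim
      fix x assume x: "x \<in> \<Gamma>"
      have xc: "x \<in> carrier G" using x by (rule \<Gamma>_carrier)
      obtain W where W: "openin T W" "\<one> \<in> W" "\<And>k. k \<in> W \<Longrightarrow> inv x \<otimes> (k \<otimes> x) \<in> Ua"
        using conjugates_tend_to_one[OF xc Ua(1,2)] by metis
      obtain n0 where n0: "\<And>m. m \<ge> n0 \<Longrightarrow> Ob m \<subseteq> W" using Ob(3)[OF W(1,2)] by blast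
      have "\<bar>\<psi> n x - \<psi>' n x\<bar> = 0" if n: "n \<ge> n0" for n
      proof -
        have "inv x \<otimes> (k n \<otimes> x) \<in> Ua" using W(3) n0[OF n] gk(3)[of n] by blast
        moreover have "inv x \<otimes> (k n \<otimes> x) \<in> \<Gamma>" "g n \<otimes> x \<in> \<Gamma>"
          using x gk(1,2) subgroup.m_closed[OF subgroup_\<Gamma>] subgroup.m_inv_closed[OF subgroup_\<Gamma>] by auto
        ultimately have "\<bar>f ((g n \<otimes> x) \<otimes> (inv x \<otimes> (k n \<otimes> x))) - f (g n \<otimes> x)\<bar> \<le> a"
          by (intro Ua(3))
        moreover have "(g n \<otimes> x) \<otimes> (inv x \<otimes> (k n \<otimes> x)) = g n \<otimes> (k n \<otimes> x)"
          using xc gc by (simp add: m_assoc lmult_cancel_inv)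
        ultimately have "\<bar>\<psi> n x\<bar> \<le> a" by (simp add: \<psi>_def)
        then show ?thesis by (auto simp: \<psi>'_def)
      qed
      then show "(\<lambda>n. \<bar>\<psi> n x - \<psi>' n x\<bar>) \<longlonglongrightarrow> 0"
        by (intro tendsto_eventually) (auto simp: eventually_sequentially)
    qed
  qed (use bd in auto)
  then have e0: "e \<longlonglongrightarrow> 0" by simp
  have main: "b \<le> 2 * e n + a * (1 - \<kappa>) + c * B * (2 / real (Suc n))" for n
  proof -
    have il: "integrable (law N) h" if "h \<in> borel_measurable BT" "\<And>x. \<bar>h x\<bar> \<le> C" for h :: "'a \<Rightarrow> real" and C
      using that by (intro L.integrable_const_bound[where B = C]) auto
    have it: "integrable \<theta> (\<lambda>x. indicator A x * h x)" if "h \<in> borel_measurable BT" "\<And>x. \<bar>h x\<bar> \<le> C" for h :: "'a \<Rightarrow> real" and C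
    proof (rule Bochner_Integration.integrable_bound[of \<theta> "\<lambda>x. C * indicator A x"])
      show "integrable \<theta> (\<lambda>x. C * indicator A x :: real)"
        using As Af s by (intro integrable_mult_right integrable_real_indicator) auto
      show "AE x in \<theta>. norm (indicator A x * h x) \<le> norm (C * indicator A x)"
        using that(2) by (auto simp: indicator_def intro: order_trans[OF _ abs_ge_self])
      show "(\<lambda>x. indicator A x * h x) \<in> borel_measurable \<theta>"
        using that As s by (simp cong: measurable_cong_sets)
    qed
    have "f (g n \<otimes> k n) - f (g n) = (\<integral>x. \<psi> n x \<partial>law N)"
    proof -
      have "f (g n \<otimes> k n) = (\<integral>x. f (g n \<otimes> k n \<otimes> x) \<partial>law N)"
        using gk(1,2) by (intro harmonic_law[OF f] subgroup.m_closed[OF subgroup_\<Gamma>])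
      also have "\<dots> = (\<integral>x. f (g n \<otimes> (k n \<otimes> x)) \<partial>law N)"
        by (intro Bochner_Integration.integral_cong) (auto simp: m_assoc gc)
      finally show ?thesis
        using harmonic_law[OF f gk(1)[of n], of N] il[OF mg fB] il[OF measurable_compose[OF measurable_lmult[OF gc(2)] mg] fB]
        by (simp add: \<psi>_def)
    qed
    also have "\<dots> = (\<integral>x. \<psi> n x - \<psi>' n x \<partial>law N) + (\<integral>x. \<psi>' n x \<partial>law N)"
      using il[OF m\<psi> b\<psi>] il[OF m\<psi>' b\<psi>'] by simp
    finally have 1: "b < \<bar>(\<integral>x. \<psi> n x - \<psi>' n x \<partial>law N) + (\<integral>x. \<psi>' n x \<partial>law N)\<bar>" using gk(4)[of n] by simp
    have 2: "\<bar>\<integral>x. \<psi> n x - \<psi>' n x \<partial>law N\<bar> \<le> e n" unfolding e_def by (rule integral_abs_bound)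
    define J where "J = (\<integral>x. indicator A x * \<psi>' n x \<partial>\<theta>)"
    have tA': "(\<integral>x. indicator A x * a \<partial>\<theta>) = measure \<theta> A * a"
      using As s sets.sets_into_space[of A \<theta>] by (simp add: Int_absorb2)
    have 3: "c * (\<integral>x. indicator A x * (a - \<psi>' n x) \<partial>\<theta>) \<le> (\<integral>x. a - \<psi>' n x \<partial>law N)"
    proof (rule minorization_integral_le[OF \<theta> As Af c dom, where b = "2 * a"])
      fix x show "0 \<le> a - \<psi>' n x" "a - \<psi>' n x \<le> 2 * a" using b\<psi>'[of n x] by linarith+
    qed (auto intro!: borel_measurable_diff m\<psi>')
    have 4: "c * (\<integral>x. indicator A x * (a + \<psi>' n x) \<partial>\<theta>) \<le> (\<integral>x. a + \<psi>' n x \<partial>law N)"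
    proof (rule minorization_integral_le[OF \<theta> As Af c dom, where b = "2 * a"])
      fix x show "0 \<le> a + \<psi>' n x" "a + \<psi>' n x \<le> 2 * a" using b\<psi>'[of n x] by linarith+
    qed (auto intro!: borel_measurable_add m\<psi>')
    have ita: "integrable \<theta> (\<lambda>x. indicator A x * a)" using it[of "\<lambda>_. a" a] ab(4) by simp
    have h3: "c * (measure \<theta> A * a - J) \<le> a - (\<integral>x. \<psi>' n x \<partial>law N)"
      using 3 it[OF m\<psi>' b\<psi>'] il[OF m\<psi>' b\<psi>'] ita tA' by (simp add: right_diff_distrib J_def L.prob_space del: space_law)
    have h4: "c * (measure \<theta> A * a + J) \<le> a + (\<integral>x. \<psi>' n x \<partial>law N)"
      using 4 it[OF m\<psi>' b\<psi>'] il[OF m\<psi>' b\<psi>'] ita tA' by (simp add: distrib_left J_def L.prob_space del: space_law)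
    have 5: "c * \<bar>J\<bar> \<le> e n + c * B * (2 / real (Suc n))"
    proof -
      have "J = (\<integral>x. indicator A x * \<psi> n x \<partial>\<theta>) - (\<integral>x. indicator A x * (\<psi> n x - \<psi>' n x) \<partial>\<theta>)"
        using it[OF m\<psi>' b\<psi>'] it[OF m\<psi> b\<psi>] by (simp add: right_diff_distrib J_def)
      moreover have "\<bar>\<integral>x. indicator A x * (\<psi> n x - \<psi>' n x) \<partial>\<theta>\<bar> \<le> (\<integral>x. indicator A x * \<bar>\<psi> n x - \<psi>' n x\<bar> \<partial>\<theta>)"
        using integral_abs_bound[of \<theta> "\<lambda>x. indicator A x * (\<psi> n x - \<psi>' n x)"] by (simp add: abs_mult)
      moreover have "c * (\<integral>x. indicator A x * \<bar>\<psi> n x - \<psi>' n x\<bar> \<partial>\<theta>) \<le> e n"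
        unfolding e_def using bd by (intro minorization_integral_le[OF \<theta> As Af c dom, where b = "2 * B + a"]) auto
      moreover have "\<bar>\<integral>x. indicator A x * \<psi> n x \<partial>\<theta>\<bar> \<le> B * (2 / real (Suc n))"
      proof -
        have "\<bar>\<integral>x. indicator A x * \<psi> n x \<partial>\<theta>\<bar> \<le> B * (measure \<theta> ((k n <# A) - A) + measure \<theta> (A - (k n <# A)))"
          unfolding \<psi>_def by (rule haar_translate_integral[OF \<theta> A As gc(2) mg fB])
        also have "\<dots> \<le> B * (1 / real (Suc n) + 1 / real (Suc n))"
          using gk(5,6)[of n] B by (intro mult_left_mono add_mono) auto
        finally show ?thesis by simp
      qed
      ultimately have "\<bar>J\<bar> \<le> B * (2 / real (Suc n)) + (\<integral>x. indicator A x * \<bar>\<psi> n x - \<psi>' n x\<bar> \<partial>\<theta>)" by linarith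
      then have "c * \<bar>J\<bar> \<le> c * (B * (2 / real (Suc n)) + (\<integral>x. indicator A x * \<bar>\<psi> n x - \<psi>' n x\<bar> \<partial>\<theta>))"
        using c by (intro mult_left_mono) auto
      then show ?thesis
        using \<open>c * (\<integral>x. indicator A x * \<bar>\<psi> n x - \<psi>' n x\<bar> \<partial>\<theta>) \<le> e n\<close> by (simp only: distrib_left mult.assoc)
    qed
    have "\<kappa> * a - c * \<bar>J\<bar> \<le> a - (\<integral>x. \<psi>' n x \<partial>law N)" "\<kappa> * a - c * \<bar>J\<bar> \<le> a + (\<integral>x. \<psi>' n x \<partial>law N)"
    proof -
      have "c * J \<le> c * \<bar>J\<bar>" "- (c * \<bar>J\<bar>) \<le> c * J"
        using mult_left_mono[of J "\<bar>J\<bar>" c] mult_left_mono[of "- \<bar>J\<bar>" J c] c by auto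
      then show "\<kappa> * a - c * \<bar>J\<bar> \<le> a - (\<integral>x. \<psi>' n x \<partial>law N)" "\<kappa> * a - c * \<bar>J\<bar> \<le> a + (\<integral>x. \<psi>' n x \<partial>law N)"
        using h3 h4 unfolding \<kappa>_def distrib_left right_diff_distrib mult.assoc by linarith+
    qed
    moreover have "a * (1 - \<kappa>) = a - \<kappa> * a" by (simp add: algebra_simps)
    ultimately show ?thesis using 1 2 5 by linarith
  qed
  have "(\<lambda>n. 2 * e n + a * (1 - \<kappa>) + c * B * (2 / real (Suc n))) \<longlonglongrightarrow> 2 * 0 + a * (1 - \<kappa>) + c * B * 0"
    using LIMSEQ_Suc[OF lim_const_over_n[of "2::real"]]
    by (intro tendsto_add tendsto_mult tendsto_const e0)
  from LIMSEQ_le_const[OF this, of b] main have "b \<le> a * (1 - \<kappa>)" by auto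
  then show False using ab(3) by simp
qed

end

section \<open>Small open subgroups of compact totally disconnected groups\<close>

text \<open>Van Dantzig's argument. In a compact totally disconnected group the identity has a clopen
  neighbourhood \<open>C\<close> inside the given one. The elements that, together with their inverses, map \<open>C\<close> into
  itself by right translation form a subgroup; it lies in \<open>C\<close> because \<open>C\<close> contains the identity, and it is
  open by the tube lemma because \<open>C\<close> is compact.\<close>

lemma compact_subgroup_small_open_subgroup:
  assumes tg: "topological_group G T" and H: "Hausdorff_space T" and td: "totally_disconnected_space T"
    and L: "subgroup L G" "compactin T L" and Q: "openin T Q" "\<one>\<^bsub>G\<^esub> \<in> Q"
  obtains U where "subgroup U G" "U \<subseteq> L \<inter> Q" "openin (subtopology T L) U"
proof -
  interpret group G using tg by (simp add: topological_group_def)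
  interpret L: subgroup L G by (rule L(1))
  have ts: "topspace T = carrier G" using tg by (simp add: topological_group_def)
  let ?X = "subtopology T L"
  have tX: "topspace ?X = L" using L.subset ts by auto
  have cX: "compact_space ?X" using L(2) by (simp add: compactin_subspace)
  have hX: "Hausdorff_space ?X" using H by (rule Hausdorff_space_subtopology)
  have one: "\<one>\<^bsub>G\<^esub> \<in> topspace ?X" unfolding tX by (rule L.one_closed)
  have comp: "connected_component_of_set ?X \<one>\<^bsub>G\<^esub> = {\<one>\<^bsub>G\<^esub>}"
  proof -
    have "connectedin T (connected_component_of_set ?X \<one>\<^bsub>G\<^esub>)"
      using connectedin_connected_component_of[of ?X "\<one>\<^bsub>G\<^esub>"] by (simp add: connectedin_subtopology)
    then obtain a where "connected_component_of_set ?X \<one>\<^bsub>G\<^esub> \<subseteq> {a}"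
      using td unfolding totally_disconnected_space_def by blast
    moreover have "\<one>\<^bsub>G\<^esub> \<in> connected_component_of_set ?X \<one>\<^bsub>G\<^esub>"
      using one by (simp add: connected_component_of_refl)
    ultimately show ?thesis by blast
  qed
  have "openin ?X (L \<inter> Q)" using Q(1) by (auto simp: openin_subtopology_Int2)
  obtain C where C: "openin ?X C" "closedin ?X C" "\<one>\<^bsub>G\<^esub> \<in> C" "C \<subseteq> L \<inter> Q"
  proof -
    have "{\<one>\<^bsub>G\<^esub>} \<in> connected_components_of ?X"
      using comp one unfolding connected_components_of_def by (metis (no_types, lifting) image_eqI)
    moreover have "compactin ?X {\<one>\<^bsub>G\<^esub>}" using one by simp
    moreover have "{\<one>\<^bsub>G\<^esub>} \<subseteq> L \<inter> Q" using Q(2) L.one_closed by blast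
    ultimately obtain U V where UV: "openin ?X U" "openin ?X V" "disjnt U V" "U \<union> V = topspace ?X"
      "{\<one>\<^bsub>G\<^esub>} \<subseteq> U" "U \<subseteq> L \<inter> Q"
      using wilder_locally_compact_component_thm[OF compact_imp_locally_compact_space[OF cX] hX _ _ \<open>openin ?X (L \<inter> Q)\<close>]
      by metis
    have "topspace ?X - U = V" using UV(3,4) by (auto simp: disjnt_def)
    then have "closedin ?X U" using UV openin_subset[OF UV(1)] by (simp add: closedin_def)
    then show ?thesis using that[of U] UV by blast
  qed
  have Ccomp: "compactin ?X C" by (rule closedin_compact_space[OF cX C(2)])
  have CL: "C \<subseteq> L" using C(4) by blast
  have open_stab: "openin ?X {k \<in> L. \<forall>c\<in>C. h c k \<in> C}"
    if h: "continuous_map (prod_topology T T) T (\<lambda>(c, k). h c k)" "\<And>c k. c \<in> L \<Longrightarrow> k \<in> L \<Longrightarrow> h c k \<in> L" for h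
  proof (subst openin_subopen, clarify)
    have hX: "continuous_map (prod_topology ?X ?X) ?X (\<lambda>(c, k). h c k)"
    proof -
      have e: "prod_topology ?X ?X = subtopology (prod_topology T T) (L \<times> L)"
        by (simp add: subtopology_Times)
      have "continuous_map (prod_topology ?X ?X) T (\<lambda>(c, k). h c k)"
        unfolding e using h(1) by (rule continuous_map_from_subtopology)
      then show ?thesis using h(2) tX by (auto simp: continuous_map_in_subtopology)
    qed
    fix k0 assume k0: "k0 \<in> L" "\<forall>c\<in>C. h c k0 \<in> C"
    let ?W = "{p \<in> topspace (prod_topology ?X ?X). (case p of (c, k) \<Rightarrow> h c k) \<in> C}"
    have W: "openin (prod_topology ?X ?X) ?W" by (rule openin_continuous_map_preimage[OF hX C(1)])
    have "C \<times> {k0} \<subseteq> ?W" using k0 CL tX by auto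
    from tube_lemma_left[OF W Ccomp _ this] k0 tX obtain A B where
      AB: "openin ?X B" "C \<subseteq> A" "k0 \<in> B" "A \<times> B \<subseteq> ?W" by auto
    have "B \<subseteq> {k \<in> L. \<forall>c\<in>C. h c k \<in> C}"
    proof
      fix k assume k: "k \<in> B"
      then have "\<And>c. c \<in> C \<Longrightarrow> (c, k) \<in> ?W" using AB by blast
      moreover have "k \<in> L" using k openin_subset[OF AB(1)] tX by blast
      ultimately show "k \<in> {k \<in> L. \<forall>c\<in>C. h c k \<in> C}" by simp
    qed
    then show "\<exists>B. openin ?X B \<and> k0 \<in> B \<and> B \<subseteq> {k \<in> L. \<forall>c\<in>C. h c k \<in> C}" using AB by blast
  qed
  define U where "U = {k \<in> L. \<forall>c\<in>C. c \<otimes>\<^bsub>G\<^esub> k \<in> C} \<inter> {k \<in> L. \<forall>c\<in>C. c \<otimes>\<^bsub>G\<^esub> inv\<^bsub>G\<^esub> k \<in> C}"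
  have Cc: "c \<in> C \<Longrightarrow> c \<in> carrier G" for c using CL L.subset by blast
  have "openin ?X U"
    unfolding U_def
  proof (intro openin_Int open_stab)
    show m: "continuous_map (prod_topology T T) T (\<lambda>(c, k). c \<otimes>\<^bsub>G\<^esub> k)"
      using tg by (simp add: topological_group_def)
    have "continuous_map (prod_topology T T) (prod_topology T T) (\<lambda>p. (fst p, inv\<^bsub>G\<^esub> (snd p)))"
      using tg by (intro continuous_map_pairedI continuous_map_fst continuous_map_compose[OF continuous_map_snd, unfolded o_def])
         (auto simp: topological_group_def)
    from continuous_map_compose[OF this m] show "continuous_map (prod_topology T T) T (\<lambda>(c, k). c \<otimes>\<^bsub>G\<^esub> inv\<^bsub>G\<^esub> k)"
      by (simp add: o_def case_prod_unfold)
  qed auto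
  moreover have "subgroup U G"
  proof (rule subgroupI)
    show "U \<subseteq> carrier G" using L.subset by (auto simp: U_def)
    have "\<one>\<^bsub>G\<^esub> \<in> U" using Cc by (auto simp: U_def)
    then show "U \<noteq> {}" by blast
    show "inv\<^bsub>G\<^esub> a \<in> U" if "a \<in> U" for a using that by (auto simp: U_def)
    show "a \<otimes>\<^bsub>G\<^esub> b \<in> U" if ab: "a \<in> U" "b \<in> U" for a b
    proof -
      have [simp]: "a \<in> carrier G" "b \<in> carrier G" using ab by (auto simp: U_def)
      have "c \<otimes>\<^bsub>G\<^esub> (a \<otimes>\<^bsub>G\<^esub> b) \<in> C" if c: "c \<in> C" for c
        using ab c Cc[OF c] by (simp add: U_def m_assoc[symmetric])
      moreover have "c \<otimes>\<^bsub>G\<^esub> inv\<^bsub>G\<^esub> (a \<otimes>\<^bsub>G\<^esub> b) \<in> C" if c: "c \<in> C" for c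
        using ab c Cc[OF c] by (simp add: U_def m_assoc[symmetric] inv_mult_group)
      ultimately show ?thesis using ab by (auto simp: U_def)
    qed
  qed
  moreover have "U \<subseteq> L \<inter> Q"
  proof
    fix k assume k: "k \<in> U"
    then have "\<one>\<^bsub>G\<^esub> \<otimes>\<^bsub>G\<^esub> k \<in> C" using C(3) by (auto simp: U_def)
    moreover have "k \<in> carrier G" using k by (auto simp: U_def)
    ultimately show "k \<in> L \<inter> Q" using C(4) by auto
  qed
  ultimately show ?thesis using that by blast
qed

section \<open>Sublinear growth of a reflected height\<close>

context random_walk
begin

text \<open>The height \<open>W\<close> behaves like a random walk with increments \<open>z\<close> of nonpositive mean, reflected by the
  obstacles \<open>P\<close>. For bounded centred increments of variance \<open>v\<close> the Lyapunov function \<open>u\<^sup>2 / (2 c)\<close> grows by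
  \<open>v / (2 c)\<close> on average in each step, and taking the positive part of \<open>u\<close> only decreases it; a large \<open>c\<close>
  makes this drift small. Unbounded increments and obstacles are truncated at a level \<open>L\<close>, at which the
  mean error is small by integrability.\<close>

theorem sublinear_height:
  fixes W P z :: "'a \<Rightarrow> real"
  assumes W: "W \<in> borel_measurable BT" "\<And>g. 0 \<le> W g" "W \<one> \<le> 0"
    and P: "integrable \<mu> P" "\<And>x. 0 \<le> P x" and z: "integrable \<mu> z" "(\<integral>x. z x \<partial>\<mu>) \<le> 0"
    and step: "\<And>g x. g \<in> carrier G \<Longrightarrow> x \<in> carrier G \<Longrightarrow> W (g \<otimes> x) \<le> max (W g) (P x) + z x"
    and eps: "0 < \<epsilon>"
  shows "\<exists>C\<ge>0. \<forall>n. (\<integral>\<^sup>+ g. ennreal (W g) \<partial>law n) \<le> ennreal (C + \<epsilon> * real n)"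
proof -
  have [measurable]: "P \<in> borel_measurable \<mu>" "z \<in> borel_measurable \<mu>" using P z by auto
  note Wm [measurable] = W(1)
  \<comment> \<open>the total truncation error at level \<open>L\<close>\<close>
  define R where "R L x = max 0 (P x - L) + (if \<bar>z x\<bar> \<le> L then 0 else \<bar>z x\<bar>)" for L x
  have Rb: "0 \<le> R L x" "0 \<le> L \<Longrightarrow> R L x \<le> P x + \<bar>z x\<bar>" for L x using P(2)[of x] by (auto simp: R_def)
  have Rm [measurable]: "R L \<in> borel_measurable \<mu>" for L unfolding R_def[abs_def] by measurable
  have Ri: "integrable \<mu> (R L)" if "0 \<le> L" for L
  proof (rule Bochner_Integration.integrable_bound[of \<mu> "\<lambda>x. P x + \<bar>z x\<bar>"])
    show "AE x in \<mu>. norm (R L x) \<le> norm (P x + \<bar>z x\<bar>)"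
      using Rb that P(2) by (intro AE_I2) (simp add: abs_of_nonneg)
  qed (use P z in auto)
  have "(\<lambda>k. \<integral>x. R (real k) x \<partial>\<mu>) \<longlonglongrightarrow> (\<integral>x. 0 \<partial>\<mu>)"
  proof (rule integral_dominated_convergence[where w = "\<lambda>x. P x + \<bar>z x\<bar>"])
    show "AE x in \<mu>. (\<lambda>k. R (real k) x) \<longlonglongrightarrow> 0"
    proof (rule AE_I2)
      fix x
      obtain k0 where k0: "P x + \<bar>z x\<bar> \<le> real k0" using real_arch_simple by blast
      have "R (real k) x = 0" if "k0 \<le> k" for k
      proof -
        have "real k0 \<le> real k" using that by simp
        then have "P x \<le> real k" "\<bar>z x\<bar> \<le> real k" using k0 P(2)[of x] by linarith+
        then show ?thesis by (simp add: R_def)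
      qed
      then show "(\<lambda>k. R (real k) x) \<longlonglongrightarrow> 0"
        by (intro tendsto_eventually) (auto simp: eventually_sequentially)
    qed
    show "AE x in \<mu>. norm (R (real k) x) \<le> P x + \<bar>z x\<bar>" for k using Rb by simp
  qed (use P z in auto)
  then have "\<forall>\<^sub>F k in sequentially. (\<integral>x. R (real k) x \<partial>\<mu>) < \<epsilon> / 4"
    using eps by (intro order_tendstoD(2)) auto
  then obtain k where k: "(\<integral>x. R (real k) x \<partial>\<mu>) < \<epsilon> / 4" by (auto simp: eventually_sequentially)
  define L where "L = real k"
  have L: "0 \<le> L" "(\<integral>x. R L x \<partial>\<mu>) < \<epsilon> / 4" using k by (simp_all add: L_def)
  define y where "y x = (if \<bar>z x\<bar> \<le> L then z x else 0)" for x
  have yb: "\<bar>y x\<bar> \<le> L" for x using L by (simp add: y_def)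
  have ym [measurable]: "y \<in> borel_measurable \<mu>" unfolding y_def[abs_def] by measurable
  have yi: "integrable \<mu> y" using yb by (intro mu.integrable_const_bound[where B = L]) auto
  define m where "m = (\<integral>x. y x \<partial>\<mu>)"
  have zy: "\<bar>z x - y x\<bar> \<le> R L x" for x using P(2)[of x] by (auto simp: y_def R_def)
  have m: "m \<le> \<epsilon> / 4"
  proof -
    have "m = (\<integral>x. z x \<partial>\<mu>) - (\<integral>x. z x - y x \<partial>\<mu>)" using z yi by (simp add: m_def)
    moreover have "- (\<integral>x. z x - y x \<partial>\<mu>) \<le> (\<integral>x. R L x \<partial>\<mu>)"
    proof -
      have "- (\<integral>x. z x - y x \<partial>\<mu>) = (\<integral>x. - (z x - y x) \<partial>\<mu>)" by (rule Bochner_Integration.integral_minus[symmetric])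
      also have "\<dots> \<le> (\<integral>x. R L x \<partial>\<mu>)"
      proof (rule integral_mono)
        fix x show "- (z x - y x) \<le> R L x" using zy[of x] by linarith
      qed (use z yi Ri L in auto)
      finally show ?thesis .
    qed
    ultimately show ?thesis using z(2) L(2) by linarith
  qed
  define yc where "yc x = y x - m" for x
  have ycb: "\<bar>yc x\<bar> \<le> L + \<bar>m\<bar>" for x using yb[of x] by (simp add: yc_def)
  have ycm [measurable]: "yc \<in> borel_measurable \<mu>" unfolding yc_def[abs_def] by measurable
  have yci: "integrable \<mu> yc" "(\<integral>x. yc x \<partial>\<mu>) = 0" using yi unfolding yc_def[abs_def] by (simp_all add: m_def)
  have yc2i: "integrable \<mu> (\<lambda>x. (yc x)\<^sup>2)"
  proof (rule mu.integrable_const_bound[where B = "(L + \<bar>m\<bar>)\<^sup>2"])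
    show "AE x in \<mu>. norm ((yc x)\<^sup>2) \<le> (L + \<bar>m\<bar>)\<^sup>2"
      using ycb L(1) by (intro AE_I2) (simp add: abs_le_square_iff[symmetric])
  qed measurable
  define v where "v = (\<integral>x. (yc x)\<^sup>2 \<partial>\<mu>)"
  have v: "0 \<le> v" by (simp add: v_def)
  \<comment> \<open>large enough for the Lyapunov drift \<open>v / (2 * c)\<close> to be at most \<open>\<epsilon> / 2\<close>\<close>
  define c where "c = v / \<epsilon> + 1"
  have c: "0 < c" using v eps by (simp add: c_def add_nonneg_pos)
  define \<zeta> where "\<zeta> x = R L x + max 0 m" for x
  have \<zeta>0: "0 \<le> \<zeta> x" for x using Rb(1)[of L x] by (simp add: \<zeta>_def)
  have \<zeta>i: "integrable \<mu> \<zeta>" using Ri[OF L(1)] by (simp add: \<zeta>_def[abs_def])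
  define K where "K = (\<integral>x. \<zeta> x \<partial>\<mu>)"
  have K: "0 \<le> K" "K \<le> \<epsilon> / 2"
  proof -
    show "0 \<le> K" unfolding K_def using \<zeta>0 by (intro integral_nonneg_AE) auto
    show "K \<le> \<epsilon> / 2" using Ri[OF L(1)] L(2) m eps by (simp add: K_def \<zeta>_def)
  qed
  define D where "D = K + v / (2 * c)"
  have D0: "0 \<le> D" using K v c by (simp add: D_def)
  \<comment> \<open>the height is split as \<open>a + u\<close>: \<open>u\<close> performs the centred bounded walk, \<open>a\<close> collects the truncation errors\<close>
  have claim: "(\<integral>\<^sup>+ h. ennreal (W (g \<otimes> h)) \<partial>law n) \<le> ennreal (a + u\<^sup>2 / (2 * c) + c / 2 + real n * D)"
    if "g \<in> carrier G" "L \<le> a" "0 \<le> u" "W g \<le> a + u" for n g a u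
    using that
  proof (induction n arbitrary: g a u)
    case 0
    have gm: "(\<lambda>h. ennreal (W (g \<otimes> h))) \<in> borel_measurable BT"
      using measurable_compose[OF measurable_lmult[OF 0(1)] Wm] by simp
    have "0 \<le> (u - c)\<^sup>2 / (2 * c)" using c by simp
    also have "\<dots> = u\<^sup>2 / (2 * c) + c / 2 - u" using c by (simp add: power2_diff field_simps power2_eq_square)
    finally have "u \<le> u\<^sup>2 / (2 * c) + c / 2" by simp
    then show ?case using 0 gm by (simp add: nn_integral_return ennreal_leI)
  next
    case (Suc n)
    have gm: "(\<lambda>h. ennreal (W (g \<otimes> h))) \<in> borel_measurable BT"
      using measurable_compose[OF measurable_lmult[OF Suc.prems(1)] Wm] by simp
    define w where "w x = a + \<zeta> x + (u + yc x)\<^sup>2 / (2 * c) + c / 2 + real n * D" for x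
    have w0: "0 \<le> w x" for x using \<zeta>0[of x] Suc.prems(2) L(1) c D0 by (simp add: w_def)
    have exp: "w x = (a + u\<^sup>2 / (2 * c) + c / 2 + real n * D) + \<zeta> x + (u / c) * yc x + 1 / (2 * c) * (yc x)\<^sup>2" for x
      using c by (simp add: w_def power2_sum add_divide_distrib)
    have wi: "integrable \<mu> w"
      unfolding exp[abs_def] using \<zeta>i yci yc2i by (intro Bochner_Integration.integrable_add integrable_mult_right) auto
    have wint: "(\<integral>x. w x \<partial>\<mu>) = a + u\<^sup>2 / (2 * c) + c / 2 + real (Suc n) * D"
      unfolding exp[abs_def] using \<zeta>i yci yc2i
      by (simp add: K_def[symmetric] v_def[symmetric] D_def algebra_simps add_divide_distrib)
    have "(\<integral>\<^sup>+ h. ennreal (W (g \<otimes> h)) \<partial>law (Suc n)) = (\<integral>\<^sup>+ x. (\<integral>\<^sup>+ h. ennreal (W (g \<otimes> (x \<otimes> h))) \<partial>law n) \<partial>\<mu>)"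
      by (rule nn_integral_law_Suc[OF gm])
    also have "\<dots> \<le> (\<integral>\<^sup>+ x. ennreal (w x) \<partial>\<mu>)"
    proof (rule nn_integral_mono)
      fix x assume "x \<in> space \<mu>"
      then have x: "x \<in> carrier G" by simp
      define u' where "u' = max 0 (u + yc x)"
      have "max (W g) (P x) \<le> a + u + max 0 (P x - L)" using Suc.prems by linarith
      moreover have "z x \<le> yc x + max 0 m + (R L x - max 0 (P x - L))"
        by (auto simp: yc_def y_def R_def)
      ultimately have "W (g \<otimes> x) \<le> (a + \<zeta> x) + u'"
        using step[OF Suc.prems(1) x] unfolding \<zeta>_def u'_def by linarith
      then have "(\<integral>\<^sup>+ h. ennreal (W ((g \<otimes> x) \<otimes> h)) \<partial>law n) \<le> ennreal ((a + \<zeta> x) + u'\<^sup>2 / (2 * c) + c / 2 + real n * D)"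
        using Suc.prems x \<zeta>0[of x] by (intro Suc.IH) (auto simp: u'_def)
      also have "\<dots> \<le> ennreal (w x)"
        unfolding w_def using c by (intro ennreal_leI add_mono order_refl divide_right_mono) (auto simp: u'_def max_def)
      also have "(\<integral>\<^sup>+ h. ennreal (W ((g \<otimes> x) \<otimes> h)) \<partial>law n) = (\<integral>\<^sup>+ h. ennreal (W (g \<otimes> (x \<otimes> h))) \<partial>law n)"
        using Suc.prems(1) x by (intro nn_integral_cong) (simp add: m_assoc)
      finally show "(\<integral>\<^sup>+ h. ennreal (W (g \<otimes> (x \<otimes> h))) \<partial>law n) \<le> ennreal (w x)" .
    qed
    also have "\<dots> = ennreal (\<integral>x. w x \<partial>\<mu>)" using wi w0 by (intro nn_integral_eq_integral) auto
    finally show ?case unfolding wint .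
  qed
  have Dle: "D \<le> \<epsilon>"
  proof -
    have "v / (2 * c) \<le> \<epsilon> / 2"
    proof -
      have "v \<le> \<epsilon> * c" using eps by (simp add: c_def distrib_left)
      then show ?thesis using c by (simp add: divide_le_eq)
    qed
    then show ?thesis using K(2) by (simp add: D_def)
  qed
  show ?thesis
  proof (intro exI[of _ "L + c / 2"] conjI allI)
    show "0 \<le> L + c / 2" using L c by simp
    fix n
    have "(\<integral>\<^sup>+ g. ennreal (W g) \<partial>law n) = (\<integral>\<^sup>+ h. ennreal (W (\<one> \<otimes> h)) \<partial>law n)"
      by (intro nn_integral_cong) simp
    also have "\<dots> \<le> ennreal (L + 0\<^sup>2 / (2 * c) + c / 2 + real n * D)"
      using W(3) L by (intro claim) auto
    also have "\<dots> \<le> ennreal (L + c / 2 + \<epsilon> * real n)"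
      using mult_left_mono[OF Dle, of "real n"] by (intro ennreal_leI) (simp add: mult.commute)
    finally show "(\<integral>\<^sup>+ g. ennreal (W g) \<partial>law n) \<le> ennreal (L + c / 2 + \<epsilon> * real n)" .
  qed
qed

lemma nn_integral_subadditive_le:
  assumes P: "P \<in> borel_measurable BT" "\<And>x. 0 \<le> (P x :: real)" "P \<one> = 0"
    and sub: "\<And>g x. g \<in> carrier G \<Longrightarrow> x \<in> carrier G \<Longrightarrow> P (g \<otimes> x) \<le> P g + P x"
    and p: "(\<integral>\<^sup>+ x. ennreal (P x) \<partial>\<mu>) \<le> ennreal p" "0 \<le> p"
  shows "(\<integral>\<^sup>+ g. ennreal (P g) \<partial>law n) \<le> ennreal (real n * p)"
proof (induction n)
  case 0
  show ?case using P by (simp add: nn_integral_return)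
next
  case (Suc n)
  note [measurable] = P(1)
  have "(\<integral>\<^sup>+ g. ennreal (P g) \<partial>law (Suc n)) = (\<integral>\<^sup>+ x. (\<integral>\<^sup>+ g. ennreal (P (x \<otimes> g)) \<partial>law n) \<partial>\<mu>)"
    by (rule nn_integral_law_Suc) measurable
  also have "\<dots> \<le> (\<integral>\<^sup>+ x. (\<integral>\<^sup>+ g. ennreal (P x) + ennreal (P g) \<partial>law n) \<partial>\<mu>)"
    using sub P(2) by (intro nn_integral_mono) (simp flip: ennreal_plus add: ennreal_leI)
  also have "\<dots> = (\<integral>\<^sup>+ x. ennreal (P x) \<partial>\<mu>) + (\<integral>\<^sup>+ g. ennreal (P g) \<partial>law n)"
    by (simp add: nn_integral_add)
  also have "\<dots> \<le> ennreal p + ennreal (real n * p)" using p Suc by (intro add_mono) auto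
  also have "\<dots> = ennreal (real (Suc n) * p)" using p by (simp flip: ennreal_plus add: algebra_simps)
  finally show ?case .
qed

end

section \<open>Automorphisms of totally disconnected locally compact groups\<close>

locale tdlc_automorphism =
  fixes G :: "('a, 'm) monoid_scheme" (structure) and T :: "'a topology" and \<alpha> :: "'a \<Rightarrow> 'a" and V :: "'a set"
  assumes tdlc: "tdlc_group G T" and \<alpha>: "\<alpha> \<in> topological_auto G T" and V: "compact_open_subgroup G T V"
begin

lemma topological_group: "topological_group G T" and Hausdorff: "Hausdorff_space T"
  and totally_disconnected: "totally_disconnected_space T"
  using tdlc by (simp_all add: tdlc_group_def)

sublocale group G
  using topological_group by (simp add: topological_group_def)

lemma topspace_T: "topspace T = carrier G"
  using topological_group by (simp add: topological_group_def)

lemma subgroup_V: "subgroup V G" and open_V: "openin T V" and compact_V: "compactin T V"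
  using V by (simp_all add: compact_open_subgroup_def)

abbreviation pw :: "int \<Rightarrow> 'a \<Rightarrow> 'a" where "pw n \<equiv> aut_pow G \<alpha> n"

lemma carrier_AutoGroup: "carrier (AutoGroup G) = auto G"
  by (simp add: AutoGroup_def)

lemma \<alpha>_auto: "\<alpha> \<in> auto G" and \<alpha>_homeo: "homeomorphic_map T T \<alpha>"
  using \<alpha> by (simp_all add: topological_auto_def)

lemma pw_auto: "pw n \<in> auto G"
  using group.int_pow_closed[OF AutoGroup, of \<alpha> n] \<alpha>_auto by (simp add: carrier_AutoGroup)

lemma pw_closed [simp]: "x \<in> carrier G \<Longrightarrow> pw n x \<in> carrier G"
  using pw_auto[of n] by (auto simp: auto_def hom_def)

lemma pw_mult: "x \<in> carrier G \<Longrightarrow> y \<in> carrier G \<Longrightarrow> pw n (x \<otimes> y) = pw n x \<otimes> pw n y"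
  using pw_auto[of n] by (auto simp: auto_def hom_def)

lemma pw_add: "x \<in> carrier G \<Longrightarrow> pw (m + n) x = pw m (pw n x)"
proof -
  assume x: "x \<in> carrier G"
  have "pw (m + n) = pw m \<otimes>\<^bsub>AutoGroup G\<^esub> pw n"
    using \<alpha>_auto by (intro group.int_pow_mult[OF AutoGroup]) (simp add: carrier_AutoGroup)
  also have "\<dots> = compose (carrier G) (pw m) (pw n)"
    using pw_auto by (simp add: AutoGroup_def BijGroup_def auto_def)
  finally show ?thesis using x by (simp add: compose_def)
qed

lemma AutoGroup_one [simp]: "x \<in> carrier G \<Longrightarrow> \<one>\<^bsub>AutoGroup G\<^esub> x = x"
  by (simp add: AutoGroup_def BijGroup_def)

lemma pw_cancel: "x \<in> carrier G \<Longrightarrow> pw (- n) (pw n x) = x" "x \<in> carrier G \<Longrightarrow> pw n (pw (- n) x) = x"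
  by (simp_all flip: pw_add)

lemma pw_one [simp]: "pw n \<one> = \<one>"
proof -
  have "pw n \<one> \<otimes> pw n \<one> = pw n \<one>" using pw_mult[of \<one> \<one> n] by simp
  then show ?thesis by (metis l_cancel_one' one_closed pw_closed)
qed

lemma pw_inv: "x \<in> carrier G \<Longrightarrow> pw n (inv x) = inv (pw n x)"
  using pw_mult[of "inv x" x n] by (intro inv_equality[symmetric]) auto

lemma pw_1: "x \<in> carrier G \<Longrightarrow> pw 1 x = \<alpha> x"
  using \<alpha>_auto by (simp add: group.int_pow_1[OF AutoGroup] carrier_AutoGroup)

lemma pw_continuous: "continuous_map T T (pw n)"
proof (induction n rule: int_induct[of _ 0])
  case base
  show ?case by (rule continuous_map_eq[OF continuous_map_id]) (simp add: topspace_T)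
next
  case (step1 i)
  have "continuous_map T T (\<alpha> \<circ> pw i)"
    using step1(2) homeomorphic_imp_continuous_map[OF \<alpha>_homeo] by (rule continuous_map_compose)
  then show ?case
    by (rule continuous_map_eq) (simp add: topspace_T pw_add[of _ 1, symmetric] pw_1[symmetric] add.commute)
next
  case (step2 i)
  obtain \<beta> where \<beta>: "continuous_map T T \<beta>" "\<And>x. x \<in> carrier G \<Longrightarrow> \<beta> (\<alpha> x) = x"
    using \<alpha>_homeo unfolding homeomorphic_map_maps homeomorphic_maps_def topspace_T by blast
  have b: "\<beta> x = pw (- 1) x" if "x \<in> carrier G" for x
    using \<beta>(2)[of "pw (- 1) x"] that pw_cancel(2)[of x 1] by (simp add: pw_1[symmetric])
  have "continuous_map T T (\<beta> \<circ> pw i)"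
    using step2(2) \<beta>(1) by (rule continuous_map_compose)
  then show ?case
    by (rule continuous_map_eq) (simp add: topspace_T b pw_add[of _ "-1", symmetric])
qed

text \<open>The subgroup \<open>\<alpha>\<^sup>n V\<^sub>-\<close>, written as a condition on orbits so that its monotonicity in \<open>n\<close> is visible.\<close>

definition B :: "int \<Rightarrow> 'a set" where
  "B n = {x \<in> carrier G. \<forall>j \<ge> - n. pw j x \<in> V}"

lemma B_carrier: "x \<in> B n \<Longrightarrow> x \<in> carrier G" by (simp add: B_def)

lemma V_minus_eq: "V_minus G \<alpha> V = B 0"
proof -
  have "x \<in> pw (- int k) ` V \<longleftrightarrow> x \<in> carrier G \<and> pw (int k) x \<in> V" for x k
  proof
    assume "x \<in> pw (- int k) ` V"
    then obtain v where v: "v \<in> V" "x = pw (- int k) v" by blast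
    then have "v \<in> carrier G" using subgroup.subset[OF subgroup_V] by blast
    then show "x \<in> carrier G \<and> pw (int k) x \<in> V" using v by (simp add: pw_cancel)
  next
    assume x: "x \<in> carrier G \<and> pw (int k) x \<in> V"
    then have "x = pw (- int k) (pw (int k) x)" by (simp add: pw_cancel)
    then show "x \<in> pw (- int k) ` V" using x by blast
  qed
  then show ?thesis unfolding V_minus_def B_def by (auto, metis nonneg_int_cases)
qed

lemma pw_in_B: "x \<in> carrier G \<Longrightarrow> pw m x \<in> B n \<longleftrightarrow> x \<in> B (n - m)"
proof -
  assume x: "x \<in> carrier G"
  have "(\<forall>j \<ge> - n. pw (j + m) x \<in> V) \<longleftrightarrow> (\<forall>j \<ge> - (n - m). pw j x \<in> V)"
  proof safe
    fix j assume "\<forall>j \<ge> - n. pw (j + m) x \<in> V" "- (n - m) \<le> j"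
    then show "pw j x \<in> V" by (auto dest: spec[of _ "j - m"])
  qed auto
  then show ?thesis using x by (simp add: B_def pw_add)
qed

lemma pw_image_B: "pw m ` B n = B (m + n)"
proof safe
  fix x assume "x \<in> B n"
  then show "pw m x \<in> B (m + n)" using pw_in_B[of x m "m + n"] by (simp add: B_carrier)
next
  fix x assume x: "x \<in> B (m + n)"
  then have "pw (- m) x \<in> B n" using pw_in_B[of x "- m" n] by (simp add: B_carrier add.commute)
  moreover have "x = pw m (pw (- m) x)" using B_carrier[OF x] by (simp add: pw_cancel)
  ultimately show "x \<in> pw m ` B n" by blast
qed

lemma B_antimono: "m \<le> n \<Longrightarrow> B n \<subseteq> B m"
  by (auto simp: B_def)

lemma B_subgroup: "subgroup (B n) G"
proof (rule subgroupI)
  show "B n \<subseteq> carrier G" using B_carrier by blast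
  show "B n \<noteq> {}" using subgroup.one_closed[OF subgroup_V] by (auto simp: B_def intro!: exI[of _ \<one>])
  show "inv a \<in> B n" if "a \<in> B n" for a
    using that subgroup.m_inv_closed[OF subgroup_V] by (simp add: B_def pw_inv)
  show "a \<otimes> b \<in> B n" if "a \<in> B n" "b \<in> B n" for a b
    using that subgroup.m_closed[OF subgroup_V] by (simp add: B_def pw_mult)
qed

lemmas B_mult = subgroup.m_closed[OF B_subgroup]
  and B_inv = subgroup.m_inv_closed[OF B_subgroup]
  and B_one = subgroup.one_closed[OF B_subgroup]

lemma B_compact: "compactin T (B n)"
proof -
  have "closedin T (\<Inter>j\<in>{-n..}. {x \<in> topspace T. pw j x \<in> V})"
  proof (rule closedin_INT)
    fix j show "closedin T {x \<in> topspace T. pw j x \<in> V}"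
      using closedin_continuous_map_preimage[OF pw_continuous compactin_imp_closedin[OF Hausdorff compact_V]] .
  qed simp
  also have "(\<Inter>j\<in>{-n..}. {x \<in> topspace T. pw j x \<in> V}) = B n"
    by (auto simp: B_def topspace_T)
  finally have c: "closedin T (B n)" .
  have "B n \<subseteq> pw n ` V"
  proof
    fix x assume x: "x \<in> B n"
    then have "pw (- n) x \<in> V" by (simp add: B_def)
    moreover have "x = pw n (pw (- n) x)" using B_carrier[OF x] by (simp add: pw_cancel)
    ultimately show "x \<in> pw n ` V" by blast
  qed
  moreover have "compactin T (pw n ` V)" by (rule image_compactin[OF compact_V pw_continuous])
  ultimately show ?thesis using closed_compactin c by metis
qed

lemma B_closed: "closedin T (B n)"
  by (rule compactin_imp_closedin[OF Hausdorff B_compact])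

abbreviation D :: "'a set" where "D \<equiv> V_minusminus G \<alpha> V"

lemma D_eq: "D = (\<Union>n::nat. B (- int n))"
  unfolding V_minusminus_def V_minus_eq pw_image_B by simp

lemma B_subset_D: "B n \<subseteq> D"
proof -
  have "B n \<subseteq> B (- int (nat (- n)))" by (rule B_antimono) simp
  then show ?thesis unfolding D_eq by blast
qed

lemma D_E: assumes "x \<in> D" obtains n :: nat where "x \<in> B (- int n)"
  using assms unfolding D_eq by blast

lemma D_carrier: "x \<in> D \<Longrightarrow> x \<in> carrier G"
  by (erule D_E) (rule B_carrier)

lemma D_subgroup: "subgroup D G"
proof (rule subgroupI)
  show "D \<subseteq> carrier G" using D_carrier by blast
  show "D \<noteq> {}" using B_one B_subset_D by blast
  show "inv a \<in> D" if "a \<in> D" for a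
    using that B_inv B_subset_D by (meson D_E subsetD)
  show "a \<otimes> b \<in> D" if ab: "a \<in> D" "b \<in> D" for a b
  proof -
    obtain m n :: nat where "a \<in> B (- int m)" "b \<in> B (- int n)" using ab D_E by metis
    then have "a \<in> B (- int (max m n))" "b \<in> B (- int (max m n))"
      using B_antimono[of "- int (max m n)" "- int m"] B_antimono[of "- int (max m n)" "- int n"] by auto
    then show ?thesis using B_mult B_subset_D by blast
  qed
qed

lemmas D_mult = subgroup.m_closed[OF D_subgroup]
  and D_inv = subgroup.m_inv_closed[OF D_subgroup]
  and D_one = subgroup.one_closed[OF D_subgroup]

lemma pw_D: "x \<in> D \<Longrightarrow> pw m x \<in> D"
proof (erule D_E)
  fix n assume "x \<in> B (- int n)"
  then have "pw m x \<in> B (m + - int n)" using pw_image_B by blast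
  then show "pw m x \<in> D" using B_subset_D by blast
qed

lemma finite_cover_by_cosets:
  assumes L: "subgroup L G" "compactin T L" and U: "subgroup U G" "openin (subtopology T L) U"
  obtains F where "finite F" "F \<subseteq> L" "L \<subseteq> (\<Union>f\<in>F. f <# U)"
proof -
  obtain Q where Q: "openin T Q" "U = Q \<inter> L" using U(2) unfolding openin_subtopology by blast
  have Lc: "l \<in> L \<Longrightarrow> l \<in> carrier G" for l using subgroup.subset[OF L(1)] by blast
  define S where "S l = {x \<in> topspace T. inv l \<otimes> x \<in> Q}" for l
  have lm: "continuous_map T T (\<lambda>x. g \<otimes> x)" if g: "g \<in> carrier G" for g
  proof -
    have "continuous_map T (prod_topology T T) (\<lambda>x. (g, x))"
      using g by (intro continuous_map_pairedI) (auto simp: topspace_T)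
    from continuous_map_compose[OF this, of T "\<lambda>(x, y). x \<otimes> y"] show ?thesis
      using topological_group by (simp add: topological_group_def o_def)
  qed
  have S: "openin T (S l)" "l \<in> S l" if l: "l \<in> L" for l
  proof -
    show "openin T (S l)" unfolding S_def
      using Lc[OF l] by (intro openin_continuous_map_preimage[OF lm Q(1)]) simp
    show "l \<in> S l" unfolding S_def using Lc[OF l] subgroup.one_closed[OF U(1)] Q(2) by (simp add: topspace_T)
  qed
  obtain \<F> where \<F>: "finite \<F>" "\<F> \<subseteq> S ` L" "L \<subseteq> \<Union>\<F>"
    using compactinD[OF L(2), of "S ` L"] S by blast
  obtain F where F: "F \<subseteq> L" "finite F" "\<F> = S ` F" using finite_subset_image[OF \<F>(1,2)] by blast
  have "L \<subseteq> (\<Union>f\<in>F. f <# U)"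
  proof
    fix x assume x: "x \<in> L"
    then obtain f where f: "f \<in> F" "x \<in> S f" using \<F>(3) F(3) by blast
    have fL: "f \<in> L" using f F by blast
    have "inv f \<otimes> x \<in> U" using f(2) Q(2) x fL subgroup.m_closed[OF L(1)] subgroup.m_inv_closed[OF L(1)]
      by (simp add: S_def)
    moreover have "x = f \<otimes> (inv f \<otimes> x)" using Lc[OF x] Lc[OF fL] by (simp add: m_assoc[symmetric])
    ultimately show "x \<in> (\<Union>f\<in>F. f <# U)" using f(1) unfolding l_coset_def by blast
  qed
  then show ?thesis using that F by blast
qed

text \<open>\<open>B 0 = V \<inter> B (-1)\<close> is open in the compact group \<open>B (-1)\<close>, so it has finite index, at most \<open>q\<close>. Each further
  level is the image of this one under a power of \<open>\<alpha>\<close> and multiplies the number of cosets by at most \<open>q\<close>.\<close>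

lemma B_index:
  assumes U: "subgroup U G" "U \<subseteq> B 0" "openin (subtopology T (B 0)) U"
  obtains q j :: nat where "q \<ge> 1" "\<And>n. \<exists>F. finite F \<and> card F \<le> j * q ^ n \<and> F \<subseteq> B (- int n) \<and> B (- int n) \<subseteq> (\<Union>f\<in>F. f <# U)"
proof -
  obtain F0 where F0: "finite F0" "F0 \<subseteq> B 0" "B 0 \<subseteq> (\<Union>f\<in>F0. f <# U)"
    using finite_cover_by_cosets[OF B_subgroup B_compact U(1,3)] by blast
  have "B 0 = V \<inter> B (- 1)"
  proof -
    have "(\<forall>j\<ge>0. P j) \<longleftrightarrow> P 0 \<and> (\<forall>j\<ge>1. P j)" for P :: "int \<Rightarrow> bool"
      by (metis int_one_le_iff_zero_less linorder_le_less_linear order.order_iff_strict order.refl order.strict_trans1 zero_le_one)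
    then show ?thesis using subgroup.subset[OF subgroup_V] by (auto simp: B_def)
  qed
  then have "openin (subtopology T (B (- 1))) (B 0)" using open_V by (auto simp: openin_subtopology)
  then obtain F1 where F1: "finite F1" "F1 \<subseteq> B (- 1)" "B (- 1) \<subseteq> (\<Union>f\<in>F1. f <# B 0)"
    using finite_cover_by_cosets[OF B_subgroup B_compact B_subgroup] by blast
  have "F1 \<noteq> {}" using F1(3) B_one by blast
  then have q1: "card F1 \<ge> 1" using F1(1) by (simp add: Suc_leI card_gt_0_iff)
  have "\<exists>F. finite F \<and> card F \<le> card F0 * card F1 ^ n \<and> F \<subseteq> B (- int n) \<and> B (- int n) \<subseteq> (\<Union>f\<in>F. f <# U)" for n
  proof (induction n)
    case 0
    show ?case using F0 by (intro exI[of _ F0]) simp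
  next
    case (Suc n)
    then obtain F where F: "finite F" "card F \<le> card F0 * card F1 ^ n" "F \<subseteq> B (- int n)" "B (- int n) \<subseteq> (\<Union>f\<in>F. f <# U)"
      by blast
    define F' where "F' = (\<lambda>(a, b). pw (- int n) a \<otimes> b) ` (F1 \<times> F)"
    have fin: "finite F'" using F F1 by (simp add: F'_def)
    have card: "card F' \<le> card F0 * card F1 ^ Suc n"
    proof -
      have "card F' \<le> card F1 * card F" unfolding F'_def using card_image_le[of "F1 \<times> F"] F F1 by (simp add: card_cartesian_product)
      also have "\<dots> \<le> card F1 * (card F0 * card F1 ^ n)" using F(2) by simp
      finally show ?thesis by (simp add: mult_ac)
    qed
    have pwF: "pw (- int n) a \<in> B (- int (Suc n))" if "a \<in> B (- 1)" for a
      using that by (simp add: pw_in_B B_carrier)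
    have sub: "B (- int n) \<subseteq> B (- int (Suc n))" by (rule B_antimono) simp
    have subB: "F' \<subseteq> B (- int (Suc n))"
    proof
      fix x assume "x \<in> F'"
      then obtain a b where ab: "a \<in> F1" "b \<in> F" "x = pw (- int n) a \<otimes> b" by (auto simp: F'_def)
      then have "pw (- int n) a \<in> B (- int (Suc n))" "b \<in> B (- int (Suc n))"
        using pwF F1(2) F(3) sub by blast+
      then show "x \<in> B (- int (Suc n))" unfolding ab(3) by (rule B_mult)
    qed
    have cover: "B (- int (Suc n)) \<subseteq> (\<Union>f\<in>F'. f <# U)"
    proof
      fix x assume x: "x \<in> B (- int (Suc n))"
      have xc: "x \<in> carrier G" using x by (rule B_carrier)
      have "pw (int n) x \<in> B (- 1)" using pw_in_B[OF xc, of "int n" "- 1"] x by simp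
      then obtain a b0 where a: "a \<in> F1" "b0 \<in> B 0" "pw (int n) x = a \<otimes> b0" using F1(3) unfolding l_coset_def by blast
      have ac: "a \<in> carrier G" "b0 \<in> carrier G" using a F1(2) B_carrier by blast+
      have "x = pw (- int n) (a \<otimes> b0)" using a(3) pw_cancel(1)[OF xc, of "int n"] by simp
      also have "\<dots> = pw (- int n) a \<otimes> pw (- int n) b0" using ac by (rule pw_mult)
      finally have x2: "x = pw (- int n) a \<otimes> pw (- int n) b0" .
      have "pw (- int n) b0 \<in> B (- int n)" using a(2) pw_image_B[of "- int n" 0] by auto
      then obtain b u where b: "b \<in> F" "u \<in> U" "pw (- int n) b0 = b \<otimes> u" using F(4) unfolding l_coset_def by blast
      have bc: "b \<in> carrier G" "u \<in> carrier G" using b F(3) B_carrier subgroup.subset[OF U(1)] by blast+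
      have "x = (pw (- int n) a \<otimes> b) \<otimes> u" using x2 b(3) ac bc by (simp add: m_assoc)
      moreover have "pw (- int n) a \<otimes> b \<in> F'" using a(1) b(1) by (force simp: F'_def)
      ultimately show "x \<in> (\<Union>f\<in>F'. f <# U)" using b(2) unfolding l_coset_def by blast
    qed
    show ?case using fin card subB cover by (intro exI[of _ F'] conjI)
  qed
  then show ?thesis using that q1 by blast
qed

end

section \<open>The semidirect product and its height functions\<close>

context tdlc_automorphism
begin

abbreviation H where "H \<equiv> semidirect G \<alpha> V"
abbreviation TH where "TH \<equiv> semidirect_top G T \<alpha> V"

lemma carrier_H: "carrier H = D \<times> UNIV"
  by (simp add: semidirect_def)

lemma mult_H: "(v, m) \<otimes>\<^bsub>H\<^esub> (w, n) = (v \<otimes> pw m w, m + n)"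
  by (simp add: semidirect_def)

lemma one_H: "\<one>\<^bsub>H\<^esub> = (\<one>, 0)"
  by (simp add: semidirect_def)

lemma group_H: "group H"
proof (rule groupI)
  fix x y assume "x \<in> carrier H" "y \<in> carrier H"
  then show "x \<otimes>\<^bsub>H\<^esub> y \<in> carrier H"
    by (auto simp: carrier_H mult_H intro!: D_mult pw_D)
next
  fix x y z assume "x \<in> carrier H" "y \<in> carrier H" "z \<in> carrier H"
  then show "x \<otimes>\<^bsub>H\<^esub> y \<otimes>\<^bsub>H\<^esub> z = x \<otimes>\<^bsub>H\<^esub> (y \<otimes>\<^bsub>H\<^esub> z)"
    by (auto simp: carrier_H mult_H D_carrier pw_mult pw_add m_assoc)
next
  fix x assume "x \<in> carrier H"
  then obtain v m where x: "x = (v, m)" "v \<in> D" by (auto simp: carrier_H)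
  have "(pw (- m) (inv v), - m) \<otimes>\<^bsub>H\<^esub> x = \<one>\<^bsub>H\<^esub>"
    using x by (simp add: mult_H one_H pw_mult[symmetric] D_carrier)
  moreover have "(pw (- m) (inv v), - m) \<in> carrier H" using x by (simp add: carrier_H pw_D D_inv)
  ultimately show "\<exists>y\<in>carrier H. y \<otimes>\<^bsub>H\<^esub> x = \<one>\<^bsub>H\<^esub>" by blast
qed (auto simp: carrier_H one_H D_one mult_H D_carrier)

sublocale H: group H by (rule group_H)

lemma inv_H: "v \<in> D \<Longrightarrow> inv\<^bsub>H\<^esub> (v, m) = (pw (- m) (inv v), - m)"
  by (rule H.inv_equality)
     (simp_all add: mult_H one_H pw_mult[symmetric] D_carrier carrier_H pw_D D_inv)

lemma topspace_TH: "topspace TH = carrier H"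
  using D_carrier by (auto simp: semidirect_top_def carrier_H topspace_T)

lemma Hausdorff_TH: "Hausdorff_space TH"
  using Hausdorff by (simp add: semidirect_top_def Hausdorff_space_prod_topology Hausdorff_space_subtopology)

lemma continuous_fst_TH: "continuous_map TH T fst"
proof -
  have "continuous_map TH (subtopology T D) fst" unfolding semidirect_top_def by (rule continuous_map_fst)
  then show ?thesis by (rule continuous_map_into_fulltopology)
qed

lemma continuous_snd_TH: "continuous_map TH (discrete_topology UNIV) snd"
  unfolding semidirect_top_def by (rule continuous_map_snd)

lemma continuous_into_TH:
  assumes "continuous_map X T (\<lambda>x. fst (f x))" "continuous_map X (discrete_topology UNIV) (\<lambda>x. snd (f x))"
    "\<And>x. x \<in> topspace X \<Longrightarrow> fst (f x) \<in> D"
  shows "continuous_map X TH f"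
  unfolding semidirect_top_def
  using assms by (subst continuous_map_pairwise) (auto simp: o_def continuous_map_in_subtopology)

text \<open>Continuity may be checked on the fibres of \<open>s\<close>, which are open.\<close>

lemma continuous_split_discrete:
  assumes s: "continuous_map X (discrete_topology UNIV) s" and f: "\<And>m. continuous_map X Y (f m)"
  shows "continuous_map X Y (\<lambda>x. f (s x) x)"
proof (rule pasting_lemma[where I = UNIV and T = "\<lambda>m. {x \<in> topspace X. s x \<in> {m}}" and f = f])
  fix m show "openin X {x \<in> topspace X. s x \<in> {m}}"
    by (rule openin_continuous_map_preimage[OF s]) simp
  show "continuous_map (subtopology X {x \<in> topspace X. s x \<in> {m}}) Y (f m)"
    using f by (rule continuous_map_from_subtopology)
qed auto

lemma continuous_mult_T:
  assumes "continuous_map X T f" "continuous_map X T g"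
  shows "continuous_map X T (\<lambda>x. f x \<otimes> g x)"
proof -
  have "continuous_map X (prod_topology T T) (\<lambda>x. (f x, g x))" using assms by (rule continuous_map_pairedI)
  from continuous_map_compose[OF this, of T "\<lambda>(x, y). x \<otimes> y"] show ?thesis
    using topological_group by (simp add: topological_group_def o_def)
qed

lemma topological_group_H: "topological_group H TH"
  unfolding topological_group_def
proof (intro conjI group_H topspace_TH)
  have D1: "fst p \<in> D" if "p \<in> topspace TH" for p using that by (auto simp: topspace_TH carrier_H)
  show "continuous_map (prod_topology TH TH) TH (\<lambda>(x, y). x \<otimes>\<^bsub>H\<^esub> y)"
  proof (rule continuous_into_TH)
    let ?X = "prod_topology TH TH"
    have s: "continuous_map ?X (discrete_topology UNIV) (\<lambda>p. snd (fst p))"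
      "continuous_map ?X (discrete_topology UNIV) (\<lambda>p. snd (snd p))"
      using continuous_map_compose[OF continuous_map_fst continuous_snd_TH]
        continuous_map_compose[OF continuous_map_snd continuous_snd_TH] by (simp_all add: o_def)
    have f: "continuous_map ?X T (\<lambda>p. fst (fst p))" "continuous_map ?X T (\<lambda>p. fst (snd p))"
      using continuous_map_compose[OF continuous_map_fst continuous_fst_TH]
        continuous_map_compose[OF continuous_map_snd continuous_fst_TH] by (simp_all add: o_def)
    have "continuous_map ?X T (\<lambda>p. fst (fst p) \<otimes> pw (snd (fst p)) (fst (snd p)))"
    proof (rule continuous_split_discrete[OF s(1), of T "\<lambda>m p. fst (fst p) \<otimes> pw m (fst (snd p))"])
      fix m show "continuous_map ?X T (\<lambda>p. fst (fst p) \<otimes> pw m (fst (snd p)))"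
        using continuous_map_compose[OF f(2) pw_continuous] by (intro continuous_mult_T f(1)) (simp add: o_def)
    qed
    then show "continuous_map ?X T (\<lambda>p. fst (case p of (x, y) \<Rightarrow> x \<otimes>\<^bsub>H\<^esub> y))"
      by (simp add: semidirect_def case_prod_unfold)
    have "continuous_map ?X (prod_topology (discrete_topology UNIV) (discrete_topology UNIV)) (\<lambda>p. (snd (fst p), snd (snd p)))"
      using s by (rule continuous_map_pairedI)
    from continuous_map_compose[OF this, of "discrete_topology UNIV" "\<lambda>(a, b). a + b"]
    show "continuous_map ?X (discrete_topology UNIV) (\<lambda>p. snd (case p of (x, y) \<Rightarrow> x \<otimes>\<^bsub>H\<^esub> y))"
      by (simp add: semidirect_def case_prod_unfold o_def prod_topology_discrete_topology[symmetric])
    show "fst (case p of (x, y) \<Rightarrow> x \<otimes>\<^bsub>H\<^esub> y) \<in> D" if "p \<in> topspace ?X" for p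
      using that by (auto simp: topspace_TH carrier_H mult_H intro!: D_mult pw_D)
  qed
  have ic: "continuous_map T T (\<lambda>x. inv x)" using topological_group by (simp add: topological_group_def)
  have "continuous_map TH TH (\<lambda>p. (pw (- snd p) (inv (fst p)), - snd p))"
  proof (rule continuous_into_TH)
    have "continuous_map TH T (\<lambda>p. pw (- snd p) (inv (fst p)))"
    proof (rule continuous_split_discrete[OF continuous_snd_TH, of T "\<lambda>m p. pw (- m) (inv (fst p))"])
      fix m show "continuous_map TH T (\<lambda>p. pw (- m) (inv (fst p)))"
        using continuous_map_compose[OF continuous_map_compose[OF continuous_fst_TH ic] pw_continuous] by (simp add: o_def)
    qed
    then show "continuous_map TH T (\<lambda>p. fst (pw (- snd p) (inv (fst p)), - snd p))" by simp
    show "continuous_map TH (discrete_topology UNIV) (\<lambda>p. snd (pw (- snd p) (inv (fst p)), - snd p))"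
      using continuous_map_compose[OF continuous_snd_TH, of "discrete_topology UNIV" uminus] by (simp add: o_def)
  qed (auto simp: topspace_TH carrier_H intro!: pw_D D_inv)
  then show "continuous_map TH TH (\<lambda>x. inv\<^bsub>H\<^esub> x)"
    by (rule continuous_map_eq) (auto simp: topspace_TH carrier_H inv_H)
qed

lemma closedin_TH_slab: "closedin TH (B k \<times> S)"
proof -
  have "closedin (subtopology T D) (B k)"
    using B_closed B_subset_D by (metis closedin_subset_topspace)
  then show ?thesis unfolding semidirect_top_def by (simp add: closedin_prod_Times_iff)
qed

lemma compactin_TH_slab: "compactin TH (K \<times> {m})" if "compactin T K" "K \<subseteq> D"
proof -
  have "compactin (subtopology T D) K" using that by (simp add: compactin_subtopology)
  then show ?thesis unfolding semidirect_top_def by (simp add: compactin_Times)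
qed

text \<open>The path in the tree from the base vertex \<open>o\<close> to \<open>g o\<close> first goes up, towards the end \<open>\<omega>\<close>, and then down.
  The ancestor of \<open>g o\<close> at level \<open>- p\<close> is represented by \<open>(fst g, - p)\<close> and that of \<open>o\<close> by \<open>(\<one>, - p)\<close>; they
  coincide when \<open>fst g\<close> lies in \<open>B (- p)\<close>. So \<open>climb\<close> is the number of steps up and \<open>descent\<close> the number of
  steps down.\<close>

definition climb :: "'a \<times> int \<Rightarrow> nat" where
  "climb g = (LEAST p. - snd g \<le> int p \<and> fst g \<in> B (- int p))"

definition descent :: "'a \<times> int \<Rightarrow> int" where
  "descent g = int (climb g) + snd g"

lemma climb_exists: "g \<in> carrier H \<Longrightarrow> \<exists>p. - snd g \<le> int p \<and> fst g \<in> B (- int p)"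
proof -
  assume "g \<in> carrier H"
  then obtain n where n: "fst g \<in> B (- int n)" by (auto simp: carrier_H elim: D_E)
  have "fst g \<in> B (- int (max n (nat (- snd g))))" 
    using n B_antimono[of "- int (max n (nat (- snd g)))" "- int n"] by auto
  then show ?thesis by (intro exI[of _ "max n (nat (- snd g))"]) auto
qed

lemma climb_spec: "g \<in> carrier H \<Longrightarrow> - snd g \<le> int (climb g) \<and> fst g \<in> B (- int (climb g))"
  unfolding climb_def by (rule LeastI_ex[OF climb_exists])

lemma climb_le_iff: "g \<in> carrier H \<Longrightarrow> climb g \<le> k \<longleftrightarrow> - snd g \<le> int k \<and> fst g \<in> B (- int k)"
proof
  assume g: "g \<in> carrier H" "climb g \<le> k"
  then show "- snd g \<le> int k \<and> fst g \<in> B (- int k)"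
    using climb_spec[OF g(1)] B_antimono[of "- int k" "- int (climb g)"] by auto
next
  assume "- snd g \<le> int k \<and> fst g \<in> B (- int k)"
  then show "climb g \<le> k" unfolding climb_def by (rule Least_le)
qed

lemma descent_nonneg: "g \<in> carrier H \<Longrightarrow> 0 \<le> descent g"
  using climb_spec[of g] by (simp add: descent_def)

text \<open>The common ancestor of \<open>o\<close> and \<open>g x o\<close> lies no higher than the higher one of the common ancestors of
  \<open>o\<close> and \<open>g o\<close>, at level \<open>- climb g\<close>, and of \<open>g o\<close> and \<open>g x o\<close>, at level \<open>snd g - climb x\<close>.\<close>

lemma climb_mult:
  assumes g: "g \<in> carrier H" and x: "x \<in> carrier H"
  shows "int (climb (g \<otimes>\<^bsub>H\<^esub> x)) \<le> max (int (climb g)) (int (climb x) - snd g)"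
proof -
  obtain w s where gs: "g = (w, s)" "w \<in> D" using g by (auto simp: carrier_H)
  obtain a t where xs: "x = (a, t)" "a \<in> D" using x by (auto simp: carrier_H)
  define k where "k = nat (max (int (climb g)) (int (climb x) - s))"
  have k: "int k = max (int (climb g)) (int (climb x) - s)" by (simp add: k_def)
  have 1: "w \<in> B (- int k)" using climb_spec[OF g] gs B_antimono[of "- int k" "- int (climb g)"] k by auto
  have "a \<in> B (- int (climb x))" using climb_spec[OF x] xs by simp
  then have "pw s a \<in> B (s - int (climb x))" using xs by (simp add: pw_in_B D_carrier)
  moreover have "- int k \<le> s - int (climb x)" using k by linarith
  ultimately have 2: "pw s a \<in> B (- int k)" using B_antimono by blast
  have "climb (g \<otimes>\<^bsub>H\<^esub> x) \<le> k"
  proof (subst climb_le_iff)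
    show "- snd (g \<otimes>\<^bsub>H\<^esub> x) \<le> int k \<and> fst (g \<otimes>\<^bsub>H\<^esub> x) \<in> B (- int k)"
      using climb_spec[OF x] k B_mult[OF 1 2] by (auto simp: gs xs mult_H)
  qed (simp add: g x)
  then show ?thesis using k gs by auto
qed

lemma climb_subadditive: "g \<in> carrier H \<Longrightarrow> x \<in> carrier H \<Longrightarrow> climb (g \<otimes>\<^bsub>H\<^esub> x) \<le> climb g + climb x"
  using climb_mult[of g x] climb_spec[of g] by auto

text \<open>Along the walk the descent is thus dominated by a reflected random walk with increments \<open>snd x\<close>.\<close>

lemma descent_mult:
  assumes g: "g \<in> carrier H" and x: "x \<in> carrier H"
  shows "descent (g \<otimes>\<^bsub>H\<^esub> x) \<le> max (descent g) (int (climb x)) + snd x"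
proof -
  have "snd (g \<otimes>\<^bsub>H\<^esub> x) = snd g + snd x" by (cases g, cases x) (simp add: mult_H)
  then show ?thesis using climb_mult[OF g x] unfolding descent_def by linarith
qed

lemma climb_one: "climb \<one>\<^bsub>H\<^esub> = 0"
proof -
  have "climb \<one>\<^bsub>H\<^esub> \<le> 0" by (subst climb_le_iff) (auto simp: one_H B_one carrier_H D_one)
  then show ?thesis by simp
qed

lemma real_climb_measurable: "(\<lambda>g. real (climb g)) \<in> borel_measurable (borel_of TH)"
  unfolding borel_measurable_iff_le
proof
  fix a
  have sp: "space (borel_of TH) = carrier H" by (simp add: space_borel_of topspace_TH)
  show "{g \<in> space (borel_of TH). real (climb g) \<le> a} \<in> sets (borel_of TH)"
  proof (cases "0 \<le> a")
    case True
    define N where "N = nat \<lfloor>a\<rfloor>"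
    have "{g \<in> space (borel_of TH). real (climb g) \<le> a} = B (- int N) \<times> {- int N..}"
    proof -
      have e: "real (climb g) \<le> a \<longleftrightarrow> climb g \<le> N" for g using True by (simp add: N_def le_nat_iff le_floor_iff)
      show ?thesis unfolding e sp using B_subset_D[of "- int N"]
        by (auto simp: climb_le_iff carrier_H)
    qed
    also have "\<dots> \<in> sets (borel_of TH)" by (rule closedin_borel_of[OF closedin_TH_slab])
    finally show ?thesis .
  next
    case False
    then have "{g \<in> space (borel_of TH). real (climb g) \<le> a} = {}" by (auto simp: not_le intro: less_le_trans)
    then show ?thesis by (simp only: sets.empty_sets)
  qed
qed

lemma snd_measurable: "snd \<in> measurable (borel_of TH) (count_space UNIV)"
proof (rule measurableI)
  fix A :: "int set"
  have "closedin TH {p \<in> topspace TH. snd p \<in> A}"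
    by (rule closedin_continuous_map_preimage[OF continuous_snd_TH]) simp
  from closedin_borel_of[OF this] show "snd -` A \<inter> space (borel_of TH) \<in> sets (borel_of TH)"
    by (simp add: space_borel_of vimage_def Int_def conj_commute)
qed simp

section \<open>The tree and its ends\<close>

lemma base_vertex_eq: "base_vertex G \<alpha> V = B 0 \<times> {0}"
  by (simp add: base_vertex_def V_minus_eq)

lemma vert_eq: "v \<in> D \<Longrightarrow> vert G \<alpha> V (v, m) = (v <# B m) \<times> {m}"
proof -
  assume v: "v \<in> D"
  have "vert G \<alpha> V (v, m) = (\<lambda>k. (v \<otimes> pw m k, m)) ` B 0"
    unfolding vert_def base_vertex_eq l_coset_def by (auto simp: mult_H)
  also have "\<dots> = (\<lambda>k. (v \<otimes> k, m)) ` (pw m ` B 0)" by (simp add: image_image)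
  also have "\<dots> = (v <# B m) \<times> {m}" unfolding pw_image_B l_coset_def by auto
  finally show ?thesis .
qed

lemma in_coset_B: "v \<in> carrier G \<Longrightarrow> w \<in> carrier G \<Longrightarrow> w \<in> v <# B m \<longleftrightarrow> inv v \<otimes> w \<in> B m"
proof
  assume v: "v \<in> carrier G" "w \<in> carrier G" "inv v \<otimes> w \<in> B m"
  then have "w = v \<otimes> (inv v \<otimes> w)" by (simp add: m_assoc[symmetric])
  then show "w \<in> v <# B m" using v unfolding l_coset_def by blast
next
  assume v: "v \<in> carrier G" "w \<in> v <# B m"
  then show "inv v \<otimes> w \<in> B m" unfolding l_coset_def by (auto simp: m_assoc[symmetric] B_carrier)
qed

lemma coset_B_eq: "v \<in> carrier G \<Longrightarrow> w \<in> carrier G \<Longrightarrow> inv v \<otimes> w \<in> B m \<Longrightarrow> v <# B m = w <# B m"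
  using B_subgroup in_coset_B by (metis l_repr_independence)

lemma vert_eq_iff:
  assumes "v \<in> D" "w \<in> D"
  shows "vert G \<alpha> V (v, m) = vert G \<alpha> V (w, n) \<longleftrightarrow> m = n \<and> inv v \<otimes> w \<in> B m"
proof
  assume eq: "vert G \<alpha> V (v, m) = vert G \<alpha> V (w, n)"
  have "w \<in> w <# B n" using assms(2) by (simp add: in_coset_B D_carrier B_one)
  then have "(w, n) \<in> vert G \<alpha> V (v, m)" unfolding eq by (simp add: vert_eq assms)
  then show "m = n \<and> inv v \<otimes> w \<in> B m" using assms by (auto simp: vert_eq in_coset_B D_carrier)
next
  assume a: "m = n \<and> inv v \<otimes> w \<in> B m"
  have "v <# B m = w <# B m" using a assms by (intro coset_B_eq) (auto simp: D_carrier)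
  then show "vert G \<alpha> V (v, m) = vert G \<alpha> V (w, n)" using a assms by (simp add: vert_eq)
qed

lemma tree_verts_iff: "x \<in> tree_verts G \<alpha> V \<longleftrightarrow> (\<exists>v m. v \<in> D \<and> x = vert G \<alpha> V (v, m))"
  unfolding tree_verts_def LCOSETS_def vert_def carrier_H by auto

lemma vert_in_tree_verts: "v \<in> D \<Longrightarrow> vert G \<alpha> V (v, m) \<in> tree_verts G \<alpha> V"
  unfolding tree_verts_iff by blast

lemma arc_iff: "(x, y) \<in> tree_arcs G \<alpha> V \<longleftrightarrow>
   (\<exists>v w m. v \<in> D \<and> w \<in> D \<and> x = vert G \<alpha> V (v, m) \<and> y = vert G \<alpha> V (w, m + 1) \<and> inv v \<otimes> w \<in> B m)"
proof
  assume "(x, y) \<in> tree_arcs G \<alpha> V"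
  then show "\<exists>v w m. v \<in> D \<and> w \<in> D \<and> x = vert G \<alpha> V (v, m) \<and> y = vert G \<alpha> V (w, m + 1) \<and> inv v \<otimes> w \<in> B m"
  proof -
    obtain v m w where a: "v \<in> D" "w \<in> D" "x = vert G \<alpha> V (v, m)" "y = vert G \<alpha> V (w, m + 1)" "w \<in> v <# B m"
      using \<open>(x, y) \<in> tree_arcs G \<alpha> V\<close> unfolding tree_arcs_def V_minus_eq pw_image_B add_0_right by blast
    have "inv v \<otimes> w \<in> B m" using a in_coset_B D_carrier by blast
    then show ?thesis using a by blast
  qed
next
  assume "\<exists>v w m. v \<in> D \<and> w \<in> D \<and> x = vert G \<alpha> V (v, m) \<and> y = vert G \<alpha> V (w, m + 1) \<and> inv v \<otimes> w \<in> B m"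
  then obtain v w m where a: "v \<in> D" "w \<in> D" "x = vert G \<alpha> V (v, m)" "y = vert G \<alpha> V (w, m + 1)" "inv v \<otimes> w \<in> B m"
    by blast
  then have "w \<in> v <# B m" by (simp add: in_coset_B D_carrier)
  then show "(x, y) \<in> tree_arcs G \<alpha> V"
    unfolding tree_arcs_def V_minus_eq pw_image_B using a
    by (intro CollectI exI[of _ v] exI[of _ m] exI[of _ w] exI[of _ "m + 1"]) simp
qed

lemma arc_up: "v \<in> D \<Longrightarrow> (vert G \<alpha> V (v, m), vert G \<alpha> V (v, m + 1)) \<in> tree_edges G \<alpha> V"
  and arc_down: "v \<in> D \<Longrightarrow> (vert G \<alpha> V (v, m + 1), vert G \<alpha> V (v, m)) \<in> tree_edges G \<alpha> V"
proof -
  assume v: "v \<in> D"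
  have "(vert G \<alpha> V (v, m), vert G \<alpha> V (v, m + 1)) \<in> tree_arcs G \<alpha> V"
    unfolding arc_iff using v B_one by (intro exI[of _ v] exI[of _ m]) (simp add: D_carrier)
  then show "(vert G \<alpha> V (v, m), vert G \<alpha> V (v, m + 1)) \<in> tree_edges G \<alpha> V"
    "(vert G \<alpha> V (v, m + 1), vert G \<alpha> V (v, m)) \<in> tree_edges G \<alpha> V" by (simp_all add: tree_edges_def)
qed

lemma path_up: "v \<in> D \<Longrightarrow> (vert G \<alpha> V (v, m), vert G \<alpha> V (v, m + int k)) \<in> tree_edges G \<alpha> V ^^ k"
proof (induction k)
  case (Suc k)
  have "(vert G \<alpha> V (v, m + int k), vert G \<alpha> V (v, m + int k + 1)) \<in> tree_edges G \<alpha> V"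
    using Suc(2) by (rule arc_up)
  then show ?case using Suc by (auto simp: add.assoc add.commute[of 1])
qed simp

lemma path_down: "v \<in> D \<Longrightarrow> (vert G \<alpha> V (v, m + int k), vert G \<alpha> V (v, m)) \<in> tree_edges G \<alpha> V ^^ k"
proof (induction k)
  case (Suc k)
  have "(vert G \<alpha> V (v, m + int k + 1), vert G \<alpha> V (v, m + int k)) \<in> tree_edges G \<alpha> V"
    using Suc(2) by (rule arc_down)
  moreover have "m + int (Suc k) = m + int k + 1" by simp
  ultimately show ?case using Suc relpow_Suc_I2 by metis
qed simp

text \<open>An edge changes the level by one and the representative by a factor from \<open>B\<close> of the higher of its two
  levels. A path of length \<open>n\<close> from the base vertex never rises above level \<open>- n\<close>, so all these factors lie in
  \<open>B (- n)\<close>.\<close>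

lemma path_level_climb:
  assumes "(vert G \<alpha> V (\<one>, 0), x) \<in> tree_edges G \<alpha> V ^^ n"
  shows "\<exists>w s. w \<in> D \<and> x = vert G \<alpha> V (w, s) \<and> \<bar>s\<bar> \<le> int n \<and> w \<in> B (- int n)"
  using assms
proof (induction n arbitrary: x)
  case 0
  then show ?case using B_one D_one by (intro exI[of _ \<one>] exI[of _ 0]) simp
next
  case (Suc n)
  then obtain y where y: "(vert G \<alpha> V (\<one>, 0), y) \<in> tree_edges G \<alpha> V ^^ n" "(y, x) \<in> tree_edges G \<alpha> V" by auto
  obtain v s where v: "v \<in> D" "y = vert G \<alpha> V (v, s)" "\<bar>s\<bar> \<le> int n" "v \<in> B (- int n)" using Suc.IH[OF y(1)] by blast
  have step: "\<exists>w s. w \<in> D \<and> x = vert G \<alpha> V (w, s) \<and> \<bar>s\<bar> \<le> int (Suc n) \<and> w \<in> B (- int (Suc n))"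
    if w: "w \<in> D" "x = vert G \<alpha> V (w, t)" "\<bar>t - s\<bar> \<le> 1" "inv v \<otimes> w \<in> B (s - 1)" for w t
  proof -
    have "v \<in> B (- int (Suc n))" "inv v \<otimes> w \<in> B (- int (Suc n))"
      using subsetD[OF B_antimono[of "- int (Suc n)" "- int n"] v(4)]
        subsetD[OF B_antimono[of "- int (Suc n)" "s - 1"] w(4)] v(3) by linarith+
    then have "v \<otimes> (inv v \<otimes> w) \<in> B (- int (Suc n))" by (rule B_mult)
    then have "w \<in> B (- int (Suc n))" using v(1) w(1) by (simp add: m_assoc[symmetric] D_carrier)
    then show ?thesis using w v(3) by (intro exI[of _ w] exI[of _ t]) auto
  qed
  from y(2) consider "(y, x) \<in> tree_arcs G \<alpha> V" | "(x, y) \<in> tree_arcs G \<alpha> V" by (auto simp: tree_edges_def)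
  then show ?case
  proof cases
    case 1
    then obtain v' w m where a: "v' \<in> D" "w \<in> D" "y = vert G \<alpha> V (v', m)" "x = vert G \<alpha> V (w, m + 1)" "inv v' \<otimes> w \<in> B m"
      unfolding arc_iff by blast
    have eq: "s = m" "inv v \<otimes> v' \<in> B s" using a(3) v vert_eq_iff[OF v(1) a(1)] by auto
    have "(inv v \<otimes> v') \<otimes> (inv v' \<otimes> w) \<in> B s" using eq a(5) B_mult[of "inv v \<otimes> v'" s "inv v' \<otimes> w"] by simp
    moreover have "(inv v \<otimes> v') \<otimes> (inv v' \<otimes> w) = inv v \<otimes> w"
    proof -
      have "v' \<otimes> (inv v' \<otimes> w) = w" using a by (simp add: m_assoc[symmetric] D_carrier)
      then show ?thesis using a v by (simp add: m_assoc D_carrier)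
    qed
    ultimately show ?thesis using a eq B_antimono[of "s - 1" s] by (intro step[of w "m + 1"]) auto
  next
    case 2
    then obtain v' w m where a: "v' \<in> D" "w \<in> D" "x = vert G \<alpha> V (v', m)" "y = vert G \<alpha> V (w, m + 1)" "inv v' \<otimes> w \<in> B m"
      unfolding arc_iff by blast
    have eq: "s = m + 1" "inv v \<otimes> w \<in> B s" using a(4) v vert_eq_iff[OF v(1) a(2)] by auto
    have "inv v \<otimes> w \<in> B m" using eq B_antimono[of m s] by auto
    moreover have "inv (inv v' \<otimes> w) \<in> B m" using a(5) by (rule B_inv)
    ultimately have "(inv v \<otimes> w) \<otimes> inv (inv v' \<otimes> w) \<in> B m" by (rule B_mult)
    moreover have "(inv v \<otimes> w) \<otimes> inv (inv v' \<otimes> w) = inv v \<otimes> v'"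
    proof -
      have "w \<otimes> (inv w \<otimes> v') = v'" using a by (simp add: m_assoc[symmetric] D_carrier)
      then show ?thesis using a v by (simp add: m_assoc D_carrier inv_mult_group)
    qed
    ultimately show ?thesis using a eq by (intro step[of v' m]) auto
  qed
qed

lemma tree_act_vert: "h \<in> carrier H \<Longrightarrow> x \<in> tree_verts G \<alpha> V \<Longrightarrow> tree_act G \<alpha> V h x = h <#\<^bsub>H\<^esub> x"
  by (simp add: tree_act_def)

lemma base_vertex_vert: "base_vertex G \<alpha> V = vert G \<alpha> V (\<one>, 0)"
  using D_one B_carrier by (simp add: vert_eq base_vertex_eq lcos_mult_one subset_iff)

lemma act_vert:
  assumes "a \<in> D" "v \<in> D"
  shows "(a, k) <#\<^bsub>H\<^esub> vert G \<alpha> V (v, m) = vert G \<alpha> V (a \<otimes> pw k v, k + m)"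
proof -
  have "base_vertex G \<alpha> V \<subseteq> carrier H" using B_subset_D by (auto simp: base_vertex_eq carrier_H)
  then have "(a, k) <#\<^bsub>H\<^esub> vert G \<alpha> V (v, m) = ((a, k) \<otimes>\<^bsub>H\<^esub> (v, m)) <#\<^bsub>H\<^esub> base_vertex G \<alpha> V"
    unfolding vert_def using assms by (intro H.lcos_m_assoc) (auto simp: carrier_H)
  then show ?thesis by (simp add: vert_def mult_H)
qed

lemma climb_le_tree_length:
  assumes g: "g \<in> carrier H"
  shows "climb g \<le> tree_length G \<alpha> V g" "\<bar>snd g\<bar> \<le> int (tree_length G \<alpha> V g)"
proof -
  obtain w s where gs: "g = (w, s)" "w \<in> D" using g by (auto simp: carrier_H)
  have im: "tree_act G \<alpha> V g (base_vertex G \<alpha> V) = vert G \<alpha> V (w, s)"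
    using g gs D_one unfolding base_vertex_vert
    by (subst tree_act_vert) (auto simp: tree_verts_iff act_vert D_carrier)
  define p where "p = climb g"
  have p: "w \<in> B (- int p)" "- s \<le> int p" using climb_spec[OF g] gs by (auto simp: p_def)
  have "(vert G \<alpha> V (\<one>, - int p + int p), vert G \<alpha> V (\<one>, - int p)) \<in> tree_edges G \<alpha> V ^^ p"
    using D_one by (rule path_down)
  moreover have "vert G \<alpha> V (\<one>, - int p) = vert G \<alpha> V (w, - int p)"
    using gs D_one p by (simp add: vert_eq_iff D_carrier)
  moreover have "(vert G \<alpha> V (w, - int p), vert G \<alpha> V (w, - int p + int (nat (s + int p)))) \<in> tree_edges G \<alpha> V ^^ nat (s + int p)"
    using gs(2) by (rule path_up)
  ultimately have "(vert G \<alpha> V (\<one>, 0), vert G \<alpha> V (w, s)) \<in> tree_edges G \<alpha> V ^^ (p + nat (s + int p))"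
    using p(2) by (auto simp: relpow_add)
  then have "(base_vertex G \<alpha> V, tree_act G \<alpha> V g (base_vertex G \<alpha> V)) \<in> tree_edges G \<alpha> V ^^ tree_length G \<alpha> V g"
    unfolding tree_length_def gdist_def im[symmetric] base_vertex_vert[symmetric] by (rule LeastI)
  then have "(vert G \<alpha> V (\<one>, 0), vert G \<alpha> V (w, s)) \<in> tree_edges G \<alpha> V ^^ tree_length G \<alpha> V g"
    unfolding im unfolding base_vertex_vert .
  from path_level_climb[OF this] obtain w' s' where w': "w' \<in> D" "vert G \<alpha> V (w, s) = vert G \<alpha> V (w', s')"
    "\<bar>s'\<bar> \<le> int (tree_length G \<alpha> V g)" "w' \<in> B (- int (tree_length G \<alpha> V g))"
    by (elim exE conjE)
  have e: "s = s'" "inv w \<otimes> w' \<in> B s" using w'(2) vert_eq_iff[OF gs(2) w'(1)] by auto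
  then show 1: "\<bar>snd g\<bar> \<le> int (tree_length G \<alpha> V g)" using w' gs by simp
  let ?k = "tree_length G \<alpha> V g"
  have "inv w \<otimes> w' \<in> B (- int ?k)" proof -
    have "- int ?k \<le> s" using 1 gs by simp
    then show ?thesis using e(2) B_antimono by blast
  qed
  then have "w' \<otimes> inv (inv w \<otimes> w') \<in> B (- int ?k)" by (rule B_mult[OF w'(4) B_inv])
  moreover have "w' \<otimes> inv (inv w \<otimes> w') = w"
    using gs(2) w'(1) by (simp add: inv_mult_group D_carrier m_assoc[symmetric])
  ultimately have "w \<in> B (- int ?k)" by simp
  then show "climb g \<le> ?k" using 1 gs by (subst climb_le_iff[OF g]) auto
qed

lemma path_level:
  assumes "(vert G \<alpha> V (v, m), x) \<in> tree_edges G \<alpha> V ^^ n" "v \<in> D" "x = vert G \<alpha> V (w, s)" "w \<in> D"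
  shows "\<bar>s - m\<bar> \<le> int n"
  using assms
proof (induction n arbitrary: x w s)
  case 0
  then show ?case by (simp add: vert_eq_iff)
next
  case (Suc n)
  then obtain y where y: "(vert G \<alpha> V (v, m), y) \<in> tree_edges G \<alpha> V ^^ n" "(y, x) \<in> tree_edges G \<alpha> V" by auto
  obtain a t b t' where a: "a \<in> D" "b \<in> D" "y = vert G \<alpha> V (a, t)" "x = vert G \<alpha> V (b, t')" "\<bar>t' - t\<bar> = 1"
    using y(2) unfolding tree_edges_def by (auto simp: arc_iff)
  have "\<bar>t - m\<bar> \<le> int n" using Suc.IH[OF y(1) Suc.prems(2) a(3,1)] .
  moreover have "t' = s" using a Suc.prems by (simp add: vert_eq_iff)
  ultimately show ?case using a(5) by linarith
qed

text \<open>A point \<open>u\<close> of \<open>V\<^sub>-\<^sub>-\<close> determines an end other than \<open>\<omega>\<close>, through the descending sequence of cosets of \<open>u\<close>.\<close>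

abbreviation branch :: "'a \<Rightarrow> nat \<Rightarrow> ('a \<times> int) set" where
  "branch u n \<equiv> vert G \<alpha> V (u, int n)"

lemma branch_geodesic: "u \<in> D \<Longrightarrow> branch u \<in> geodesic_rays (tree_verts G \<alpha> V) (tree_edges G \<alpha> V)"
  unfolding geodesic_rays_def
proof (intro CollectI conjI allI impI)
  assume u: "u \<in> D"
  show "range (branch u) \<subseteq> tree_verts G \<alpha> V" using u by (auto intro: vert_in_tree_verts)
  fix i j :: nat assume ij: "i \<le> j"
  have p: "(branch u i, branch u j) \<in> tree_edges G \<alpha> V ^^ (j - i)"
    using path_up[OF u, of "int i" "j - i"] ij by (simp add: of_nat_diff)
  then show "(branch u i, branch u j) \<in> (tree_edges G \<alpha> V)\<^sup>*" by (rule relpow_imp_rtrancl)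
  show "gdist (tree_edges G \<alpha> V) (branch u i) (branch u j) = j - i"
    unfolding gdist_def
  proof (rule Least_equality)
    show "(branch u i, branch u j) \<in> tree_edges G \<alpha> V ^^ (j - i)" by (rule p)
    fix n assume "(branch u i, branch u j) \<in> tree_edges G \<alpha> V ^^ n"
    from path_level[OF this u refl u] show "j - i \<le> n" by linarith
  qed
qed

lemma act_edge:
  assumes h: "h \<in> carrier H" and e: "(x, y) \<in> tree_edges G \<alpha> V"
  shows "(tree_act G \<alpha> V h x, tree_act G \<alpha> V h y) \<in> tree_edges G \<alpha> V"
proof -
  obtain a k where ak: "h = (a, k)" "a \<in> D" using h by (auto simp: carrier_H)
  have arc: "(tree_act G \<alpha> V h x, tree_act G \<alpha> V h y) \<in> tree_arcs G \<alpha> V" if xy: "(x, y) \<in> tree_arcs G \<alpha> V" for x y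
  proof -
    obtain v w m where a: "v \<in> D" "w \<in> D" "x = vert G \<alpha> V (v, m)" "y = vert G \<alpha> V (w, m + 1)" "inv v \<otimes> w \<in> B m"
      using xy unfolding arc_iff by blast
    have xv: "x \<in> tree_verts G \<alpha> V" "y \<in> tree_verts G \<alpha> V" using a by (auto simp: tree_verts_iff)
    have "inv (a \<otimes> pw k v) \<otimes> (a \<otimes> pw k w) = pw k (inv v \<otimes> w)"
      using a ak by (simp add: D_carrier inv_mult_group pw_mult pw_inv m_assoc) (simp add: D_carrier m_assoc[symmetric])
    then have "inv (a \<otimes> pw k v) \<otimes> (a \<otimes> pw k w) \<in> B (k + m)"
      using a(5) pw_image_B[of k m] by auto
    moreover have "tree_act G \<alpha> V h x = vert G \<alpha> V (a \<otimes> pw k v, k + m)"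
      unfolding tree_act_vert[OF h xv(1)] unfolding a(3) ak(1) by (rule act_vert[OF ak(2) a(1)])
    moreover have "tree_act G \<alpha> V h y = vert G \<alpha> V (a \<otimes> pw k w, k + m + 1)"
      unfolding tree_act_vert[OF h xv(2)] unfolding a(4) ak(1) using act_vert[OF ak(2) a(2)] by (simp add: add.assoc)
    moreover have "a \<otimes> pw k v \<in> D" "a \<otimes> pw k w \<in> D" using a ak by (auto intro!: D_mult pw_D)
    ultimately show ?thesis unfolding arc_iff by blast
  qed
  then show ?thesis using e by (auto simp: tree_edges_def)
qed

lemma act_closed: "h \<in> carrier H \<Longrightarrow> x \<in> tree_verts G \<alpha> V \<Longrightarrow> tree_act G \<alpha> V h x \<in> tree_verts G \<alpha> V"
proof -
  assume h: "h \<in> carrier H" and x: "x \<in> tree_verts G \<alpha> V"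
  obtain a k v m where "h = (a, k)" "a \<in> D" "v \<in> D" "x = vert G \<alpha> V (v, m)"
    using h x by (auto simp: carrier_H tree_verts_iff)
  then show ?thesis using tree_act_vert[OF h x] by (auto simp: act_vert tree_verts_iff intro!: D_mult pw_D)
qed

lemma act_inverse: "h \<in> carrier H \<Longrightarrow> x \<in> tree_verts G \<alpha> V \<Longrightarrow> tree_act G \<alpha> V (inv\<^bsub>H\<^esub> h) (tree_act G \<alpha> V h x) = x"
proof -
  assume h: "h \<in> carrier H" and x: "x \<in> tree_verts G \<alpha> V"
  have xs: "x \<subseteq> carrier H"
  proof -
    obtain v m where v: "v \<in> D" "x = (v <# B m) \<times> {m}" using x by (auto simp: tree_verts_iff vert_eq)
    have "v \<otimes> k \<in> D" if "k \<in> B m" for k using that v(1) B_subset_D by (blast intro: D_mult)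
    then show ?thesis unfolding v(2) carrier_H l_coset_def by blast
  qed
  show ?thesis
    using h xs x act_closed[OF h x] by (simp add: tree_act_vert H.lcos_m_assoc H.lcos_mult_one)
qed

lemma act_path:
  assumes h: "h \<in> carrier H" and e: "(x, y) \<in> tree_edges G \<alpha> V ^^ n"
  shows "(tree_act G \<alpha> V h x, tree_act G \<alpha> V h y) \<in> tree_edges G \<alpha> V ^^ n"
  using e by (induction n arbitrary: y) (auto intro: act_edge[OF h])

lemma act_gdist:
  assumes h: "h \<in> carrier H" and x: "x \<in> tree_verts G \<alpha> V" "y \<in> tree_verts G \<alpha> V"
  shows "gdist (tree_edges G \<alpha> V) (tree_act G \<alpha> V h x) (tree_act G \<alpha> V h y) = gdist (tree_edges G \<alpha> V) x y"
proof -
  have "(tree_act G \<alpha> V h x, tree_act G \<alpha> V h y) \<in> tree_edges G \<alpha> V ^^ n \<longleftrightarrow> (x, y) \<in> tree_edges G \<alpha> V ^^ n" for n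
    using act_path[OF h, of x y n] act_path[of "inv\<^bsub>H\<^esub> h" "tree_act G \<alpha> V h x" "tree_act G \<alpha> V h y" n]
      act_inverse[OF h x(1)] act_inverse[OF h x(2)] h by auto
  then show ?thesis by (simp add: gdist_def)
qed

lemma act_geodesic:
  assumes h: "h \<in> carrier H" and r: "r \<in> geodesic_rays (tree_verts G \<alpha> V) (tree_edges G \<alpha> V)"
  shows "tree_act G \<alpha> V h \<circ> r \<in> geodesic_rays (tree_verts G \<alpha> V) (tree_edges G \<alpha> V)"
proof -
  have rv: "r i \<in> tree_verts G \<alpha> V" for i using r by (auto simp: geodesic_rays_def)
  have path: "(tree_act G \<alpha> V h (r i), tree_act G \<alpha> V h (r j)) \<in> (tree_edges G \<alpha> V)\<^sup>*" if "i \<le> j" for i j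
  proof -
    have "(r i, r j) \<in> (tree_edges G \<alpha> V)\<^sup>*" using r that by (auto simp: geodesic_rays_def)
    then obtain n where "(r i, r j) \<in> tree_edges G \<alpha> V ^^ n" using rtrancl_imp_relpow by blast
    from act_path[OF h this] show ?thesis by (rule relpow_imp_rtrancl)
  qed
  then show ?thesis using r rv act_closed[OF h rv] by (auto simp: geodesic_rays_def act_gdist[OF h rv rv])
qed

text \<open>The assumption says that \<open>\<Gamma>\<close> fixes the point \<open>u\<close> under its affine action, up to every \<open>B m\<close>. Each element
  of \<open>\<Gamma>\<close> then shifts the branch of \<open>u\<close> along itself and so fixes its end. This end is not \<open>\<omega>\<close>: the ray to
  \<open>\<omega>\<close> goes up, the branch goes down, and they share at most one vertex.\<close>

lemma fixed_point_imp_exceptional: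
  assumes \<Gamma>: "subgroup \<Gamma> H" and u: "u \<in> D"
    and fix_u: "\<And>w z m. (w, z) \<in> \<Gamma> \<Longrightarrow> inv u \<otimes> (w \<otimes> pw z u) \<in> B m"
  shows "\<not> non_exceptional G \<alpha> V \<Gamma>"
proof -
  let ?X = "tree_verts G \<alpha> V" and ?E = "tree_edges G \<alpha> V"
  define \<xi> where "\<xi> = ray_equiv ?X ?E `` {branch u}"
  have geo: "branch u \<in> geodesic_rays ?X ?E" using u by (rule branch_geodesic)
  have inj: "inj (branch u)" using u by (auto intro!: injI simp: vert_eq_iff)
  have inf: "infinite (range (branch u))" using inj by (simp add: finite_image_iff)
  have \<xi>_iff: "s \<in> \<xi> \<longleftrightarrow> s \<in> geodesic_rays ?X ?E \<and> infinite (range (branch u) \<inter> range s)" for s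
    using geo by (simp add: \<xi>_def ray_equiv_def)
  have act_branch: "tree_act G \<alpha> V h (branch u n) = vert G \<alpha> V (u, snd h + int n)" if h: "h \<in> \<Gamma>" for h n
  proof -
    obtain w z where hz: "h = (w, z)" by (cases h)
    have hc: "h \<in> carrier H" using h subgroup.subset[OF \<Gamma>] by blast
    have w: "w \<in> D" using hc hz by (simp add: carrier_H)
    have "branch u n \<in> ?X" using u by (rule vert_in_tree_verts)
    then have "tree_act G \<alpha> V h (branch u n) = vert G \<alpha> V (w \<otimes> pw z u, z + int n)"
      using tree_act_vert[OF hc] act_vert[OF w u] hz by simp
    also have "\<dots> = vert G \<alpha> V (u, z + int n)"
      using u w fix_u[of w z "z + int n"] h hz by (subst eq_commute, subst vert_eq_iff) (auto intro!: D_mult pw_D)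
    finally show ?thesis using hz by simp
  qed
  have maps: "tree_act G \<alpha> V h \<circ> s \<in> \<xi>" if h: "h \<in> \<Gamma>" and s: "s \<in> \<xi>" for h s
  proof -
    let ?\<gamma> = "tree_act G \<alpha> V h"
    have hc: "h \<in> carrier H" using h subgroup.subset[OF \<Gamma>] by blast
    have sg: "s \<in> geodesic_rays ?X ?E" and si: "infinite (range (branch u) \<inter> range s)" using s by (auto simp: \<xi>_iff)
    define S where "S = range (branch u) \<inter> range s - branch u ` {n. n < nat \<bar>snd h\<bar>}"
    have "infinite S" unfolding S_def using si by (intro Diff_infinite_finite) auto
    moreover have "inj_on ?\<gamma> S"
    proof (rule inj_on_inverseI)
      fix x assume "x \<in> S"
      then have "x \<in> ?X" using u by (auto simp: S_def intro: vert_in_tree_verts)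
      then show "tree_act G \<alpha> V (inv\<^bsub>H\<^esub> h) (?\<gamma> x) = x" by (rule act_inverse[OF hc])
    qed
    ultimately have "infinite (?\<gamma> ` S)" by (simp add: finite_image_iff)
    moreover have "?\<gamma> ` S \<subseteq> range (branch u) \<inter> range (?\<gamma> \<circ> s)"
    proof
      fix y assume "y \<in> ?\<gamma> ` S"
      then obtain x where x: "x \<in> S" "y = ?\<gamma> x" by blast
      then obtain n where n: "x = branch u n" "\<not> n < nat \<bar>snd h\<bar>" by (auto simp: S_def)
      have "snd h + int n = int (nat (snd h + int n))" using n(2) by auto
      then have "y = branch u (nat (snd h + int n))" using x(2) n(1) act_branch[OF h, of n] by simp
      moreover have "y \<in> range (?\<gamma> \<circ> s)" using x by (auto simp: S_def)
      ultimately show "y \<in> range (branch u) \<inter> range (?\<gamma> \<circ> s)" by blast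
    qed
    ultimately have "infinite (range (branch u) \<inter> range (?\<gamma> \<circ> s))" using finite_subset by blast
    then show ?thesis using act_geodesic[OF hc sg] by (simp add: \<xi>_iff)
  qed
  have fixed: "end_act \<gamma> \<xi> = \<xi>" if \<gamma>: "\<gamma> \<in> tree_act G \<alpha> V ` \<Gamma>" for \<gamma>
  proof -
    obtain h where h: "h \<in> \<Gamma>" "\<gamma> = tree_act G \<alpha> V h" using \<gamma> by blast
    have hc: "h \<in> carrier H" using h subgroup.subset[OF \<Gamma>] by blast
    have ih: "inv\<^bsub>H\<^esub> h \<in> \<Gamma>" using h subgroup.m_inv_closed[OF \<Gamma>] by blast
    show ?thesis
    proof
      show "end_act \<gamma> \<xi> \<subseteq> \<xi>" using maps[OF h(1)] h(2) by (auto simp: end_act_def)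
      show "\<xi> \<subseteq> end_act \<gamma> \<xi>"
      proof
        fix s assume s: "s \<in> \<xi>"
        have sX: "s i \<in> ?X" for i using s by (auto simp: \<xi>_iff geodesic_rays_def)
        have "s = \<gamma> \<circ> (tree_act G \<alpha> V (inv\<^bsub>H\<^esub> h) \<circ> s)"
          using act_inverse[of "inv\<^bsub>H\<^esub> h"] hc sX h(2) by (auto simp: o_def)
        then show "s \<in> end_act \<gamma> \<xi>" unfolding end_act_def using maps[OF ih s] by blast
      qed
    qed
  qed
  have "\<xi> \<in> ends ?X ?E" unfolding ends_def \<xi>_def using geo by (rule quotientI)
  moreover have "\<xi> \<noteq> omega_end G \<alpha> V"
  proof
    assume "\<xi> = omega_end G \<alpha> V"
    moreover have "branch u \<in> \<xi>" using geo inf by (simp add: \<xi>_iff)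
    ultimately have "infinite (range (\<lambda>n. vert G \<alpha> V (\<one>, - int n)) \<inter> range (branch u))"
      by (auto simp: omega_end_def ray_equiv_def)
    moreover have "range (\<lambda>n. vert G \<alpha> V (\<one>, - int n)) \<inter> range (branch u) \<subseteq> {branch u 0}"
    proof
      fix x assume "x \<in> range (\<lambda>n. vert G \<alpha> V (\<one>, - int n)) \<inter> range (branch u)"
      then obtain i j where ij: "x = vert G \<alpha> V (\<one>, - int i)" "x = branch u j" by blast
      then have "- int i = int j" using vert_eq_iff[OF D_one u] by metis
      then show "x \<in> {branch u 0}" using ij by simp
    qed
    ultimately show False by (meson finite.emptyI finite_insert finite_subset)
  qed
  ultimately have "\<exists>\<xi>\<in>ends ?X ?E. \<xi> \<noteq> omega_end G \<alpha> V \<and> (\<forall>\<gamma>\<in>tree_act G \<alpha> V ` \<Gamma>. end_act \<gamma> \<xi> = \<xi>)"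
    using fixed by (intro bexI[of _ \<xi>] conjI ballI)
  then show ?thesis unfolding non_exceptional_def exceptional_def not_not by (rule disjI2)
qed

end

section \<open>Nonpositive mean\<close>

locale tdlc_walk = tdlc_automorphism +
  fixes \<mu> :: "('a \<times> int) measure" and \<Gamma> :: "('a \<times> int) set"
  assumes second_countable_TH: "second_countable TH" and borel_prob_\<mu>: "borel_prob TH \<mu>"
    and subgroup_\<Gamma>: "subgroup \<Gamma> H" and closed_\<Gamma>: "closedin TH \<Gamma>"
    and AE_\<Gamma>: "AE x in \<mu>. x \<in> \<Gamma>" and moment: "finite_first_moment G \<alpha> V \<mu>"
begin

sublocale R: random_walk_in_subgroup H TH \<mu> \<Gamma>
  using topological_group_H second_countable_TH borel_prob_\<mu> subgroup_\<Gamma> closed_\<Gamma> AE_\<Gamma>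
  by (intro random_walk_in_subgroup.intro random_walk.intro random_walk_in_subgroup_axioms.intro)

lemma climb_measurable [measurable]: "(\<lambda>g. real (climb g)) \<in> borel_measurable \<mu>"
  and snd_measurable' [measurable]: "(\<lambda>g. real_of_int (snd g)) \<in> borel_measurable \<mu>"
  using real_climb_measurable measurable_compose[OF snd_measurable, of real_of_int borel]
  by (simp_all cong: measurable_cong_sets)

lemma integrable_climb: "integrable \<mu> (\<lambda>g. real (climb g))"
  and integrable_snd: "integrable \<mu> (\<lambda>g. real_of_int (snd g))"
proof -
  have fin: "(\<integral>\<^sup>+ g. ennreal (real (tree_length G \<alpha> V g)) \<partial>\<mu>) < \<infinity>"
    using moment by (simp add: finite_first_moment_def)
  have "(\<integral>\<^sup>+ g. ennreal (real (climb g)) \<partial>\<mu>) \<le> (\<integral>\<^sup>+ g. ennreal (real (tree_length G \<alpha> V g)) \<partial>\<mu>)"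
    using climb_le_tree_length(1) by (intro nn_integral_mono ennreal_leI) simp
  then show "integrable \<mu> (\<lambda>g. real (climb g))"
    using fin by (intro integrableI_bounded) auto
  have "(\<integral>\<^sup>+ g. ennreal \<bar>real_of_int (snd g)\<bar> \<partial>\<mu>) \<le> (\<integral>\<^sup>+ g. ennreal (real (tree_length G \<alpha> V g)) \<partial>\<mu>)"
  proof (intro nn_integral_mono ennreal_leI)
    fix g assume "g \<in> space \<mu>"
    then have "\<bar>snd g\<bar> \<le> int (tree_length G \<alpha> V g)" using climb_le_tree_length(2)[of g] by simp
    then show "\<bar>real_of_int (snd g)\<bar> \<le> real (tree_length G \<alpha> V g)" by linarith
  qed
  then show "integrable \<mu> (\<lambda>g. real_of_int (snd g))"
    using fin by (intro integrableI_bounded) auto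
qed

lemma mean_eq: "(\<integral>z. real_of_int z \<partial>distr \<mu> (count_space UNIV) eta) = (\<integral>g. real_of_int (snd g) \<partial>\<mu>)"
proof -
  have "eta \<in> measurable \<mu> (count_space UNIV)"
    using snd_measurable by (simp add: eta_def cong: measurable_cong_sets)
  then show ?thesis by (subst integral_distr) (auto simp: eta_def)
qed

lemma slabs_cover: "countable (range (\<lambda>(n::nat, m::int). B (- int n) \<times> {m}))"
  "\<And>C. C \<in> range (\<lambda>(n::nat, m::int). B (- int n) \<times> {m}) \<Longrightarrow> compactin TH C"
  "carrier H \<subseteq> \<Union>(range (\<lambda>(n::nat, m::int). B (- int n) \<times> {m}))"
proof -
  show "countable (range (\<lambda>(n::nat, m::int). B (- int n) \<times> {m}))" by (rule countable_image[OF countableI_type])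
qed (auto simp: carrier_H intro!: compactin_TH_slab B_compact elim!: D_E dest: subsetD[OF B_subset_D])

text \<open>An open subgroup of \<open>V\<^sub>-\<close> suffices here because the second factor of the semidirect product is discrete.\<close>

lemma small_subgroup:
  assumes U: "openin TH U" "\<one>\<^bsub>H\<^esub> \<in> U"
  obtains K0 where "subgroup K0 G" "K0 \<subseteq> B 0" "openin (subtopology T (B 0)) K0" "K0 \<times> {0} \<subseteq> U"
proof -
  have "continuous_map (subtopology T D) TH (\<lambda>v. (v, 0))"
    unfolding semidirect_top_def by (intro continuous_map_pairedI) auto
  from openin_continuous_map_preimage[OF this U(1)]
  have "openin (subtopology T D) {v \<in> D. (v, 0) \<in> U}" using D_carrier by (simp add: topspace_T) (metis (no_types, lifting) Collect_cong)
  then obtain Q where Q: "openin T Q" "{v \<in> D. (v, 0) \<in> U} = Q \<inter> D" unfolding openin_subtopology by blast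
  have "\<one> \<in> Q" using Q(2) U(2) D_one by (auto simp: one_H)
  then obtain K0 where K0: "subgroup K0 G" "K0 \<subseteq> B 0 \<inter> Q" "openin (subtopology T (B 0)) K0"
    using compact_subgroup_small_open_subgroup[OF topological_group Hausdorff totally_disconnected B_subgroup B_compact Q(1)]
    by metis
  moreover have "K0 \<times> {0} \<subseteq> U" using K0(2) Q(2) B_subset_D[of 0] by blast
  ultimately show ?thesis using that by blast
qed

lemma nn_integral_geometric:
  assumes "0 \<le> r" "r < (1::real)"
  shows "(\<integral>\<^sup>+ n. ennreal (r ^ n) \<partial>count_space UNIV) = ennreal (1 / (1 - r))"
proof -
  have "(\<integral>\<^sup>+ n. ennreal (r ^ n) \<partial>count_space UNIV) = (\<Sum>n. ennreal (r ^ n))"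
    by (rule nn_integral_count_space_nat)
  also have "\<dots> = ennreal (\<Sum>n. r ^ n)"
    using assms by (intro suminf_ennreal2 summable_geometric) auto
  also have "\<dots> = ennreal (1 / (1 - r))" using assms by (simp add: suminf_geometric)
  finally show ?thesis .
qed

text \<open>At most \<open>j q\<^sup>n\<close> cosets have climb \<open>p\<close> and descent \<open>n\<close>, so the weights \<open>q\<^sup>-\<^sup>n r\<^sup>p\<^sup>+\<^sup>n\<close> with \<open>r = exp (- \<delta>)\<close> are
  summable over all cosets. Gibbs' inequality bounds the entropy by a constant plus \<open>ln q + \<delta>\<close> times the
  mean descent plus \<open>\<delta>\<close> times the mean climb. The mean descent is sublinear, the mean climb at most linear,
  and \<open>\<delta>\<close> is arbitrary; so the entropy is sublinear.\<close>

theorem almost_right_invariant_imp_integral_small: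
  assumes K0: "subgroup K0 G" "K0 \<subseteq> B 0" "openin (subtopology T (B 0)) K0"
    and mean: "(\<integral>g. real_of_int (snd g) \<partial>\<mu>) \<le> 0"
    and f: "R.harmonic_on_\<Gamma> C f" and eps: "0 \<le> \<epsilon>"
    and inv: "\<And>g k. g \<in> \<Gamma> \<Longrightarrow> k \<in> K0 \<times> {0} \<Longrightarrow> g \<otimes>\<^bsub>H\<^esub> k \<in> \<Gamma> \<Longrightarrow> \<bar>f (g \<otimes>\<^bsub>H\<^esub> k) - f g\<bar> \<le> \<epsilon>"
  shows "(\<integral>x. \<bar>f x - f \<one>\<^bsub>H\<^esub>\<bar> \<partial>\<mu>) \<le> 2 * \<epsilon>"
proof -
  define K where "K = K0 \<times> {0::int}"
  have K0c: "k \<in> K0 \<Longrightarrow> k \<in> carrier G" for k using subgroup.subset[OF K0(1)] by blast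
  have K0D: "K0 \<subseteq> D" using K0(2) B_subset_D by blast
  have K: "subgroup K H"
  proof (rule H.subgroupI)
    show "K \<subseteq> carrier H" using K0D by (auto simp: K_def carrier_H)
    show "K \<noteq> {}" using subgroup.one_closed[OF K0(1)] by (auto simp: K_def)
    show "inv\<^bsub>H\<^esub> a \<in> K" if "a \<in> K" for a
      using that K0D subgroup.m_inv_closed[OF K0(1)] by (auto simp: K_def inv_H K0c subset_iff)
    show "a \<otimes>\<^bsub>H\<^esub> b \<in> K" if "a \<in> K" "b \<in> K" for a b
      using that subgroup.m_closed[OF K0(1)] by (auto simp: K_def mult_H K0c)
  qed
  have Ks: "K \<in> sets (borel_of TH)"
  proof -
    obtain Q where Q: "openin T Q" "K0 = Q \<inter> B 0" using K0(3) unfolding openin_subtopology by blast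
    have "K = {p \<in> topspace TH. fst p \<in> Q} \<inter> (B 0 \<times> {0})"
      using Q(2) B_subset_D[of 0] by (auto simp: K_def topspace_TH carrier_H)
    then show ?thesis
      using openin_borel_of[OF openin_continuous_map_preimage[OF continuous_fst_TH Q(1)]]
        closedin_borel_of[OF closedin_TH_slab[of 0 "{0}"]] by auto
  qed
  obtain q j :: nat where q: "q \<ge> 1" and "\<And>n. \<exists>F. finite F \<and> card F \<le> j * q ^ n \<and> F \<subseteq> B (- int n) \<and> B (- int n) \<subseteq> (\<Union>f\<in>F. f <# K0)"
    using B_index[OF K0] by metis
  then obtain F where F: "\<And>n. finite (F n)" "\<And>n. card (F n) \<le> j * q ^ n" "\<And>n. F n \<subseteq> B (- int n)"
    "\<And>n. B (- int n) \<subseteq> (\<Union>f\<in>F n. f <# K0)" by metis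
  \<comment> \<open>\<open>Ys (p, n)\<close> contains the cosets of all elements with climb \<open>p\<close> and descent \<open>n\<close>, whose level is \<open>n - p\<close>\<close>
  define Ys where "Ys = (\<lambda>(p, n). (\<lambda>f. (pw (int n - int p) f, int n - int p) <#\<^bsub>H\<^esub> K) ` F n)"
  have Ys_fin: "finite (Ys pn)" for pn using F(1) by (auto simp: Ys_def case_prod_unfold)
  have Ys_card: "card (Ys pn) \<le> j * q ^ snd pn" for pn
    using card_image_le[OF F(1)] F(2) by (auto simp: Ys_def case_prod_unfold intro: order_trans)
  have in_Ys: "g <#\<^bsub>H\<^esub> K \<in> Ys (climb g, nat (descent g))" if g: "g \<in> carrier H" for g
  proof -
    obtain w s where ws: "g = (w, s)" "w \<in> D" using g by (auto simp: carrier_H)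
    have n: "int (nat (descent g)) = int (climb g) + s" using descent_nonneg[OF g] ws by (simp add: descent_def)
    have s: "s = int (nat (descent g)) - int (climb g)" using n by simp
    have wc: "w \<in> carrier G" using ws(2) by (rule D_carrier)
    have "w \<in> B (- int (climb g))" using climb_spec[OF g] ws by simp
    then have "pw (- s) w \<in> B (- int (nat (descent g)))" using wc n by (simp add: pw_in_B)
    then obtain f u where fu: "f \<in> F (nat (descent g))" "u \<in> K0" "pw (- s) w = f \<otimes> u"
      using F(4) unfolding l_coset_def by blast
    have fc: "f \<in> carrier G" using fu(1) F(3) B_carrier by blast
    have "f \<in> D" using fu(1) F(3) B_subset_D by blast
    then have fD: "(pw s f, s) \<in> carrier H" by (simp add: carrier_H pw_D)
    have "w = pw s (f \<otimes> u)" using fu(3) pw_cancel(2)[OF wc, of s] by simp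
    then have "g = (pw s f, s) \<otimes>\<^bsub>H\<^esub> (u, 0)" using ws fc K0c[OF fu(2)] by (simp add: mult_H pw_mult)
    then have "g \<in> (pw s f, s) <#\<^bsub>H\<^esub> K" using fu(2) unfolding l_coset_def K_def by blast
    then have "g <#\<^bsub>H\<^esub> K = (pw s f, s) <#\<^bsub>H\<^esub> K" using H.l_repr_independence[OF _ fD K] by simp
    moreover have "Ys (climb g, nat (descent g)) = (\<lambda>f. (pw s f, s) <#\<^bsub>H\<^esub> K) ` F (nat (descent g))"
      unfolding Ys_def prod.case s[symmetric] ..
    ultimately show ?thesis using fu(1) by blast
  qed
  have cY: "countable (lcosets\<^bsub>H\<^esub> K)"
  proof (rule countable_subset)
    show "lcosets\<^bsub>H\<^esub> K \<subseteq> (\<Union>pn. Ys pn)" using in_Ys unfolding LCOSETS_def by blast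
    show "countable (\<Union>pn. Ys pn)" using Ys_fin by (intro countable_UN) (auto intro: countable_finite)
  qed
  interpret E: random_walk_entropy H TH \<mu> \<Gamma> K
    by (intro random_walk_entropy.intro random_walk_cosets.intro random_walk_cosets_axioms.intro
        R.random_walk_in_subgroup_axioms R.random_walk_axioms K Ks cY)
  have climb_K: "climb (g \<otimes>\<^bsub>H\<^esub> k) \<le> climb g" "snd (g \<otimes>\<^bsub>H\<^esub> k) = snd g" if g: "g \<in> carrier H" and k: "k \<in> K" for g k
  proof -
    have kc: "k \<in> carrier H" using subsetD[OF subgroup.subset[OF K] k] .
    have "climb k \<le> 0" using k K0(2) kc by (subst climb_le_iff) (auto simp: K_def)
    then show "climb (g \<otimes>\<^bsub>H\<^esub> k) \<le> climb g" using climb_mult[OF g kc] climb_spec[OF g] by auto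
    show "snd (g \<otimes>\<^bsub>H\<^esub> k) = snd g" using k by (cases g) (auto simp: K_def mult_H)
  qed
  have coset_inv: "climb h = climb g \<and> snd h = snd g" if g: "g \<in> carrier H" and h: "h \<in> g <#\<^bsub>H\<^esub> K" for g h
  proof -
    obtain k where k: "k \<in> K" "h = g \<otimes>\<^bsub>H\<^esub> k" using h unfolding l_coset_def by blast
    have kc: "k \<in> carrier H" "inv\<^bsub>H\<^esub> k \<in> K"
      using subsetD[OF subgroup.subset[OF K] k(1)] subgroup.m_inv_closed[OF K k(1)] by auto
    have "g = h \<otimes>\<^bsub>H\<^esub> inv\<^bsub>H\<^esub> k" using k g kc by (simp add: H.m_assoc)
    then have "climb g \<le> climb h" using climb_K(1)[of h "inv\<^bsub>H\<^esub> k"] kc k g by simp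
    then show ?thesis using climb_K[OF g k(1)] k(2) by simp
  qed
  define rep where "rep y = (SOME g. g \<in> y)" for y :: "('a \<times> int) set"
  have rep: "climb (rep (g <#\<^bsub>H\<^esub> K)) = climb g" "descent (rep (g <#\<^bsub>H\<^esub> K)) = descent g" if g: "g \<in> carrier H" for g
  proof -
    have "g \<in> g <#\<^bsub>H\<^esub> K" using E.in_coset_iff[OF E.coset_in_Y[OF g] g] by simp
    then have "rep (g <#\<^bsub>H\<^esub> K) \<in> g <#\<^bsub>H\<^esub> K" unfolding rep_def by (rule someI)
    from coset_inv[OF g this] show "climb (rep (g <#\<^bsub>H\<^esub> K)) = climb g" "descent (rep (g <#\<^bsub>H\<^esub> K)) = descent g"
      by (simp_all add: descent_def)
  qed
  have descentm [measurable]: "(\<lambda>g. real_of_int (descent g)) \<in> borel_measurable (borel_of TH)"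
    using borel_measurable_add[OF real_climb_measurable measurable_compose[OF snd_measurable, of real_of_int borel]]
    by (simp add: descent_def)
  note [measurable] = real_climb_measurable
  define p1 where "p1 = (\<integral>g. real (climb g) \<partial>\<mu>)"
  have p1: "0 \<le> p1" "(\<integral>\<^sup>+ g. ennreal (real (climb g)) \<partial>\<mu>) \<le> ennreal p1"
    using nn_integral_eq_integral[OF integrable_climb] by (simp_all add: p1_def)
  have growth: "\<exists>n\<ge>1. E.entropy n \<le> ennreal (\<eta> * real n)" if \<eta>: "0 < \<eta>" for \<eta>
  proof -
    \<comment> \<open>the cost \<open>\<delta> * p1\<close> per step of the climb is at most \<open>\<eta> / 4\<close>\<close>
    define \<delta> where "\<delta> = \<eta> / (4 * (p1 + 1))"
    have \<delta>: "0 < \<delta>" using \<eta> p1 by (simp add: \<delta>_def)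
    define lq where "lq = ln (real q)"
    have lq: "0 \<le> lq" "exp lq = real q" using q by (simp_all add: lq_def)
    define r where "r = exp (- \<delta>)"
    have r: "0 < r" "r < 1" using \<delta> by (simp_all add: r_def)
    define pd where "pd y = (climb (rep y), nat (descent (rep y)))" for y
    define L where "L y = real (snd (pd y)) * (lq + \<delta>) + real (fst (pd y)) * \<delta>" for y
    have L0: "0 \<le> L y" for y using lq \<delta> by (simp add: L_def)
    define a where "a pn = (1 / real q) ^ snd pn * (r ^ snd pn * r ^ fst pn)" for pn :: "nat \<times> nat"
    have expL: "exp (- L y) = a (pd y)" for y
    proof -
      have "exp (- L y) = exp (- lq) ^ snd (pd y) * (exp (- \<delta>) ^ snd (pd y) * exp (- \<delta>) ^ fst (pd y))"
        by (simp add: L_def exp_of_nat_mult[symmetric] exp_add[symmetric] algebra_simps)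
      then show ?thesis using lq(2) by (simp add: a_def r_def exp_minus inverse_eq_divide)
    qed
    have a0: "0 \<le> a pn" for pn using r by (simp add: a_def)
    have pdY: "y \<in> Ys (pd y)" if "y \<in> lcosets\<^bsub>H\<^esub> K" for y
      using that in_Ys rep unfolding LCOSETS_def pd_def by auto
    define C1 where "C1 = real j * (1 / (1 - r) * (1 / (1 - r)))"
    have C1: "0 \<le> C1" using r by (simp add: C1_def)
    have "(\<integral>\<^sup>+ y. ennreal (exp (- L y)) \<partial>count_space (lcosets\<^bsub>H\<^esub> K))
      \<le> (\<integral>\<^sup>+ y. (\<integral>\<^sup>+ pn. ennreal (a pn) * indicator (Ys pn) y \<partial>count_space UNIV) \<partial>count_space (lcosets\<^bsub>H\<^esub> K))"
    proof (rule nn_integral_mono)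
      fix y assume "y \<in> space (count_space (lcosets\<^bsub>H\<^esub> K))"
      then have y: "y \<in> lcosets\<^bsub>H\<^esub> K" by simp
      have "ennreal (exp (- L y)) = (\<integral>\<^sup>+ pn. ennreal (a pn) * indicator (Ys pn) y * indicator {pd y} pn \<partial>count_space UNIV)"
        using pdY[OF y] by (subst nn_integral_indicator_singleton) (simp_all add: expL)
      also have "\<dots> \<le> (\<integral>\<^sup>+ pn. ennreal (a pn) * indicator (Ys pn) y \<partial>count_space UNIV)"
        by (intro nn_integral_mono) (auto simp: indicator_def)
      finally show "ennreal (exp (- L y)) \<le> \<dots>" .
    qed
    also have "\<dots> = (\<integral>\<^sup>+ pn. (\<integral>\<^sup>+ y. ennreal (a pn) * indicator (Ys pn) y \<partial>count_space (lcosets\<^bsub>H\<^esub> K)) \<partial>count_space UNIV)"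
      by (rule nn_integral_count_space_nn_integral[OF cY, symmetric]) simp
    also have "\<dots> \<le> (\<integral>\<^sup>+ pn. ennreal (real j) * (ennreal (r ^ fst pn) * ennreal (r ^ snd pn)) \<partial>count_space UNIV)"
    proof (rule nn_integral_mono)
      fix pn :: "nat \<times> nat"
      have "(\<integral>\<^sup>+ y. ennreal (a pn) * indicator (Ys pn) y \<partial>count_space (lcosets\<^bsub>H\<^esub> K))
        = ennreal (a pn) * (\<integral>\<^sup>+ y. indicator (Ys pn \<inter> lcosets\<^bsub>H\<^esub> K) y \<partial>count_space (lcosets\<^bsub>H\<^esub> K))"
        by (subst nn_integral_cmult[symmetric]) (auto intro!: nn_integral_cong simp: indicator_def)
      also have "\<dots> = ennreal (a pn) * ennreal (real (card (Ys pn \<inter> lcosets\<^bsub>H\<^esub> K)))"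
        using Ys_fin[of pn] by (subst nn_integral_indicator) (auto simp: emeasure_count_space_finite ennreal_of_nat_eq_real_of_nat)
      also have "\<dots> \<le> ennreal (a pn) * ennreal (real j * real q ^ snd pn)"
      proof -
        have "card (Ys pn \<inter> lcosets\<^bsub>H\<^esub> K) \<le> j * q ^ snd pn"
          using card_mono[OF Ys_fin[of pn], of "Ys pn \<inter> lcosets\<^bsub>H\<^esub> K"] Ys_card[of pn] by simp
        then have "real (card (Ys pn \<inter> lcosets\<^bsub>H\<^esub> K)) \<le> real (j * q ^ snd pn)" by (rule of_nat_mono)
        then show ?thesis by (intro mult_left_mono ennreal_leI) simp_all
      qed
      also have "\<dots> = ennreal (a pn * (real j * real q ^ snd pn))"
        using a0[of pn] by (simp add: ennreal_mult)
      also have "a pn * (real j * real q ^ snd pn) = real j * (r ^ fst pn * r ^ snd pn)"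
        using q by (simp add: a_def power_divide field_simps)
      also have "ennreal \<dots> = ennreal (real j) * (ennreal (r ^ fst pn) * ennreal (r ^ snd pn))"
        using r by (simp add: ennreal_mult)
      finally show "(\<integral>\<^sup>+ y. ennreal (a pn) * indicator (Ys pn) y \<partial>count_space (lcosets\<^bsub>H\<^esub> K))
        \<le> ennreal (real j) * (ennreal (r ^ fst pn) * ennreal (r ^ snd pn))" .
    qed
    also have "\<dots> = ennreal (real j) * (\<integral>\<^sup>+ p. (\<integral>\<^sup>+ n. ennreal (r ^ p) * ennreal (r ^ n) \<partial>count_space UNIV) \<partial>count_space UNIV)"
      by (simp add: nn_integral_cmult nn_integral_fst_count_space[symmetric])
    also have "\<dots> = ennreal C1"
      using r by (simp add: nn_integral_cmult nn_integral_multc nn_integral_geometric C1_def) (simp flip: ennreal_mult)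
    finally have sumL: "(\<integral>\<^sup>+ y. ennreal (exp (- L y)) \<partial>count_space (lcosets\<^bsub>H\<^esub> K)) \<le> ennreal C1" .
    \<comment> \<open>the cost \<open>(lq + \<delta>) * \<epsilon>'\<close> per step of the descent is at most \<open>\<eta> / 4\<close>\<close>
    define \<epsilon>' where "\<epsilon>' = \<eta> / (4 * (lq + \<delta> + 1))"
    have \<epsilon>': "0 < \<epsilon>'" using \<eta> lq \<delta> by (simp add: \<epsilon>'_def)
    have "\<exists>C\<ge>0. \<forall>n. (\<integral>\<^sup>+ g. ennreal (max 0 (real_of_int (descent g))) \<partial>R.law n) \<le> ennreal (C + \<epsilon>' * real n)"
    proof (rule R.sublinear_height[where P = "\<lambda>g. real (climb g)" and z = "\<lambda>g. real_of_int (snd g)"])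
      show "max 0 (real_of_int (descent \<one>\<^bsub>H\<^esub>)) \<le> 0" by (simp add: descent_def climb_one) (simp add: one_H)
      fix g x assume g: "g \<in> carrier H" and x: "x \<in> carrier H"
      have "0 \<le> descent (g \<otimes>\<^bsub>H\<^esub> x)" "0 \<le> descent g" using descent_nonneg g x by auto
      then show "max 0 (real_of_int (descent (g \<otimes>\<^bsub>H\<^esub> x))) \<le> max (max 0 (real_of_int (descent g))) (real (climb x)) + real_of_int (snd x)"
        using descent_mult[OF g x] by (simp add: max_def split: if_splits)
    qed (use mean \<epsilon>' integrable_climb integrable_snd in auto)
    then obtain C where C: "0 \<le> C" "\<And>n. (\<integral>\<^sup>+ g. ennreal (max 0 (real_of_int (descent g))) \<partial>R.law n) \<le> ennreal (C + \<epsilon>' * real n)"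
      by blast
    have climbn: "(\<integral>\<^sup>+ g. ennreal (real (climb g)) \<partial>R.law n) \<le> ennreal (real n * p1)" for n
      using p1 climb_one climb_subadditive by (intro R.nn_integral_subadditive_le) (auto simp flip: of_nat_add)
    define C2 where "C2 = (lq + \<delta>) * C + C1"
    have bound: "E.entropy n \<le> ennreal (C2 + \<eta> / 2 * real n)" for n
    proof -
      have "E.entropy n \<le> (\<integral>\<^sup>+ g. ennreal (L (g <#\<^bsub>H\<^esub> K)) \<partial>R.law n) + ennreal C1"
        by (rule order_trans[OF E.entropy_gibbs[OF L0] add_left_mono[OF sumL]])
      also have "(\<integral>\<^sup>+ g. ennreal (L (g <#\<^bsub>H\<^esub> K)) \<partial>R.law n)
        = (\<integral>\<^sup>+ g. ennreal (lq + \<delta>) * ennreal (max 0 (real_of_int (descent g))) + ennreal \<delta> * ennreal (real (climb g)) \<partial>R.law n)"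
      proof (rule nn_integral_cong)
        fix g assume "g \<in> space (R.law n)"
        then have g: "g \<in> carrier H" by simp
        have "real (nat (descent g)) = max 0 (real_of_int (descent g))" using descent_nonneg[OF g] by simp
        then have "L (g <#\<^bsub>H\<^esub> K) = (lq + \<delta>) * max 0 (real_of_int (descent g)) + \<delta> * real (climb g)"
          using rep[OF g] by (simp add: L_def pd_def mult.commute)
        then show "ennreal (L (g <#\<^bsub>H\<^esub> K)) = ennreal (lq + \<delta>) * ennreal (max 0 (real_of_int (descent g))) + ennreal \<delta> * ennreal (real (climb g))"
          using lq \<delta> by (simp add: ennreal_plus ennreal_mult)
      qed
      also have "\<dots> = ennreal (lq + \<delta>) * (\<integral>\<^sup>+ g. ennreal (max 0 (real_of_int (descent g))) \<partial>R.law n)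
        + ennreal \<delta> * (\<integral>\<^sup>+ g. ennreal (real (climb g)) \<partial>R.law n)"
        by (simp add: nn_integral_add nn_integral_cmult)
      also have "\<dots> \<le> ennreal (lq + \<delta>) * ennreal (C + \<epsilon>' * real n) + ennreal \<delta> * ennreal (real n * p1)"
        by (intro add_mono mult_left_mono C(2) climbn) auto
      also have "\<dots> + ennreal C1 = ennreal ((lq + \<delta>) * (C + \<epsilon>' * real n) + \<delta> * (real n * p1) + C1)"
        using lq \<delta> C(1) \<epsilon>' p1 C1 by (simp flip: ennreal_mult ennreal_plus)
      also have "\<dots> \<le> ennreal (C2 + \<eta> / 2 * real n)"
      proof (rule ennreal_leI)
        have "(lq + \<delta>) * \<epsilon>' \<le> \<eta> / 4"
        proof -
          have "(lq + \<delta>) * \<epsilon>' = \<eta> / 4 * ((lq + \<delta>) / (lq + \<delta> + 1))" by (simp add: \<epsilon>'_def)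
          also have "\<dots> \<le> \<eta> / 4 * 1" using \<eta> lq \<delta> by (intro mult_left_mono) (auto simp: divide_le_eq_1)
          finally show ?thesis by simp
        qed
        moreover have "\<delta> * p1 \<le> \<eta> / 4"
        proof -
          have "\<delta> * p1 = \<eta> / 4 * (p1 / (p1 + 1))" by (simp add: \<delta>_def)
          also have "\<dots> \<le> \<eta> / 4 * 1" using \<eta> p1 by (intro mult_left_mono) (auto simp: divide_le_eq_1)
          finally show ?thesis by simp
        qed
        ultimately have "((lq + \<delta>) * \<epsilon>' + \<delta> * p1) * real n \<le> (\<eta> / 2) * real n"
          by (intro mult_right_mono) auto
        then show "(lq + \<delta>) * (C + \<epsilon>' * real n) + \<delta> * (real n * p1) + C1 \<le> C2 + \<eta> / 2 * real n"
          by (simp add: C2_def algebra_simps)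
      qed
      finally show ?thesis by (simp add: add_right_mono)
    qed
    obtain n where n: "2 * C2 / \<eta> + 1 \<le> real n" using real_arch_simple by blast
    have C20: "0 \<le> C2" using lq \<delta> C(1) C1 by (simp add: C2_def)
    have "1 \<le> real n" using n C20 \<eta> by (smt (verit) divide_nonneg_pos mult_nonneg_nonneg)
    moreover have "C2 + \<eta> / 2 * real n \<le> \<eta> * real n"
    proof -
      have "2 * C2 / \<eta> \<le> real n" using n by linarith
      then have "2 * C2 \<le> real n * \<eta>" using \<eta> by (simp add: divide_le_eq)
      then show ?thesis by (simp add: algebra_simps)
    qed
    ultimately show ?thesis using bound[of n] by (intro exI[of _ n]) (auto intro: order_trans ennreal_leI)
  qed
  show ?thesis
    by (rule E.entropy_criterion[OF f eps _ growth]) (use inv in \<open>auto simp: K_def\<close>)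
qed

text \<open>By right uniform continuity \<open>f\<close> and its left translates are almost right invariant under ever smaller
  open subgroups, so \<open>f (g x) = f g\<close> for almost every increment \<open>x\<close>. Continuity extends this to the support
  of \<open>\<mu>\<close>, multiplicativity to the semigroup that the support generates, and continuity again to its closure.\<close>

theorem harmonic_constant_if_mean_nonpositive:
  assumes spread: "spread_out H TH \<mu>" and mean: "(\<integral>g. real_of_int (snd g) \<partial>\<mu>) \<le> 0"
    and gen: "\<Gamma> = TH closure_of (semigroup_generated H (support_of TH \<mu>))"
    and f: "R.harmonic_on_\<Gamma> C f" and x: "x \<in> \<Gamma>"
  shows "f x = f \<one>\<^bsub>H\<^esub>"
proof -
  note \<Gamma>_closed = subgroup.m_closed[OF subgroup_\<Gamma>] subgroup.m_inv_closed[OF subgroup_\<Gamma>]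
  have fm: "f \<in> borel_measurable R.BT" and fC: "\<And>g. \<bar>f g\<bar> \<le> C"
    and fh: "\<And>g. g \<in> \<Gamma> \<Longrightarrow> f g = (\<integral>x. f (g \<otimes>\<^bsub>H\<^esub> x) \<partial>\<mu>)"
    using f unfolding R.harmonic_on_\<Gamma>_def by blast+
  have uc: "\<exists>U. openin TH U \<and> \<one>\<^bsub>H\<^esub> \<in> U \<and> (\<forall>g\<in>\<Gamma>. \<forall>k\<in>U \<inter> \<Gamma>. \<bar>f (g \<otimes>\<^bsub>H\<^esub> k) - f g\<bar> \<le> \<epsilon>)"
    if "0 < \<epsilon>" for \<epsilon>
    using R.harmonic_right_uniformly_continuous[OF spread Hausdorff_TH slabs_cover f that] .
  have near: "\<exists>N. openin TH N \<and> x \<in> N \<and> (\<forall>g\<in>\<Gamma>. \<forall>y\<in>N \<inter> \<Gamma>. \<bar>f (g \<otimes>\<^bsub>H\<^esub> y) - f (g \<otimes>\<^bsub>H\<^esub> x)\<bar> \<le> \<epsilon>)"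
    if x: "x \<in> \<Gamma>" and eps: "0 < \<epsilon>" for x \<epsilon>
  proof -
    obtain U where U: "openin TH U" "\<one>\<^bsub>H\<^esub> \<in> U" "\<And>g k. g \<in> \<Gamma> \<Longrightarrow> k \<in> U \<inter> \<Gamma> \<Longrightarrow> \<bar>f (g \<otimes>\<^bsub>H\<^esub> k) - f g\<bar> \<le> \<epsilon>"
      using uc[OF eps] by blast
    have xc: "x \<in> carrier H" using x by (rule R.\<Gamma>_carrier)
    let ?N = "{y \<in> topspace TH. inv\<^bsub>H\<^esub> x \<otimes>\<^bsub>H\<^esub> y \<in> U}"
    have "openin TH ?N"
      using xc by (intro openin_continuous_map_preimage[OF R.continuous_lmult U(1)]) simp
    moreover have "x \<in> ?N" using xc U(2) by (simp add: topspace_TH)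
    moreover have "\<bar>f (g \<otimes>\<^bsub>H\<^esub> y) - f (g \<otimes>\<^bsub>H\<^esub> x)\<bar> \<le> \<epsilon>" if g: "g \<in> \<Gamma>" and y: "y \<in> ?N \<inter> \<Gamma>" for g y
    proof -
      have "g \<otimes>\<^bsub>H\<^esub> y = (g \<otimes>\<^bsub>H\<^esub> x) \<otimes>\<^bsub>H\<^esub> (inv\<^bsub>H\<^esub> x \<otimes>\<^bsub>H\<^esub> y)"
        using g xc y R.\<Gamma>_carrier by (simp add: H.m_assoc R.lmult_cancel_inv)
      moreover have "inv\<^bsub>H\<^esub> x \<otimes>\<^bsub>H\<^esub> y \<in> U \<inter> \<Gamma>" using y x \<Gamma>_closed by auto
      ultimately show ?thesis using U(3)[of "g \<otimes>\<^bsub>H\<^esub> x"] g x \<Gamma>_closed by simp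
    qed
    ultimately show ?thesis by (intro exI[of _ ?N]) blast
  qed
  have ae: "AE x in \<mu>. f (g \<otimes>\<^bsub>H\<^esub> x) = f g" if g: "g \<in> \<Gamma>" for g
  proof -
    have gc: "g \<in> carrier H" using g by (rule R.\<Gamma>_carrier)
    let ?f = "\<lambda>x. f (g \<otimes>\<^bsub>H\<^esub> x)"
    have fgm: "?f \<in> borel_measurable R.BT" using measurable_compose[OF R.measurable_lmult[OF gc] fm] .
    have hf: "R.harmonic_on_\<Gamma> C ?f"
      unfolding R.harmonic_on_\<Gamma>_def
    proof (intro conjI allI ballI fgm fC)
      fix h assume h: "h \<in> \<Gamma>"
      have "f (g \<otimes>\<^bsub>H\<^esub> h) = (\<integral>x. f (g \<otimes>\<^bsub>H\<^esub> h \<otimes>\<^bsub>H\<^esub> x) \<partial>\<mu>)" using g h \<Gamma>_closed by (intro fh) auto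
      also have "\<dots> = (\<integral>x. f (g \<otimes>\<^bsub>H\<^esub> (h \<otimes>\<^bsub>H\<^esub> x)) \<partial>\<mu>)"
        using gc R.\<Gamma>_carrier[OF h] by (intro Bochner_Integration.integral_cong) (auto simp: H.m_assoc)
      finally show "f (g \<otimes>\<^bsub>H\<^esub> h) = \<dots>" .
    qed
    have small: "(\<integral>x. \<bar>?f x - ?f \<one>\<^bsub>H\<^esub>\<bar> \<partial>\<mu>) \<le> 2 * \<epsilon>" if eps: "0 < \<epsilon>" for \<epsilon>
    proof -
      obtain U where U: "openin TH U" "\<one>\<^bsub>H\<^esub> \<in> U" "\<And>g k. g \<in> \<Gamma> \<Longrightarrow> k \<in> U \<inter> \<Gamma> \<Longrightarrow> \<bar>f (g \<otimes>\<^bsub>H\<^esub> k) - f g\<bar> \<le> \<epsilon>"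
        using uc[OF eps] by blast
      obtain K0 where K0: "subgroup K0 G" "K0 \<subseteq> B 0" "openin (subtopology T (B 0)) K0" "K0 \<times> {0} \<subseteq> U"
        by (rule small_subgroup[OF U(1,2)])
      show ?thesis
      proof (rule almost_right_invariant_imp_integral_small[OF K0(1,2,3) mean hf])
        fix h k assume h: "h \<in> \<Gamma>" and k: "k \<in> K0 \<times> {0}" and hk: "h \<otimes>\<^bsub>H\<^esub> k \<in> \<Gamma>"
        have hc: "h \<in> carrier H" using h by (rule R.\<Gamma>_carrier)
        have kc: "k \<in> carrier H" using k K0(2) B_subset_D[of 0] by (auto simp: carrier_H)
        have "inv\<^bsub>H\<^esub> h \<otimes>\<^bsub>H\<^esub> (h \<otimes>\<^bsub>H\<^esub> k) \<in> \<Gamma>" using h hk \<Gamma>_closed by blast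
        then have "k \<in> \<Gamma>" using hc kc by (simp add: R.lmult_cancel_inv)
        then have "\<bar>f ((g \<otimes>\<^bsub>H\<^esub> h) \<otimes>\<^bsub>H\<^esub> k) - f (g \<otimes>\<^bsub>H\<^esub> h)\<bar> \<le> \<epsilon>"
          using k K0(4) g h \<Gamma>_closed by (intro U(3)) auto
        then show "\<bar>?f (h \<otimes>\<^bsub>H\<^esub> k) - ?f h\<bar> \<le> \<epsilon>" using gc hc kc by (simp add: H.m_assoc)
      qed (use eps in simp)
    qed
    have bd: "\<bar>?f x - ?f \<one>\<^bsub>H\<^esub>\<bar> \<le> 2 * C" for x using fC[of "g \<otimes>\<^bsub>H\<^esub> x"] fC[of "g \<otimes>\<^bsub>H\<^esub> \<one>\<^bsub>H\<^esub>"] by linarith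
    have i: "integrable \<mu> (\<lambda>x. \<bar>?f x - ?f \<one>\<^bsub>H\<^esub>\<bar>)"
      using bd fgm by (intro R.mu.integrable_const_bound[where B = "2 * C"]) (auto cong: measurable_cong_sets)
    have "(\<integral>x. \<bar>?f x - ?f \<one>\<^bsub>H\<^esub>\<bar> \<partial>\<mu>) \<le> 0"
    proof (rule field_le_epsilon)
      fix e :: real assume "0 < e"
      then show "(\<integral>x. \<bar>?f x - ?f \<one>\<^bsub>H\<^esub>\<bar> \<partial>\<mu>) \<le> 0 + e" using small[of "e / 2"] by simp
    qed
    then have "(\<integral>x. \<bar>?f x - ?f \<one>\<^bsub>H\<^esub>\<bar> \<partial>\<mu>) = 0" by (intro antisym integral_nonneg_AE) auto
    then have "AE x in \<mu>. \<bar>?f x - ?f \<one>\<^bsub>H\<^esub>\<bar> = 0"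
      using integral_nonneg_eq_0_iff_AE[OF i] by simp
    then show ?thesis using gc by (auto elim: eventually_mono)
  qed
  have supp: "f (g \<otimes>\<^bsub>H\<^esub> x) = f g" if x: "x \<in> support_of TH \<mu>" "x \<in> \<Gamma>" and g: "g \<in> \<Gamma>" for x g
  proof -
    have "\<bar>f (g \<otimes>\<^bsub>H\<^esub> x) - f g\<bar> \<le> 0 + \<epsilon>" if eps: "0 < \<epsilon>" for \<epsilon>
    proof -
      obtain N where N: "openin TH N" "x \<in> N" "\<And>y. y \<in> N \<inter> \<Gamma> \<Longrightarrow> \<bar>f (g \<otimes>\<^bsub>H\<^esub> y) - f (g \<otimes>\<^bsub>H\<^esub> x)\<bar> \<le> \<epsilon>"
        using near[OF x(2) eps] g by blast
      have pos: "emeasure \<mu> N > 0" using x(1) N by (auto simp: support_of_def)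
      have "\<exists>y. y \<in> N \<and> y \<in> \<Gamma> \<and> f (g \<otimes>\<^bsub>H\<^esub> y) = f g"
      proof (rule ccontr)
        assume no: "\<not> ?thesis"
        have "AE y in \<mu>. y \<notin> N" using ae[OF g] AE_\<Gamma> by eventually_elim (use no in blast)
        then have "emeasure \<mu> N = 0"
          using openin_borel_of[OF N(1)] by (subst (asm) AE_iff_measurable[where N = N]) (use sets.sets_into_space[of N \<mu>] in auto)
        then show False using pos by simp
      qed
      then obtain y where y: "y \<in> N" "y \<in> \<Gamma>" "f (g \<otimes>\<^bsub>H\<^esub> y) = f g" by blast
      then have "\<bar>f g - f (g \<otimes>\<^bsub>H\<^esub> x)\<bar> \<le> \<epsilon>" using N(3)[of y] by simp
      then show ?thesis by linarith
    qed
    then have "\<bar>f (g \<otimes>\<^bsub>H\<^esub> x) - f g\<bar> \<le> 0" by (rule field_le_epsilon)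
    then show ?thesis by simp
  qed
  let ?S = "semigroup_generated H (support_of TH \<mu>)"
  have supp_c: "support_of TH \<mu> \<subseteq> carrier H" by (auto simp: support_of_def topspace_TH)
  have S_c: "y \<in> carrier H" if "y \<in> ?S" for y
    using that by induction (use supp_c in auto)
  have S_\<Gamma>: "y \<in> \<Gamma>" if "y \<in> ?S" for y
    unfolding gen using that S_c by (intro subsetD[OF closure_of_subset]) (auto simp: topspace_TH)
  have semi: "\<forall>g\<in>\<Gamma>. f (g \<otimes>\<^bsub>H\<^esub> y) = f g" if "y \<in> ?S" for y
    using that
  proof induction
    case (incl y)
    then show ?case using supp S_\<Gamma>[OF semigroup_generated.incl[OF incl]] by blast
  next
    case (mult y z)
    have "f (g \<otimes>\<^bsub>H\<^esub> (y \<otimes>\<^bsub>H\<^esub> z)) = f g" if g: "g \<in> \<Gamma>" for g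
    proof -
      have "g \<otimes>\<^bsub>H\<^esub> (y \<otimes>\<^bsub>H\<^esub> z) = g \<otimes>\<^bsub>H\<^esub> y \<otimes>\<^bsub>H\<^esub> z"
        using g R.\<Gamma>_carrier S_c mult(1,2) by (simp add: H.m_assoc)
      then show ?thesis using mult(3,4) g \<Gamma>_closed(1)[OF g S_\<Gamma>[OF mult(1)]] by simp
    qed
    then show ?case by blast
  qed
  have "\<bar>f x - f \<one>\<^bsub>H\<^esub>\<bar> \<le> 0 + \<epsilon>" if eps: "0 < \<epsilon>" for \<epsilon>
  proof -
    have one: "\<one>\<^bsub>H\<^esub> \<in> \<Gamma>" by (rule subgroup.one_closed[OF subgroup_\<Gamma>])
    obtain N where N: "openin TH N" "x \<in> N" "\<And>y. y \<in> N \<inter> \<Gamma> \<Longrightarrow> \<bar>f (\<one>\<^bsub>H\<^esub> \<otimes>\<^bsub>H\<^esub> y) - f (\<one>\<^bsub>H\<^esub> \<otimes>\<^bsub>H\<^esub> x)\<bar> \<le> \<epsilon>"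
      using near[OF x eps] one by blast
    obtain y where y: "y \<in> N" "y \<in> ?S"
      using x N(1,2) unfolding gen in_closure_of by blast
    have "f (\<one>\<^bsub>H\<^esub> \<otimes>\<^bsub>H\<^esub> y) = f \<one>\<^bsub>H\<^esub>" using semi[OF y(2)] one by blast
    then show ?thesis using N(3)[of y] y S_\<Gamma> R.\<Gamma>_carrier[OF x] by (simp add: abs_minus_commute)
  qed
  then have "\<bar>f x - f \<one>\<^bsub>H\<^esub>\<bar> \<le> 0" by (rule field_le_epsilon)
  then show ?thesis by simp
qed

end

section \<open>Positive mean\<close>

context tdlc_walk
begin

sublocale Sq: sequence_space \<mu>
  by unfold_locales

abbreviation \<Omega> where "\<Omega> \<equiv> (\<Pi>\<^sub>M i\<in>(UNIV :: nat set). \<mu>)"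

lemma space_\<Omega>: "\<omega> \<in> space \<Omega> \<longleftrightarrow> (\<forall>i. \<omega> i \<in> carrier H)"
  by (auto simp: space_PiM PiE_iff)

abbreviation shift :: "(nat \<Rightarrow> 'a \<times> int) \<Rightarrow> nat \<Rightarrow> 'a \<times> int" where
  "shift \<omega> \<equiv> \<lambda>i. \<omega> (Suc i)"

lemma shift_space: "\<omega> \<in> space \<Omega> \<Longrightarrow> shift \<omega> \<in> space \<Omega>"
  by (simp add: space_\<Omega>)

lemma walk_closed: "\<omega> \<in> space \<Omega> \<Longrightarrow> walk H \<omega> n \<in> carrier H"
  by (induction n) (auto simp: space_\<Omega>)

lemma walk_shift: "\<omega> \<in> space \<Omega> \<Longrightarrow> walk H \<omega> (Suc n) = \<omega> 0 \<otimes>\<^bsub>H\<^esub> walk H (shift \<omega>) n"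
proof (induction n)
  case 0
  then show ?case by (simp add: space_\<Omega>)
next
  case (Suc n)
  have "walk H \<omega> (Suc (Suc n)) = \<omega> 0 \<otimes>\<^bsub>H\<^esub> walk H (shift \<omega>) n \<otimes>\<^bsub>H\<^esub> \<omega> (Suc n)"
    using Suc by simp
  then show ?case using walk_closed[OF shift_space[OF Suc.prems], of n] Suc.prems by (simp add: space_\<Omega> H.m_assoc)
qed

lemma walk_measurable [measurable]: "(\<lambda>\<omega>. walk H \<omega> n) \<in> measurable \<Omega> (borel_of TH)"
proof (induction n)
  case 0
  show ?case by simp
next
  case (Suc n)
  have c: "(\<lambda>\<omega>. \<omega> n) \<in> measurable \<Omega> (borel_of TH)"
    using measurable_component_singleton[of n UNIV "\<lambda>_. \<mu>"] by (simp cong: measurable_cong_sets)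
  show ?case unfolding walk.simps by (rule R.mult_measurable'[OF Suc c])
qed

lemma nat_case_measurable: "(\<lambda>(x, \<omega>). case_nat x \<omega>) \<in> measurable (\<mu> \<Otimes>\<^sub>M \<Omega>) \<Omega>"
  by measurable

text \<open>A bound for the climbs of the walk, valid at all times up to \<open>n\<close>. The recursion is on the first increment, so that the
  invariance of the product measure under the shift applies.\<close>

primrec max_climb :: "nat \<Rightarrow> (nat \<Rightarrow> 'a \<times> int) \<Rightarrow> real" where
  "max_climb 0 = (\<lambda>\<omega>. 0)"
| "max_climb (Suc n) = (\<lambda>\<omega>. max (real (climb (\<omega> 0))) (max_climb n (shift \<omega>) - real_of_int (snd (\<omega> 0))))"

lemma max_climb_nonneg: "0 \<le> max_climb n \<omega>"
  by (cases n) auto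

lemma max_climb_mono: "max_climb n \<omega> \<le> max_climb (Suc n) \<omega>"
proof (induction n arbitrary: \<omega>)
  case (Suc n)
  have "max_climb (Suc (Suc n)) \<omega> = max (real (climb (\<omega> 0))) (max_climb (Suc n) (shift \<omega>) - real_of_int (snd (\<omega> 0)))"
    by (simp only: max_climb.simps(2)[of "Suc n"])
  moreover have "max_climb (Suc n) \<omega> = max (real (climb (\<omega> 0))) (max_climb n (shift \<omega>) - real_of_int (snd (\<omega> 0)))"
    by (simp only: max_climb.simps(2)[of n])
  ultimately show ?case using Suc[of "shift \<omega>"] by linarith
qed simp

lemma climb_walk_le: "\<omega> \<in> space \<Omega> \<Longrightarrow> real (climb (walk H \<omega> n)) \<le> max_climb n \<omega>"
proof (induction n arbitrary: \<omega>)
  case 0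
  then show ?case by (simp add: climb_one)
next
  case (Suc n)
  have "int (climb (\<omega> 0 \<otimes>\<^bsub>H\<^esub> walk H (shift \<omega>) n)) \<le> max (int (climb (\<omega> 0))) (int (climb (walk H (shift \<omega>) n)) - snd (\<omega> 0))"
    using Suc.prems walk_closed[OF shift_space[OF Suc.prems], of n] by (intro climb_mult) (auto simp: space_\<Omega>)
  then show ?case
    using Suc.IH[OF shift_space[OF Suc.prems]] by (simp add: walk_shift[OF Suc.prems] del: walk.simps)
qed

lemma shift_measurable: "shift \<in> measurable \<Omega> \<Omega>"
  by (rule measurable_PiM_single') (auto simp: space_PiM PiE_iff)

lemma max_climb_measurable [measurable]: "max_climb n \<in> borel_measurable \<Omega>"
proof (induction n)
  case (Suc n)
  have c: "(\<lambda>\<omega>. \<omega> 0) \<in> measurable \<Omega> \<mu>" by measurable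
  show ?case unfolding max_climb.simps
    using measurable_compose[OF c climb_measurable] measurable_compose[OF c snd_measurable']
      measurable_compose[OF shift_measurable Suc]
    by (intro borel_measurable_max borel_measurable_diff)
qed simp

lemma nn_integral_\<Omega>:
  assumes F: "F \<in> borel_measurable \<Omega>"
  shows "(\<integral>\<^sup>+ \<omega>. F \<omega> \<partial>\<Omega>) = (\<integral>\<^sup>+ x. (\<integral>\<^sup>+ \<omega>. F (case_nat x \<omega>) \<partial>\<Omega>) \<partial>\<mu>)"
proof -
  have "(\<integral>\<^sup>+ \<omega>. F \<omega> \<partial>\<Omega>) = (\<integral>\<^sup>+ \<omega>. F \<omega> \<partial>distr (\<mu> \<Otimes>\<^sub>M \<Omega>) \<Omega> (\<lambda>(x, \<omega>). case_nat x \<omega>))"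
    unfolding Sq.PiM_iter ..
  also have "\<dots> = (\<integral>\<^sup>+ p. F (case p of (x, \<omega>) \<Rightarrow> case_nat x \<omega>) \<partial>(\<mu> \<Otimes>\<^sub>M \<Omega>))"
    by (rule nn_integral_distr[OF nat_case_measurable]) (simp add: F)
  also have "\<dots> = (\<integral>\<^sup>+ x. (\<integral>\<^sup>+ \<omega>. F (case_nat x \<omega>) \<partial>\<Omega>) \<partial>\<mu>)"
    using measurable_compose[OF nat_case_measurable F]
    by (subst Sq.P.nn_integral_fst[symmetric]) auto
  finally show ?thesis .
qed

lemma max_climb_integrable: "integrable \<Omega> (max_climb n)"
proof (induction n)
  case (Suc n)
  let ?g = "\<lambda>x. real (climb x) + \<bar>real_of_int (snd x)\<bar>"
  have gi: "integrable \<mu> ?g" using integrable_climb integrable_snd by (intro Bochner_Integration.integrable_add) auto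
  have gm: "?g \<in> borel_measurable \<mu>" using gi by (rule borel_measurable_integrable)
  have "(\<integral>\<^sup>+ \<omega>. ennreal (max_climb (Suc n) \<omega>) \<partial>\<Omega>) = (\<integral>\<^sup>+ x. (\<integral>\<^sup>+ \<omega>. ennreal (max_climb (Suc n) (case_nat x \<omega>)) \<partial>\<Omega>) \<partial>\<mu>)"
    by (rule nn_integral_\<Omega>) measurable
  also have "\<dots> \<le> (\<integral>\<^sup>+ x. (\<integral>\<^sup>+ \<omega>. ennreal (?g x) + ennreal (max_climb n \<omega>) \<partial>\<Omega>) \<partial>\<mu>)"
    using max_climb_nonneg[of n]
    by (intro nn_integral_mono) (auto simp flip: ennreal_plus intro!: ennreal_leI)
  also have "\<dots> = (\<integral>\<^sup>+ x. ennreal (?g x) \<partial>\<mu>) + (\<integral>\<^sup>+ \<omega>. ennreal (max_climb n \<omega>) \<partial>\<Omega>)"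
    using gm by (simp add: nn_integral_add Sq.P.emeasure_space_1 R.mu.emeasure_space_1)
  also have "\<dots> < \<infinity>"
    using integrableD(2)[OF gi] integrableD(2)[OF Suc] max_climb_nonneg[of n]
    by (simp add: less_top abs_of_nonneg)
  finally show ?case using max_climb_nonneg by (intro integrableI_bounded) (auto simp del: max_climb.simps)
qed simp

text \<open>If \<open>max_climb\<close> diverged almost surely, then \<open>max_climb (n + 1)\<close> of the walk with first increment \<open>x\<close>,
  minus \<open>max_climb n\<close> of the shifted walk, would eventually equal \<open>- snd x\<close>. By dominated convergence the
  expectations of \<open>max_climb\<close> would eventually decrease, although \<open>max_climb\<close> increases with \<open>n\<close>.\<close>

theorem max_climb_bounded_with_positive_probability:
  assumes mean: "0 < (\<integral>g. real_of_int (snd g) \<partial>\<mu>)"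
  shows "\<not> (AE \<omega> in \<Omega>. \<forall>c. \<exists>n. c < max_climb n \<omega>)"
proof
  assume unb: "AE \<omega> in \<Omega>. \<forall>c. \<exists>n. c < max_climb n \<omega>"
  interpret P: pair_prob_space \<mu> \<Omega> ..
  define \<Delta> where "\<Delta> n p = max_climb (Suc n) (case_nat (fst p) (snd p)) - max_climb n (snd p)"
    for n and p :: "('a \<times> int) \<times> (nat \<Rightarrow> 'a \<times> int)"
  have \<Delta>: "\<Delta> n (x, \<omega>) = max (real (climb x) - max_climb n \<omega>) (- real_of_int (snd x))" for n x \<omega>
    by (simp add: \<Delta>_def max_def)
  have i1: "integrable (\<mu> \<Otimes>\<^sub>M \<Omega>) (\<lambda>p. max_climb (Suc n) (case_nat (fst p) (snd p)))"
    and e1: "(\<integral>p. max_climb (Suc n) (case_nat (fst p) (snd p)) \<partial>(\<mu> \<Otimes>\<^sub>M \<Omega>)) = (\<integral>\<omega>. max_climb (Suc n) \<omega> \<partial>\<Omega>)" for n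
  proof -
    have "integrable (distr (\<mu> \<Otimes>\<^sub>M \<Omega>) \<Omega> (\<lambda>(x, \<omega>). case_nat x \<omega>)) (max_climb (Suc n))"
      unfolding Sq.PiM_iter by (rule max_climb_integrable)
    from integrable_distr[OF nat_case_measurable this]
    show "integrable (\<mu> \<Otimes>\<^sub>M \<Omega>) (\<lambda>p. max_climb (Suc n) (case_nat (fst p) (snd p)))" by (simp only: case_prod_unfold)
    have "(\<integral>\<omega>. max_climb (Suc n) \<omega> \<partial>\<Omega>) = (\<integral>\<omega>. max_climb (Suc n) \<omega> \<partial>distr (\<mu> \<Otimes>\<^sub>M \<Omega>) \<Omega> (\<lambda>(x, \<omega>). case_nat x \<omega>))"
      unfolding Sq.PiM_iter ..
    also have "\<dots> = (\<integral>p. max_climb (Suc n) (case p of (x, \<omega>) \<Rightarrow> case_nat x \<omega>) \<partial>(\<mu> \<Otimes>\<^sub>M \<Omega>))"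
      by (rule integral_distr[OF nat_case_measurable max_climb_measurable])
    finally show "(\<integral>p. max_climb (Suc n) (case_nat (fst p) (snd p)) \<partial>(\<mu> \<Otimes>\<^sub>M \<Omega>)) = (\<integral>\<omega>. max_climb (Suc n) \<omega> \<partial>\<Omega>)"
      by (simp only: case_prod_unfold)
  qed
  have dsnd: "distr (\<mu> \<Otimes>\<^sub>M \<Omega>) \<Omega> snd = \<Omega>"
  proof (rule measure_eqI)
    fix A assume "A \<in> sets (distr (\<mu> \<Otimes>\<^sub>M \<Omega>) \<Omega> snd)"
    then have A: "A \<in> sets \<Omega>" by simp
    have "snd -` A \<inter> space (\<mu> \<Otimes>\<^sub>M \<Omega>) = space \<mu> \<times> A"
      using sets.sets_into_space[OF A] by (auto simp: space_pair_measure)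
    then show "emeasure (distr (\<mu> \<Otimes>\<^sub>M \<Omega>) \<Omega> snd) A = emeasure \<Omega> A"
      using A sets.top[of \<mu>] R.mu.emeasure_space_1
      by (simp add: emeasure_distr Sq.P.emeasure_pair_measure_Times del: R.space_mu R.sets_mu)
  qed simp
  have dfst: "distr (\<mu> \<Otimes>\<^sub>M \<Omega>) \<mu> fst = \<mu>"
    by (rule Sq.P.distr_pair_fst)
  have i2: "integrable (\<mu> \<Otimes>\<^sub>M \<Omega>) (\<lambda>p. h (snd p))"
    and e2: "(\<integral>p. h (snd p) \<partial>(\<mu> \<Otimes>\<^sub>M \<Omega>)) = (\<integral>\<omega>. h \<omega> \<partial>\<Omega>)" if h: "integrable \<Omega> h" for h :: "_ \<Rightarrow> real"
  proof -
    show "integrable (\<mu> \<Otimes>\<^sub>M \<Omega>) (\<lambda>p. h (snd p))"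
      using h by (intro integrable_distr[OF measurable_snd]) (simp add: dsnd)
    have "(\<integral>\<omega>. h \<omega> \<partial>\<Omega>) = (\<integral>\<omega>. h \<omega> \<partial>distr (\<mu> \<Otimes>\<^sub>M \<Omega>) \<Omega> snd)" by (simp add: dsnd)
    also have "\<dots> = (\<integral>p. h (snd p) \<partial>(\<mu> \<Otimes>\<^sub>M \<Omega>))"
      using h by (intro integral_distr) auto
    finally show "(\<integral>p. h (snd p) \<partial>(\<mu> \<Otimes>\<^sub>M \<Omega>)) = (\<integral>\<omega>. h \<omega> \<partial>\<Omega>)" by simp
  qed
  have i3: "integrable (\<mu> \<Otimes>\<^sub>M \<Omega>) (\<lambda>p. h (fst p))"
    and e3: "(\<integral>p. h (fst p) \<partial>(\<mu> \<Otimes>\<^sub>M \<Omega>)) = (\<integral>x. h x \<partial>\<mu>)" if h: "integrable \<mu> h" for h :: "_ \<Rightarrow> real"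
  proof -
    show "integrable (\<mu> \<Otimes>\<^sub>M \<Omega>) (\<lambda>p. h (fst p))"
      using h by (intro integrable_distr[OF measurable_fst]) (simp add: dfst)
    have "(\<integral>x. h x \<partial>\<mu>) = (\<integral>x. h x \<partial>distr (\<mu> \<Otimes>\<^sub>M \<Omega>) \<mu> fst)" by (simp add: dfst)
    also have "\<dots> = (\<integral>p. h (fst p) \<partial>(\<mu> \<Otimes>\<^sub>M \<Omega>))"
      using h by (intro integral_distr) auto
    finally show "(\<integral>p. h (fst p) \<partial>(\<mu> \<Otimes>\<^sub>M \<Omega>)) = (\<integral>x. h x \<partial>\<mu>)" by simp
  qed
  have pos: "0 \<le> (\<integral>p. \<Delta> n p \<partial>(\<mu> \<Otimes>\<^sub>M \<Omega>))" for n
  proof -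
    have "(\<integral>p. \<Delta> n p \<partial>(\<mu> \<Otimes>\<^sub>M \<Omega>)) = (\<integral>\<omega>. max_climb (Suc n) \<omega> \<partial>\<Omega>) - (\<integral>\<omega>. max_climb n \<omega> \<partial>\<Omega>)"
      unfolding \<Delta>_def by (subst Bochner_Integration.integral_diff[OF i1 i2[OF max_climb_integrable]])
        (simp only: e1 e2[OF max_climb_integrable])
    moreover have "(\<integral>\<omega>. max_climb n \<omega> \<partial>\<Omega>) \<le> (\<integral>\<omega>. max_climb (Suc n) \<omega> \<partial>\<Omega>)"
      by (intro integral_mono max_climb_integrable max_climb_mono)
    ultimately show ?thesis by simp
  qed
  let ?w = "\<lambda>x. real (climb x) + \<bar>real_of_int (snd x)\<bar>"
  have wi: "integrable \<mu> ?w" using integrable_climb integrable_snd by (intro Bochner_Integration.integrable_add) auto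
  have "(\<lambda>n. \<integral>p. \<Delta> n p \<partial>(\<mu> \<Otimes>\<^sub>M \<Omega>)) \<longlonglongrightarrow> (\<integral>p. - real_of_int (snd (fst p)) \<partial>(\<mu> \<Otimes>\<^sub>M \<Omega>))"
  proof (rule integral_dominated_convergence[where w = "\<lambda>p. ?w (fst p)"])
    show "(\<lambda>p. - real_of_int (snd (fst p))) \<in> borel_measurable (\<mu> \<Otimes>\<^sub>M \<Omega>)"
      using i3[OF integrable_snd] by (intro borel_measurable_uminus borel_measurable_integrable)
    show "\<Delta> n \<in> borel_measurable (\<mu> \<Otimes>\<^sub>M \<Omega>)" for n
      unfolding \<Delta>_def[abs_def] using i1[of n] i2[OF max_climb_integrable[of n]]
      by (intro borel_measurable_diff borel_measurable_integrable)
    show "integrable (\<mu> \<Otimes>\<^sub>M \<Omega>) (\<lambda>p. ?w (fst p))" by (rule i3[OF wi])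
    show "AE p in \<mu> \<Otimes>\<^sub>M \<Omega>. norm (\<Delta> n p) \<le> ?w (fst p)" for n
    proof (rule AE_I2)
      fix p :: "('a \<times> int) \<times> (nat \<Rightarrow> 'a \<times> int)"
      obtain x \<omega> where "p = (x, \<omega>)" by (cases p)
      then show "norm (\<Delta> n p) \<le> ?w (fst p)" using max_climb_nonneg[of n \<omega>] by (auto simp: \<Delta> max_def)
    qed
    have "AE p in \<mu> \<Otimes>\<^sub>M \<Omega>. \<forall>c. \<exists>n. c < max_climb n (snd p)"
    proof -
      have "AE \<omega> in distr (\<mu> \<Otimes>\<^sub>M \<Omega>) \<Omega> snd. \<forall>c. \<exists>n. c < max_climb n \<omega>" unfolding dsnd by (rule unb)
      then show ?thesis by (rule AE_distrD[OF measurable_snd])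
    qed
    then show "AE p in \<mu> \<Otimes>\<^sub>M \<Omega>. (\<lambda>n. \<Delta> n p) \<longlonglongrightarrow> - real_of_int (snd (fst p))"
    proof eventually_elim
      fix p :: "('a \<times> int) \<times> (nat \<Rightarrow> 'a \<times> int)"
      assume p: "\<forall>c. \<exists>n. c < max_climb n (snd p)"
      obtain x \<omega> where xo: "p = (x, \<omega>)" by (cases p)
      obtain n0 where n0: "real (climb x) + real_of_int (snd x) < max_climb n0 \<omega>" using p xo by auto
      have "\<Delta> n p = - real_of_int (snd x)" if "n0 \<le> n" for n
      proof -
        have "max_climb n0 \<omega> \<le> max_climb n \<omega>"
          using that by (rule lift_Suc_mono_le[of "\<lambda>n. max_climb n \<omega>", rotated]) (rule max_climb_mono)
        then show ?thesis using n0 by (simp add: xo \<Delta>)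
      qed
      then show "(\<lambda>n. \<Delta> n p) \<longlonglongrightarrow> - real_of_int (snd (fst p))"
        using xo by (intro tendsto_eventually) (auto simp: eventually_sequentially)
    qed
  qed
  then have "0 \<le> (\<integral>p. - real_of_int (snd (fst p)) \<partial>(\<mu> \<Otimes>\<^sub>M \<Omega>))"
    by (rule LIMSEQ_le_const) (use pos in auto)
  moreover have "(\<integral>p. - real_of_int (snd (fst p)) \<partial>(\<mu> \<Otimes>\<^sub>M \<Omega>)) = - (\<integral>x. real_of_int (snd x) \<partial>\<mu>)"
    using e3[OF integrable_snd] by simp
  ultimately show False using mean by simp
qed

text \<open>The elements that move the base vertex to a descendant of the vertex represented by \<open>(u, m)\<close>.\<close>

definition subtree :: "'a \<Rightarrow> int \<Rightarrow> ('a \<times> int) set" where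
  "subtree u m = {g \<in> carrier H. m \<le> snd g \<and> inv u \<otimes> fst g \<in> B m}"

definition ends_in :: "'a \<Rightarrow> int \<Rightarrow> 'a \<times> int \<Rightarrow> (nat \<Rightarrow> 'a \<times> int) \<Rightarrow> bool" where
  "ends_in u m g \<omega> \<longleftrightarrow> (\<exists>N. \<forall>n\<ge>N. g \<otimes>\<^bsub>H\<^esub> walk H \<omega> n \<in> subtree u m)"

definition hit :: "'a \<Rightarrow> int \<Rightarrow> 'a \<times> int \<Rightarrow> real" where
  "hit u m g = measure \<Omega> {\<omega> \<in> space \<Omega>. ends_in u m g \<omega>}"

lemma subtree_sets: "u \<in> D \<Longrightarrow> subtree u m \<in> sets (borel_of TH)"
proof -
  assume u: "u \<in> D"
  have "continuous_map TH T (\<lambda>g. inv u \<otimes> fst g)"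
    using u continuous_fst_TH by (intro continuous_mult_T) (auto simp: topspace_T D_carrier)
  from closedin_continuous_map_preimage[OF this B_closed]
  have "closedin TH {g \<in> topspace TH. inv u \<otimes> fst g \<in> B m}" .
  moreover have "closedin TH {g \<in> topspace TH. snd g \<in> {m..}}"
    by (rule closedin_continuous_map_preimage[OF continuous_snd_TH]) simp
  moreover have "subtree u m = {g \<in> topspace TH. inv u \<otimes> fst g \<in> B m} \<inter> {g \<in> topspace TH. snd g \<in> {m..}}"
    by (auto simp: subtree_def topspace_TH)
  ultimately show ?thesis by (auto intro: closedin_borel_of)
qed

lemma ends_in_measurable:
  assumes u: "u \<in> D"
  shows "Measurable.pred (borel_of TH \<Otimes>\<^sub>M \<Omega>) (\<lambda>p. ends_in u m (fst p) (snd p))"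
proof -
  have m: "(\<lambda>p. fst p \<otimes>\<^bsub>H\<^esub> walk H (snd p) n) \<in> measurable (borel_of TH \<Otimes>\<^sub>M \<Omega>) (borel_of TH)" for n
    using measurable_compose[OF measurable_snd walk_measurable]
    by (intro R.mult_measurable' measurable_fst) 
  have [measurable]: "Measurable.pred (borel_of TH \<Otimes>\<^sub>M \<Omega>) (\<lambda>p. fst p \<otimes>\<^bsub>H\<^esub> walk H (snd p) n \<in> subtree u m)" for n
    using measurable_sets[OF m subtree_sets[OF u, of m]] by (simp add: pred_def vimage_def Int_def conj_commute)
  show ?thesis unfolding ends_in_def by measurable
qed

lemma ends_in_event: "u \<in> D \<Longrightarrow> g \<in> carrier H \<Longrightarrow> {\<omega> \<in> space \<Omega>. ends_in u m g \<omega>} \<in> sets \<Omega>"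
proof -
  assume u: "u \<in> D" and g: "g \<in> carrier H"
  have "(\<lambda>\<omega>. (g, \<omega>)) \<in> measurable \<Omega> (borel_of TH \<Otimes>\<^sub>M \<Omega>)" using g by (intro measurable_Pair1') simp
  from measurable_compose[OF this ends_in_measurable[OF u]]
  show ?thesis by (simp add: pred_def)
qed

lemma hit_bounds: "0 \<le> hit u m g" "hit u m g \<le> 1"
  using Sq.P.prob_le_1 by (simp_all add: hit_def)

lemma hit_eq_integral:
  assumes "u \<in> D" "g \<in> carrier H"
  shows "hit u m g = (\<integral>\<omega>. indicator {p. ends_in u m (fst p) (snd p)} (g, \<omega>) \<partial>\<Omega>)"
proof -
  have "hit u m g = (\<integral>\<omega>. indicator {\<omega> \<in> space \<Omega>. ends_in u m g \<omega>} \<omega> \<partial>\<Omega>)"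
    using ends_in_event[OF assms] by (simp add: hit_def)
  also have "\<dots> = (\<integral>\<omega>. indicator {p. ends_in u m (fst p) (snd p)} (g, \<omega>) \<partial>\<Omega>)"
    by (intro Bochner_Integration.integral_cong) (auto simp: indicator_def)
  finally show ?thesis .
qed

lemma ends_in_indicator_measurable:
  "u \<in> D \<Longrightarrow> (\<lambda>p. indicator {p. ends_in u m (fst p) (snd p)} p :: real) \<in> borel_measurable (borel_of TH \<Otimes>\<^sub>M \<Omega>)"
  using ends_in_measurable[of u m] by (simp add: borel_measurable_indicator_iff pred_def Int_def conj_commute)

lemma hit_measurable: "u \<in> D \<Longrightarrow> hit u m \<in> borel_measurable (borel_of TH)"
proof -
  assume u: "u \<in> D"
  have "(\<lambda>g. \<integral>\<omega>. (indicator {p. ends_in u m (fst p) (snd p)} (g, \<omega>) :: real) \<partial>\<Omega>) \<in> borel_measurable (borel_of TH)"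
  proof (rule Sq.P.borel_measurable_lebesgue_integral)
    show "(\<lambda>(g, \<omega>). indicator {p. ends_in u m (fst p) (snd p)} (g, \<omega>) :: real) \<in> borel_measurable (borel_of TH \<Otimes>\<^sub>M \<Omega>)"
      using ends_in_indicator_measurable[OF u, of m] by (simp add: case_prod_unfold)
  qed
  then show ?thesis
    by (rule measurable_cong[THEN iffD1, rotated]) (simp add: hit_eq_integral u)
qed

text \<open>Where the walk ends up does not depend on its first increment, except through the point from which the
  shifted walk starts.\<close>

lemma hit_harmonic: "u \<in> D \<Longrightarrow> R.harmonic_on_\<Gamma> 1 (hit u m)"
  unfolding R.harmonic_on_\<Gamma>_def
proof (intro conjI allI ballI hit_measurable)
  assume u: "u \<in> D"
  fix g show "\<bar>hit u m g\<bar> \<le> 1" using hit_bounds[of u m g] by simp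
next
  assume u: "u \<in> D"
  fix g assume "g \<in> \<Gamma>"
  then have g: "g \<in> carrier H" by (rule R.\<Gamma>_carrier)
  let ?I = "\<lambda>g \<omega>. indicator {p. ends_in u m (fst p) (snd p)} (g, \<omega>) :: real"
  have tail: "?I g (case_nat x \<omega>) = ?I (g \<otimes>\<^bsub>H\<^esub> x) \<omega>" if x: "x \<in> carrier H" and \<omega>: "\<omega> \<in> space \<Omega>" for x \<omega>
  proof -
    have c: "case_nat x \<omega> \<in> space \<Omega>" using x \<omega> by (auto simp: space_\<Omega> split: nat.split)
    have w: "g \<otimes>\<^bsub>H\<^esub> walk H (case_nat x \<omega>) (Suc n) = g \<otimes>\<^bsub>H\<^esub> x \<otimes>\<^bsub>H\<^esub> walk H \<omega> n" for n
      using walk_shift[OF c, of n] walk_closed[OF \<omega>, of n] x g by (simp add: H.m_assoc del: walk.simps)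
    have "ends_in u m g (case_nat x \<omega>) \<longleftrightarrow> ends_in u m (g \<otimes>\<^bsub>H\<^esub> x) \<omega>"
    proof
      assume "ends_in u m g (case_nat x \<omega>)"
      then obtain N where "\<And>n. n \<ge> N \<Longrightarrow> g \<otimes>\<^bsub>H\<^esub> walk H (case_nat x \<omega>) n \<in> subtree u m" by (auto simp: ends_in_def)
      then have "\<And>n. n \<ge> N \<Longrightarrow> g \<otimes>\<^bsub>H\<^esub> x \<otimes>\<^bsub>H\<^esub> walk H \<omega> n \<in> subtree u m" unfolding w[symmetric] by (meson le_SucI)
      then show "ends_in u m (g \<otimes>\<^bsub>H\<^esub> x) \<omega>" by (auto simp: ends_in_def)
    next
      assume "ends_in u m (g \<otimes>\<^bsub>H\<^esub> x) \<omega>"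
      then obtain N where N: "\<And>n. n \<ge> N \<Longrightarrow> g \<otimes>\<^bsub>H\<^esub> x \<otimes>\<^bsub>H\<^esub> walk H \<omega> n \<in> subtree u m" by (auto simp: ends_in_def)
      have "g \<otimes>\<^bsub>H\<^esub> walk H (case_nat x \<omega>) n \<in> subtree u m" if "n \<ge> Suc N" for n
      proof -
        obtain k where "n = Suc k" using Suc_le_D[OF \<open>n \<ge> Suc N\<close>] by blast
        moreover have "k \<ge> N" using calculation \<open>n \<ge> Suc N\<close> by simp
        ultimately show ?thesis using N[of k] w[of k] by simp
      qed
      then show "ends_in u m g (case_nat x \<omega>)" unfolding ends_in_def by blast
    qed
    then show ?thesis by (simp add: indicator_def)
  qed
  have gm: "(\<lambda>\<omega>. ?I g \<omega>) \<in> borel_measurable \<Omega>"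
  proof -
    have "(\<lambda>\<omega>. (g, \<omega>)) \<in> measurable \<Omega> (borel_of TH \<Otimes>\<^sub>M \<Omega>)" using g by (intro measurable_Pair1') simp
    from measurable_compose[OF this ends_in_indicator_measurable[OF u, of m]] show ?thesis .
  qed
  interpret P: pair_prob_space \<mu> \<Omega> ..
  have "hit u m g = (\<integral>\<omega>. ?I g \<omega> \<partial>distr (\<mu> \<Otimes>\<^sub>M \<Omega>) \<Omega> (\<lambda>(x, \<omega>). case_nat x \<omega>))"
    unfolding Sq.PiM_iter by (rule hit_eq_integral[OF u g])
  also have "\<dots> = (\<integral>p. ?I g (case p of (x, \<omega>) \<Rightarrow> case_nat x \<omega>) \<partial>(\<mu> \<Otimes>\<^sub>M \<Omega>))"
    by (rule integral_distr[OF nat_case_measurable gm])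
  also have "\<dots> = (\<integral>x. (\<integral>\<omega>. ?I g (case_nat x \<omega>) \<partial>\<Omega>) \<partial>\<mu>)"
    using measurable_compose[OF nat_case_measurable gm]
    by (subst P.integral_fst'[symmetric]) (auto intro!: P.P.integrable_const_bound[where B = 1] simp: indicator_def)
  also have "\<dots> = (\<integral>x. hit u m (g \<otimes>\<^bsub>H\<^esub> x) \<partial>\<mu>)"
    using tail g by (intro Bochner_Integration.integral_cong refl)
      (auto simp: hit_eq_integral[OF u] intro!: Bochner_Integration.integral_cong)
  finally show "hit u m g = (\<integral>x. hit u m (g \<otimes>\<^bsub>H\<^esub> x) \<partial>\<mu>)" .
qed

lemma subtree_cong: "u \<in> D \<Longrightarrow> u' \<in> D \<Longrightarrow> inv u \<otimes> u' \<in> B m \<Longrightarrow> subtree u m = subtree u' m"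
proof -
  have sub: "subtree u m \<subseteq> subtree u' m" if u: "u \<in> D" "u' \<in> D" "inv u \<otimes> u' \<in> B m" for u u'
  proof
    fix g assume g: "g \<in> subtree u m"
    then have gc: "fst g \<in> carrier G" by (auto simp: subtree_def carrier_H D_carrier)
    have "inv (inv u \<otimes> u') \<otimes> (inv u \<otimes> fst g) \<in> B m"
      using B_mult[OF B_inv[OF u(3)]] g by (simp add: subtree_def)
    moreover have "inv (inv u \<otimes> u') \<otimes> (inv u \<otimes> fst g) = inv u' \<otimes> fst g"
      using u gc by (simp add: inv_mult_group D_carrier m_assoc) (simp add: D_carrier m_assoc[symmetric])
    ultimately show "g \<in> subtree u' m" using g by (simp add: subtree_def)
  qed
  assume u: "u \<in> D" "u' \<in> D" "inv u \<otimes> u' \<in> B m"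
  have "inv (inv u \<otimes> u') \<in> B m" using u(3) by (rule B_inv)
  then have "inv u' \<otimes> u \<in> B m" using u by (simp add: inv_mult_group D_carrier)
  then show ?thesis using sub u by blast
qed

lemma subtree_antimono: "m' \<le> m \<Longrightarrow> subtree u m \<subseteq> subtree u m'"
  using B_antimono[of m' m] by (auto simp: subtree_def)

lemma subtree_disjoint:
  assumes u: "u \<in> D" "u' \<in> D" and ne: "inv u \<otimes> u' \<notin> B m"
  shows "subtree u m \<inter> subtree u' m = {}"
proof (rule ccontr)
  assume "subtree u m \<inter> subtree u' m \<noteq> {}"
  then obtain g where g: "g \<in> carrier H" "inv u \<otimes> fst g \<in> B m" "inv u' \<otimes> fst g \<in> B m"
    by (auto simp: subtree_def)
  have gc: "fst g \<in> carrier G" using g(1) by (auto simp: carrier_H D_carrier)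
  have "(inv u \<otimes> fst g) \<otimes> inv (inv u' \<otimes> fst g) \<in> B m" using g by (intro B_mult[OF _ B_inv])
  moreover have "(inv u \<otimes> fst g) \<otimes> inv (inv u' \<otimes> fst g) = inv u \<otimes> u'"
  proof -
    have "fst g \<otimes> (inv (fst g) \<otimes> u') = u'" using u gc by (simp add: m_assoc[symmetric] D_carrier)
    then show ?thesis using u gc by (simp add: inv_mult_group D_carrier m_assoc)
  qed
  ultimately show False using ne by simp
qed

lemma subtree_translate:
  assumes h: "(w, z) \<in> carrier H" and u: "u \<in> D" and g: "g \<in> carrier H"
  shows "(w, z) \<otimes>\<^bsub>H\<^esub> g \<in> subtree (w \<otimes> pw z u) (m + z) \<longleftrightarrow> g \<in> subtree u m"
proof -
  obtain v n where vn: "g = (v, n)" "v \<in> D" using g by (auto simp: carrier_H)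
  have w: "w \<in> D" using h by (simp add: carrier_H)
  have "inv (w \<otimes> pw z u) \<otimes> (w \<otimes> pw z v) = pw z (inv u \<otimes> v)"
    using u w vn by (simp add: D_carrier inv_mult_group pw_mult pw_inv m_assoc) (simp add: D_carrier m_assoc[symmetric])
  then have "inv (w \<otimes> pw z u) \<otimes> (w \<otimes> pw z v) \<in> B (m + z) \<longleftrightarrow> inv u \<otimes> v \<in> B m"
    using u vn by (simp add: pw_in_B D_carrier)
  then show ?thesis
    using H.m_closed[OF h g] g by (simp add: subtree_def vn mult_H)
qed

lemma hit_mono:
  assumes "u \<in> D" "u' \<in> D" "g \<in> carrier H" "subtree u m \<subseteq> subtree u' m'"
  shows "hit u m g \<le> hit u' m' g"
  unfolding hit_def
proof (rule Sq.P.finite_measure_mono[OF _ ends_in_event[OF assms(2,3)]])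
  have "ends_in u' m' g \<omega>" if "ends_in u m g \<omega>" for \<omega>
    using \<open>ends_in u m g \<omega>\<close> assms(4) unfolding ends_in_def by (meson subsetD)
  then show "{\<omega> \<in> space \<Omega>. ends_in u m g \<omega>} \<subseteq> {\<omega> \<in> space \<Omega>. ends_in u' m' g \<omega>}" by blast
qed

lemma hit_translate:
  assumes h: "(w, z) \<in> carrier H" and u: "u \<in> D"
  shows "hit (w \<otimes> pw z u) (m + z) (w, z) = hit u m \<one>\<^bsub>H\<^esub>"
proof -
  have "ends_in (w \<otimes> pw z u) (m + z) (w, z) \<omega> \<longleftrightarrow> ends_in u m \<one>\<^bsub>H\<^esub> \<omega>" if \<omega>: "\<omega> \<in> space \<Omega>" for \<omega>
    unfolding ends_in_def using subtree_translate[OF h u walk_closed[OF \<omega>]] walk_closed[OF \<omega>] by simp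
  then have "{\<omega> \<in> space \<Omega>. ends_in (w \<otimes> pw z u) (m + z) (w, z) \<omega>} = {\<omega> \<in> space \<Omega>. ends_in u m \<one>\<^bsub>H\<^esub> \<omega>}"
    by (intro Collect_cong conj_cong refl)
  then show ?thesis by (simp only: hit_def)
qed

text \<open>The probabilities of ending in a subtree, for the walk from the identity, form a measure \<open>\<nu>\<close> on the
  ends other than \<open>\<omega>\<close>. It is nonzero because climbs stay bounded with positive probability. If
  bounded harmonic functions are constant, \<open>\<nu>\<close> is invariant under \<open>\<Gamma>\<close>. Since the mean is positive, \<open>\<Gamma>\<close>
  contains an element of positive translation; it contracts towards a fixed point \<open>u\<close>, so every subtree
  containing the end of \<open>u\<close> carries the full mass \<open>a\<close>. Were \<open>u\<close> moved by an element of \<open>\<Gamma>\<close>, there would be two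
  disjoint subtrees of mass \<open>a\<close> inside one subtree of mass at most \<open>a\<close>.\<close>

theorem constant_harmonic_imp_exceptional:
  assumes mean: "0 < (\<integral>g. real_of_int (snd g) \<partial>\<mu>)"
    and const: "\<And>f g. R.harmonic_on_\<Gamma> 1 f \<Longrightarrow> g \<in> \<Gamma> \<Longrightarrow> f g = f \<one>\<^bsub>H\<^esub>"
  shows "\<not> non_exceptional G \<alpha> V \<Gamma>"
proof -
  define \<nu> where "\<nu> u m = hit u m \<one>\<^bsub>H\<^esub>" for u m
  have \<Gamma>c: "h \<in> \<Gamma> \<Longrightarrow> h \<in> carrier H" for h by (rule R.\<Gamma>_carrier)
  have \<Gamma>D: "(w, z) \<in> \<Gamma> \<Longrightarrow> w \<in> D" for w z using \<Gamma>c[of "(w, z)"] by (simp add: carrier_H)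
  have act_D: "w \<otimes> pw z u \<in> D" if "(w, z) \<in> \<Gamma>" "u \<in> D" for w z u
    by (rule D_mult[OF \<Gamma>D[OF that(1)] pw_D[OF that(2)]])
  have inv\<nu>: "\<nu> (w \<otimes> pw z u) (m + z) = \<nu> u m" if h: "(w, z) \<in> \<Gamma>" and u: "u \<in> D" for w z u m
    using const[OF hit_harmonic[OF act_D[OF h u]] h, of "m + z"] hit_translate[OF \<Gamma>c[OF h] u, of m]
    by (simp add: \<nu>_def)
  have \<nu>_mono: "\<nu> u m \<le> \<nu> u' m'" if "u \<in> D" "u' \<in> D" "subtree u m \<subseteq> subtree u' m'" for u u' m m'
    unfolding \<nu>_def using that by (intro hit_mono) auto
  have \<nu>_cong: "\<nu> u m = \<nu> u' m" if "u \<in> D" "u' \<in> D" "inv u \<otimes> u' \<in> B m" for u u' m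
    using subtree_cong[OF that] by (simp add: \<nu>_def hit_def ends_in_def)
  \<comment> \<open>a bounded climb means staying below a single ancestor of the base vertex, hence in one subtree\<close>
  have "\<exists>N::nat. 0 < \<nu> \<one> (- int N)"
  proof (rule ccontr)
    assume "\<not> ?thesis"
    then have z: "\<nu> \<one> (- int N) = 0" for N using hit_bounds(1)[of \<one> "- int N" "\<one>\<^bsub>H\<^esub>"] by (auto simp: \<nu>_def not_less intro: antisym)
    have "AE \<omega> in \<Omega>. \<not> ends_in \<one> (- int N) \<one>\<^bsub>H\<^esub> \<omega>" for N
    proof -
      have E: "{\<omega> \<in> space \<Omega>. ends_in \<one> (- int N) \<one>\<^bsub>H\<^esub> \<omega>} \<in> sets \<Omega>" by (intro ends_in_event D_one H.one_closed)
      have "emeasure \<Omega> {\<omega> \<in> space \<Omega>. ends_in \<one> (- int N) \<one>\<^bsub>H\<^esub> \<omega>} = 0"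
        using z[of N] by (simp add: \<nu>_def hit_def Sq.P.emeasure_eq_measure)
      then show ?thesis using E by (subst AE_iff_measurable[OF E]) auto
    qed
    then have "AE \<omega> in \<Omega>. \<forall>N. \<not> ends_in \<one> (- int N) \<one>\<^bsub>H\<^esub> \<omega>" by (simp add: AE_all_countable)
    moreover have "AE \<omega> in \<Omega>. \<omega> \<in> space \<Omega>" by (rule AE_space)
    ultimately have "AE \<omega> in \<Omega>. \<forall>c. \<exists>n. c < max_climb n \<omega>"
    proof eventually_elim
      fix \<omega> assume no: "\<forall>N. \<not> ends_in \<one> (- int N) \<one>\<^bsub>H\<^esub> \<omega>" and \<omega>: "\<omega> \<in> space \<Omega>"
      show "\<forall>c. \<exists>n. c < max_climb n \<omega>"
      proof (rule allI, rule ccontr)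
        fix c assume "\<not> (\<exists>n. c < max_climb n \<omega>)"
        then have c: "max_climb n \<omega> \<le> c" for n by (auto simp: not_less)
        obtain N :: nat where N: "c \<le> real N" using real_arch_simple by blast
        have "\<one>\<^bsub>H\<^esub> \<otimes>\<^bsub>H\<^esub> walk H \<omega> n \<in> subtree \<one> (- int N)" for n
        proof -
          have wc: "walk H \<omega> n \<in> carrier H" by (rule walk_closed[OF \<omega>])
          have "climb (walk H \<omega> n) \<le> N" using climb_walk_le[OF \<omega>, of n] c[of n] N by linarith
          then have "- snd (walk H \<omega> n) \<le> int N \<and> fst (walk H \<omega> n) \<in> B (- int N)" by (simp add: climb_le_iff[OF wc])
          then show ?thesis using wc by (auto simp: subtree_def B_carrier)
        qed
        then show False using no by (auto simp: ends_in_def)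
      qed
    qed
    then show False using max_climb_bounded_with_positive_probability[OF mean] by simp
  qed
  then obtain N0 :: nat where N0: "0 < \<nu> \<one> (- int N0)" by blast
  have base_mono: "\<nu> \<one> m \<le> \<nu> \<one> m'" if "m' \<le> m" for m m'
    using that by (intro \<nu>_mono D_one subtree_antimono)
  \<comment> \<open>the subtrees below the ancestors of the base vertex exhaust the tree, so this is the total mass\<close>
  define a where "a = (SUP N::nat. \<nu> \<one> (- int N))"
  have bdd: "bdd_above (range (\<lambda>N::nat. \<nu> \<one> (- int N)))"
  proof (rule bdd_aboveI[of _ 1])
    fix x assume "x \<in> range (\<lambda>N::nat. \<nu> \<one> (- int N))"
    then obtain N :: nat where "x = hit \<one> (- int N) \<one>\<^bsub>H\<^esub>" by (auto simp: \<nu>_def)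
    then show "x \<le> 1" using hit_bounds(2) by metis
  qed
  have a_upper: "\<nu> \<one> (- int N) \<le> a" for N :: nat
    unfolding a_def by (rule cSUP_upper[OF _ bdd]) simp
  have a0: "0 < a" using N0 a_upper[of N0] by linarith
  have "\<exists>h\<in>\<Gamma>. 0 < snd h"
  proof (rule ccontr)
    assume "\<not> ?thesis"
    then have "AE g in \<mu>. real_of_int (snd g) \<le> 0"
      using AE_\<Gamma> by (auto elim!: eventually_mono simp: not_less)
    then have "(\<integral>g. real_of_int (snd g) \<partial>\<mu>) \<le> (\<integral>g. 0 \<partial>\<mu>)"
      by (intro integral_mono_AE integrable_snd) auto
    then show False using mean by simp
  qed
  then obtain w z where h: "(w, z) \<in> \<Gamma>" and z: "0 < z" by auto
  have wD: "w \<in> D" using h by (rule \<Gamma>D)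
  obtain N1 :: nat where N1: "w \<in> B (- int N1)" using wD by (rule D_E)
  \<comment> \<open>the affine map \<open>v \<mapsto> w \<alpha>\<^sup>z v\<close> is contracting; its fixed point is the limit of the iterates \<open>c\<close>, obtained from
    the nested compact cosets \<open>C\<close>\<close>
  define c where "c k = ((\<lambda>v. w \<otimes> pw z v) ^^ k) \<one>" for k :: nat
  have c_Suc: "c (Suc k) = w \<otimes> pw z (c k)" and c_0: "c 0 = \<one>" for k by (simp_all add: c_def)
  have cD: "c k \<in> D" for k by (induction k) (auto simp: c_0 c_Suc D_one intro!: act_D[OF h])
  have c_step: "inv (c k) \<otimes> c (Suc k) \<in> B (int k * z - int N1)" for k
  proof (induction k)
    case 0
    then show ?case using N1 wD by (simp add: c_Suc c_0 D_carrier)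
  next
    case (Suc k)
    have "inv (c (Suc k)) \<otimes> c (Suc (Suc k)) = pw z (inv (c k) \<otimes> c (Suc k))"
      using wD cD by (simp add: c_Suc[of k] c_Suc[of "Suc k"] D_carrier inv_mult_group pw_mult pw_inv m_assoc)
        (simp add: D_carrier m_assoc[symmetric] pw_mult)
    also have "\<dots> \<in> B (z + (int k * z - int N1))" using Suc pw_image_B by blast
    finally show ?case by (simp add: algebra_simps)
  qed
  define C where "C k = c k <# B (int k * z - int N1)" for k
  have C_dec: "C (Suc k) \<subseteq> C k" for k
  proof
    fix x assume "x \<in> C (Suc k)"
    then obtain b where b: "b \<in> B (int (Suc k) * z - int N1)" "x = c (Suc k) \<otimes> b" by (auto simp: C_def l_coset_def)
    have "b \<in> B (int k * z - int N1)" using b(1) z B_antimono[of "int k * z - int N1" "int (Suc k) * z - int N1"]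
      by (auto simp: algebra_simps)
    then have "(inv (c k) \<otimes> c (Suc k)) \<otimes> b \<in> B (int k * z - int N1)" using c_step by (rule B_mult[rotated])
    moreover have xc: "x \<in> carrier G" using b cD by (simp add: D_carrier B_carrier)
    moreover have "inv (c k) \<otimes> x = (inv (c k) \<otimes> c (Suc k)) \<otimes> b"
      using b cD[of k] cD[of "Suc k"] by (simp add: D_carrier B_carrier m_assoc)
    ultimately show "x \<in> C k" unfolding C_def using cD by (simp add: in_coset_B D_carrier)
  qed
  have C_compact: "compactin T (C k)" for k
  proof -
    have "C k = (\<lambda>b. c k \<otimes> b) ` B (int k * z - int N1)" by (auto simp: C_def l_coset_def)
    moreover have "continuous_map T T (\<lambda>b. c k \<otimes> b)"
      using cD by (intro continuous_mult_T) (auto simp: topspace_T D_carrier)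
    ultimately show ?thesis using image_compactin[OF B_compact] by metis
  qed
  have C_0: "C 0 = B (- int N1)" using B_carrier by (auto simp: C_def c_0 lcos_mult_one subset_iff)
  obtain u where u: "\<And>k. u \<in> C k"
  proof -
    have dec: "decseq C" using C_dec by (rule decseq_SucI)
    have C_le: "C k \<subseteq> B (- int N1)" for k using decseqD[OF dec, of 0 k] C_0 by simp
    have "(\<Inter>k. C k) \<noteq> {}"
    proof (rule compact_space_imp_nest[of "subtopology T (B (- int N1))" C])
      show "compact_space (subtopology T (B (- int N1)))" using B_compact by (simp add: compactin_subspace)
      show "closedin (subtopology T (B (- int N1))) (C k)" for k
        using compactin_imp_closedin[OF Hausdorff C_compact] C_le by (metis closedin_subset_topspace)
      show "C k \<noteq> {}" for k using B_one unfolding C_def l_coset_def by blast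
    qed (rule dec)
    then show ?thesis using that by blast
  qed
  have uB: "u \<in> B (- int N1)" using u[of 0] C_0 by simp
  have uD: "u \<in> D" using uB B_subset_D by blast
  have \<nu>_c: "\<nu> (c k) (int k * z - int N) = \<nu> \<one> (- int N)" for k N
  proof (induction k)
    case (Suc k)
    have "\<nu> (c (Suc k)) ((int k * z - int N) + z) = \<nu> (c k) (int k * z - int N)"
      unfolding c_Suc by (rule inv\<nu>[OF h cD])
    then show ?case using Suc by (simp add: algebra_simps)
  qed (simp add: c_0)
  have \<nu>_u: "\<nu> u (int k * z - int N) = \<nu> \<one> (- int N)" if N: "N1 \<le> N" for k N
  proof -
    have "inv (c k) \<otimes> u \<in> B (int k * z - int N1)"
      using u[of k] cD uD unfolding C_def by (simp add: in_coset_B D_carrier)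
    then have "inv (c k) \<otimes> u \<in> B (int k * z - int N)" using B_antimono[of "int k * z - int N" "int k * z - int N1"] N by auto
    then show ?thesis using \<nu>_cong[OF cD uD] \<nu>_c by metis
  qed
  have \<nu>_ge: "a \<le> \<nu> u m" for m
    unfolding a_def
  proof (rule cSUP_least)
    fix N :: nat
    define N' where "N' = max N N1"
    \<comment> \<open>\<open>k\<close> applications of the translation move the level \<open>- N'\<close> down to at least \<open>m\<close>\<close>
    define k where "k = nat (m + int N')"
    have "m + int N' \<le> int k" by (simp add: k_def)
    also have "int k \<le> int k * z" using mult_left_mono[of 1 z "int k"] z by simp
    finally have "m \<le> int k * z - int N'" by simp
    then have "\<nu> u (int k * z - int N') \<le> \<nu> u m" by (intro \<nu>_mono uD subtree_antimono)
    moreover have "\<nu> \<one> (- int N) \<le> \<nu> \<one> (- int N')" by (rule base_mono) (simp add: N'_def)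
    ultimately show "\<nu> \<one> (- int N) \<le> \<nu> u m" using \<nu>_u[of N' k] by (simp add: N'_def)
  qed simp
  show ?thesis
  proof (rule fixed_point_imp_exceptional[OF subgroup_\<Gamma> uD], rule ccontr)
    fix w' z' m assume h': "(w', z') \<in> \<Gamma>" and ne: "inv u \<otimes> (w' \<otimes> pw z' u) \<notin> B m"
    define u' where "u' = w' \<otimes> pw z' u"
    have u'D: "u' \<in> D" unfolding u'_def by (rule act_D[OF h' uD])
    have "\<nu> u' m = \<nu> u (m - z')" using inv\<nu>[OF h' uD, of "m - z'"] by (simp add: u'_def)
    then have ge: "a \<le> \<nu> u' m" "a \<le> \<nu> u m" using \<nu>_ge by simp_all
    have disj: "subtree u m \<inter> subtree u' m = {}"
      using subtree_disjoint[OF uD u'D] ne by (simp add: u'_def)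
    obtain n1 n2 :: nat where n: "u \<in> B (- int n1)" "u' \<in> B (- int n2)" using uD u'D D_E by metis
    define N where "N = max (max n1 n2) (nat (- m))"
    have Nm: "- int N \<le> m" "- int N \<le> - int n1" "- int N \<le> - int n2" by (auto simp: N_def)
    have sub: "subtree v m \<subseteq> subtree \<one> (- int N)" if v: "v \<in> D" "v \<in> B (- int N)" for v
    proof -
      have "subtree v (- int N) = subtree \<one> (- int N)"
        using v D_one B_inv[OF v(2)] by (intro subtree_cong) (simp_all add: D_carrier)
      then show ?thesis using subtree_antimono[OF Nm(1), of v] by simp
    qed
    let ?E = "\<lambda>v m. {\<omega> \<in> space \<Omega>. ends_in v m \<one>\<^bsub>H\<^esub> \<omega>}"
    have ev: "?E v m \<in> sets \<Omega>" if "v \<in> D" for v m using that by (rule ends_in_event) simp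
    have "\<nu> u m + \<nu> u' m = measure \<Omega> (?E u m \<union> ?E u' m)"
      unfolding \<nu>_def hit_def
    proof (rule Sq.P.finite_measure_Union[symmetric, OF ev[OF uD] ev[OF u'D]])
      have False if "ends_in u m \<one>\<^bsub>H\<^esub> \<omega>" "ends_in u' m \<one>\<^bsub>H\<^esub> \<omega>" for \<omega>
      proof -
        obtain k1 k2 where "\<And>n. n \<ge> k1 \<Longrightarrow> \<one>\<^bsub>H\<^esub> \<otimes>\<^bsub>H\<^esub> walk H \<omega> n \<in> subtree u m" 
          "\<And>n. n \<ge> k2 \<Longrightarrow> \<one>\<^bsub>H\<^esub> \<otimes>\<^bsub>H\<^esub> walk H \<omega> n \<in> subtree u' m" using \<open>ends_in u m \<one>\<^bsub>H\<^esub> \<omega>\<close> \<open>ends_in u' m \<one>\<^bsub>H\<^esub> \<omega>\<close> unfolding ends_in_def by blast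
        then have "\<one>\<^bsub>H\<^esub> \<otimes>\<^bsub>H\<^esub> walk H \<omega> (max k1 k2) \<in> subtree u m \<inter> subtree u' m" by simp
        then show False using disj by blast
      qed
      then show "?E u m \<inter> ?E u' m = {}" by blast
    qed
    also have "\<dots> \<le> measure \<Omega> (?E \<one> (- int N))"
    proof (rule Sq.P.finite_measure_mono[OF _ ev[OF D_one]])
      have "ends_in v m \<one>\<^bsub>H\<^esub> \<omega> \<Longrightarrow> ends_in \<one> (- int N) \<one>\<^bsub>H\<^esub> \<omega>" if v: "v \<in> D" "v \<in> B (- int N)" for v \<omega>
        unfolding ends_in_def using sub[OF v] by blast
      moreover have "u \<in> B (- int N)" "u' \<in> B (- int N)" using n Nm B_antimono by blast+
      ultimately show "?E u m \<union> ?E u' m \<subseteq> ?E \<one> (- int N)" using uD u'D by blast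
    qed
    also have "\<dots> \<le> a" using a_upper[of N] by (simp add: \<nu>_def hit_def)
    finally show False using ge a0 by linarith
  qed
qed

end

section \<open>The equivalence\<close>

theorem corollary4p0p7:
  fixes G :: "('a, 'm) monoid_scheme"
    and T :: "'a topology"
    and \<alpha> :: "'a \<Rightarrow> 'a"
    and V :: "'a set"
    and \<mu> :: "('a \<times> int) measure"
    and \<Gamma> :: "('a \<times> int) set"
  defines "H \<equiv> semidirect G \<alpha> V"
    and "TH \<equiv> semidirect_top G T \<alpha> V"
  assumes "tdlc_group G T"
    and "\<alpha> \<in> topological_auto G T"
    and "\<forall>n::nat. n > 0 \<longrightarrow> \<alpha> [^]\<^bsub>AutoGroup G\<^esub> n \<noteq> \<one>\<^bsub>AutoGroup G\<^esub>"
    and "aut_scale G T (inv\<^bsub>AutoGroup G\<^esub> \<alpha>) > 1"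
    and "compact_open_subgroup G T V"
    and "tidy G T \<alpha> V"
    and "second_countable TH"
    and "borel_prob TH \<mu>"
    and "\<Gamma> = TH closure_of (semigroup_generated H (support_of TH \<mu>))"
    and "subgroup \<Gamma> H" and "closedin TH \<Gamma>"
    and "non_exceptional G \<alpha> V \<Gamma>"
    and "aperiodic (H\<lparr>carrier := \<Gamma>\<rparr>) (subtopology TH \<Gamma>) (restrict_space \<mu> \<Gamma>)"
    and "spread_out H TH \<mu>"
    and "finite_first_moment G \<alpha> V \<mu>"
  shows "(\<integral>z. real_of_int z \<partial>distr \<mu> (count_space UNIV) eta) \<le> 0 \<longleftrightarrow>
     poisson_boundary_trivial (H\<lparr>carrier := \<Gamma>\<rparr>) (subtopology TH \<Gamma>) (restrict_space \<mu> \<Gamma>)"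
proof -
  interpret A: tdlc_automorphism G T \<alpha> V
    by (rule tdlc_automorphism.intro) fact+
  have AE: "AE x in \<mu>. x \<in> \<Gamma>"
    using AE_support_of[OF \<open>second_countable TH\<close> \<open>borel_prob TH \<mu>\<close>]
  proof eventually_elim
    fix x assume x: "x \<in> support_of TH \<mu>"
    have s: "support_of TH \<mu> \<subseteq> carrier H" by (auto simp: support_of_def H_def TH_def A.topspace_TH)
    have "y \<in> carrier H" if "y \<in> semigroup_generated H (support_of TH \<mu>)" for y
      using that by induction (use s A.H.m_closed in \<open>auto simp: H_def\<close>)
    then have "semigroup_generated H (support_of TH \<mu>) \<subseteq> \<Gamma>"
      unfolding assms(11) by (intro closure_of_subset) (auto simp: TH_def H_def A.topspace_TH)
    then show "x \<in> \<Gamma>" using semigroup_generated.incl[OF x] by blast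
  qed
  interpret W: tdlc_walk G T \<alpha> V \<mu> \<Gamma>
    using assms(9,10,12,13,17) AE unfolding H_def TH_def
    by (intro tdlc_walk.intro tdlc_walk_axioms.intro A.tdlc_automorphism_axioms)
  let ?G = "H\<lparr>carrier := \<Gamma>\<rparr>" and ?T = "subtopology TH \<Gamma>" and ?\<mu> = "restrict_space \<mu> \<Gamma>"
  have H: "H = semidirect G \<alpha> V" and TH: "TH = semidirect_top G T \<alpha> V" by (simp_all add: H_def TH_def)
  have \<Gamma>s: "\<Gamma> \<in> sets (borel_of TH)" using W.R.\<Gamma>_sets by (simp add: TH)
  have \<Gamma>\<mu>: "\<Gamma> \<in> sets \<mu>" using \<Gamma>s by (simp add: TH)
  have \<Gamma>sub: "\<Gamma> \<subseteq> topspace TH" using closedin_subset[OF assms(13)] .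
  have sT: "sets (borel_of ?T) = sets (restrict_space (borel_of TH) \<Gamma>)" by (rule sets_borel_of_subtopology[OF \<Gamma>s])
  have group: "group ?G" using A.H.subgroup_imp_group[of \<Gamma>] assms(12) by (simp add: H)
  have top: "topspace ?T = carrier ?G" using \<Gamma>sub by auto
  have em: "emeasure \<mu> \<Gamma> = 1"
    using W.R.mu.emeasure_eq_1_AE[OF \<Gamma>\<mu>] AE by simp
  have bp: "borel_prob ?T ?\<mu>"
    unfolding borel_prob_def
  proof
    show "prob_space ?\<mu>"
    proof (rule prob_spaceI)
      have sp: "space ?\<mu> = \<Gamma>" "\<Gamma> \<inter> space \<mu> = \<Gamma>"
        using sets.sets_into_space[OF \<Gamma>\<mu>] by (auto simp: space_restrict_space)
      show "emeasure ?\<mu> (space ?\<mu>) = 1"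
        unfolding sp(1) using em \<Gamma>\<mu> sp(2) by (subst emeasure_restrict_space) auto
    qed
    show "sets ?\<mu> = sets (borel_of ?T)"
      unfolding sT using W.R.sets_mu by (simp add: sets_restrict_space TH)
  qed
  have cap: "\<Gamma> \<inter> space \<mu> = \<Gamma>" "\<Gamma> \<inter> space (borel_of TH) = \<Gamma>"
    using sets.sets_into_space[OF \<Gamma>\<mu>] sets.sets_into_space[OF \<Gamma>s] by blast+
  have int_restrict: "(\<integral>x. f x \<partial>?\<mu>) = (\<integral>x. (if x \<in> \<Gamma> then f x else 0) \<partial>\<mu>)" for f :: "_ \<Rightarrow> real"
  proof -
    have "(\<integral>x. f x \<partial>?\<mu>) = (\<integral>x. indicator \<Gamma> x *\<^sub>R f x \<partial>\<mu>)"
      by (rule integral_restrict_space) (simp only: cap \<Gamma>\<mu>)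
    also have "\<dots> = (\<integral>x. (if x \<in> \<Gamma> then f x else 0) \<partial>\<mu>)"
      by (intro Bochner_Integration.integral_cong) (auto simp: indicator_def)
    finally show ?thesis .
  qed
  have "(\<forall>f. bounded_harmonic ?G ?T ?\<mu> f \<longrightarrow> (\<exists>c. \<forall>g\<in>\<Gamma>. f g = c)) \<longleftrightarrow>
    (\<integral>g. real_of_int (snd g) \<partial>\<mu>) \<le> 0"
  proof
    assume mean: "(\<integral>g. real_of_int (snd g) \<partial>\<mu>) \<le> 0"
    show "\<forall>f. bounded_harmonic ?G ?T ?\<mu> f \<longrightarrow> (\<exists>c. \<forall>g\<in>\<Gamma>. f g = c)"
    proof (intro allI impI)
      fix f assume f: "bounded_harmonic ?G ?T ?\<mu> f"
      \<comment> \<open>extended by zero, \<open>f\<close> can be integrated against measures on the whole of \<open>H\<close>\<close>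
      define f' where "f' x = (if x \<in> \<Gamma> then f x else 0)" for x
      have fm: "f \<in> borel_measurable (borel_of ?T)" and fb: "bounded (f ` carrier ?G)"
        and fh: "\<And>g. g \<in> carrier ?G \<Longrightarrow> f g = (\<integral>x. f (g \<otimes>\<^bsub>?G\<^esub> x) \<partial>?\<mu>)"
        using f unfolding bounded_harmonic_def by blast+
      have "bounded (f ` \<Gamma>)" using fb by simp
      then obtain C where C: "\<And>g. g \<in> \<Gamma> \<Longrightarrow> \<bar>f g\<bar> \<le> C"
        unfolding bounded_real by blast
      have C0: "0 \<le> C" using C[OF subgroup.one_closed[OF assms(12)]] by linarith
      have m: "f' \<in> borel_measurable (borel_of TH)"
      proof -
        have "f \<in> borel_measurable (restrict_space (borel_of TH) \<Gamma>)"
          using fm sT by (simp cong: measurable_cong_sets)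
        moreover have "\<Gamma> \<inter> space (borel_of TH) \<in> sets (borel_of TH)" by (simp only: cap \<Gamma>s)
        ultimately have "(\<lambda>x. indicator \<Gamma> x *\<^sub>R f x) \<in> borel_measurable (borel_of TH)"
          by (simp only: borel_measurable_restrict_space_iff)
        then show ?thesis by (rule measurable_cong[THEN iffD1, rotated]) (auto simp: f'_def)
      qed
      have "W.R.harmonic_on_\<Gamma> C f'"
        unfolding W.R.harmonic_on_\<Gamma>_def unfolding TH[symmetric] H[symmetric]
      proof (intro conjI allI ballI m)
        show "\<bar>f' g\<bar> \<le> C" for g using C C0 by (simp add: f'_def)
        fix g assume g: "g \<in> \<Gamma>"
        have "f' g = (\<integral>x. f (g \<otimes>\<^bsub>H\<^esub> x) \<partial>?\<mu>)" using fh[of g] g by (simp add: f'_def)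
        also have "\<dots> = (\<integral>x. (if x \<in> \<Gamma> then f (g \<otimes>\<^bsub>H\<^esub> x) else 0) \<partial>\<mu>)" by (rule int_restrict)
        also have "\<dots> = (\<integral>x. f' (g \<otimes>\<^bsub>H\<^esub> x) \<partial>\<mu>)"
        proof (rule Bochner_Integration.integral_cong[OF refl])
          fix x assume "x \<in> space \<mu>"
          then have xc: "x \<in> carrier H" by (simp add: H)
          have "g \<otimes>\<^bsub>H\<^esub> x \<in> \<Gamma> \<longleftrightarrow> x \<in> \<Gamma>"
          proof
            assume a: "g \<otimes>\<^bsub>H\<^esub> x \<in> \<Gamma>"
            have "inv\<^bsub>H\<^esub> g \<otimes>\<^bsub>H\<^esub> (g \<otimes>\<^bsub>H\<^esub> x) \<in> \<Gamma>"
              using a g subgroup.m_closed[OF assms(12)] subgroup.m_inv_closed[OF assms(12)] by blast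
            moreover have "inv\<^bsub>H\<^esub> g \<otimes>\<^bsub>H\<^esub> (g \<otimes>\<^bsub>H\<^esub> x) = x"
              using W.R.lmult_cancel_inv(2)[OF W.R.\<Gamma>_carrier[OF g], of x] xc by (simp add: H)
            ultimately show "x \<in> \<Gamma>" by simp
          qed (use g subgroup.m_closed[OF assms(12)] in blast)
          then show "(if x \<in> \<Gamma> then f (g \<otimes>\<^bsub>H\<^esub> x) else 0) = f' (g \<otimes>\<^bsub>H\<^esub> x)" by (simp add: f'_def)
        qed
        finally show "f' g = (\<integral>x. f' (g \<otimes>\<^bsub>H\<^esub> x) \<partial>\<mu>)" .
      qed
      from W.harmonic_constant_if_mean_nonpositive[OF _ mean _ this] assms(11,16)
      have "f' g = f' \<one>\<^bsub>H\<^esub>" if "g \<in> \<Gamma>" for g using that by (simp add: H TH)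
      then show "\<exists>c. \<forall>g\<in>\<Gamma>. f g = c" by (auto simp: f'_def intro!: exI[of _ "f' \<one>\<^bsub>H\<^esub>"])
    qed
  next
    assume const: "\<forall>f. bounded_harmonic ?G ?T ?\<mu> f \<longrightarrow> (\<exists>c. \<forall>g\<in>\<Gamma>. f g = c)"
    show "(\<integral>g. real_of_int (snd g) \<partial>\<mu>) \<le> 0"
    proof (rule ccontr)
      assume "\<not> ?thesis"
      then have mean: "0 < (\<integral>g. real_of_int (snd g) \<partial>\<mu>)" by simp
      have "f g = f \<one>\<^bsub>H\<^esub>" if f: "W.R.harmonic_on_\<Gamma> 1 f" and g: "g \<in> \<Gamma>" for f g
      proof -
        have fm: "f \<in> borel_measurable (borel_of TH)" and f1: "\<And>g. \<bar>f g\<bar> \<le> 1"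
          and fh: "\<And>g. g \<in> \<Gamma> \<Longrightarrow> f g = (\<integral>x. f (g \<otimes>\<^bsub>H\<^esub> x) \<partial>\<mu>)"
          using f unfolding W.R.harmonic_on_\<Gamma>_def H TH by blast+
        have "bounded_harmonic ?G ?T ?\<mu> f"
          unfolding bounded_harmonic_def
        proof (intro conjI ballI)
          show "f \<in> borel_measurable (borel_of ?T)"
            using measurable_restrict_space1[OF fm, of \<Gamma>] sT by (simp cong: measurable_cong_sets)
          show "bounded (f ` carrier ?G)" unfolding bounded_real using f1 by blast
          fix g assume "g \<in> carrier ?G"
          then have g: "g \<in> \<Gamma>" by simp
          have gc: "g \<in> carrier H" using W.R.\<Gamma>_carrier[OF g] by (simp add: H)
          have mg: "(\<lambda>x. f (g \<otimes>\<^bsub>H\<^esub> x)) \<in> borel_measurable \<mu>"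
            using measurable_compose[OF W.R.measurable_lmult[OF W.R.\<Gamma>_carrier[OF g]], of f borel] fm
            by (simp add: H TH cong: measurable_cong_sets)
          have "f g = (\<integral>x. f (g \<otimes>\<^bsub>H\<^esub> x) \<partial>\<mu>)" by (rule fh[OF g])
          also have "\<dots> = (\<integral>x. (if x \<in> \<Gamma> then f (g \<otimes>\<^bsub>H\<^esub> x) else 0) \<partial>\<mu>)"
          proof (rule integral_cong_AE[OF mg])
            have "\<Gamma> \<inter> space \<mu> \<in> sets \<mu>" by (simp only: cap \<Gamma>\<mu>)
            then show "(\<lambda>x. if x \<in> \<Gamma> then f (g \<otimes>\<^bsub>H\<^esub> x) else 0) \<in> borel_measurable \<mu>"
              by (rule measurable_If_set[OF mg borel_measurable_const])
            show "AE x in \<mu>. f (g \<otimes>\<^bsub>H\<^esub> x) = (if x \<in> \<Gamma> then f (g \<otimes>\<^bsub>H\<^esub> x) else 0)"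
              using AE by eventually_elim simp
          qed
          also have "\<dots> = (\<integral>x. f (g \<otimes>\<^bsub>H\<^esub> x) \<partial>?\<mu>)" by (rule int_restrict[symmetric])
          finally show "f g = (\<integral>x. f (g \<otimes>\<^bsub>?G\<^esub> x) \<partial>?\<mu>)" by simp
        qed
        then obtain c where "\<And>g. g \<in> \<Gamma> \<Longrightarrow> f g = c" using const by blast
        then show ?thesis using g subgroup.one_closed[OF assms(12)] by metis
      qed
      then have "\<not> non_exceptional G \<alpha> V \<Gamma>"
        unfolding H by (intro W.constant_harmonic_imp_exceptional[OF mean]) blast
      then show False using assms(14) by simp
    qed
  qed
  then show ?thesis
    using poisson_boundary_trivial_iff_harmonic_constant[OF group top bp] W.mean_eq by simp
qed

end
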